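(* Let $n\geq 2$. For any Cantor set $C\subset\mathbb{R}^{n+1}$ there is an embedding $f:\mathbb{S}^n\to\mathbb{R}^{n+1}$ such that: (a) $f\in W^{1,n}(\mathbb{S}^n,\mathbb{R}^{n+1})$; (b) $C\subset f(\mathbb{S}^n)$; (c) $f^{-1}(C)\subset\mathbb{S}^n$ is a Cantor set of Hausdorff dimension zero; (d) $f$ is a smooth diffeomorphism in $\mathbb{S}^n\setminus f^{-1}(C)$ (that is, the restriction of $f$ to $\mathbb{S}^n\setminus f^{-1}(C)$ is a smooth diffeomorphism onto its image).
   Context: $\mathbb{S}^n$ is the standard unit sphere in $\mathbb{R}^{n+1}$. A Cantor set is any subset of a Euclidean space that is homeomorphic to the ternary Cantor set. An embedding is a homeomorphism onto its image, i.e. $f:X\to Y$ is an embedding if $f:X\to f(X)$ is a homeomorphism (a topological embedding; no smoothness is assumed). The Sobolev space $W^{1,p}$ consists of functions in $L^p$ whose distributional gradient is in $L^p$; $f\in W^{1,p}(\mathbb{S}^n,\mathbb{R}^{n+1})$ means that all components of $f:\mathbb{S}^n\to\mathbb{R}^{n+1}$ are in $W^{1,p}(\mathbb{S}^n)$. *)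

theory Defs
  imports "HOL-Analysis.Analysis"
begin

section \<open>Cantor sets\<close>

definition ternary_cantor_set :: "real set" where
  "ternary_cantor_set = {x. \<exists>a :: nat \<Rightarrow> real. (\<forall>k. a k \<in> {0, 2}) \<and> (\<lambda>k. a k / 3 ^ Suc k) sums x}"

definition cantor_set :: "'a::euclidean_space set \<Rightarrow> bool" where
  "cantor_set C \<longleftrightarrow> C homeomorphic ternary_cantor_set"


section \<open>Hausdorff measure and dimension\<close>

text \<open>Only exponents \<open>s > 0\<close> are used. Since \<open>0 powr 0 = 0\<close>, the formula would not give the
  counting measure for \<open>s = 0\<close>; leaving out \<open>s = 0\<close> does not change the infimum that
  defines the dimension. Boundedness of the covering sets is required because the library's
  \<open>diameter\<close> is real-valued and has no meaning on unbounded sets.\<close>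

definition hausdorff_content :: "real \<Rightarrow> real \<Rightarrow> 'a::metric_space set \<Rightarrow> ennreal" where
  "hausdorff_content \<delta> s A =
     (INF U \<in> {U :: nat \<Rightarrow> 'a set. A \<subseteq> (\<Union>i. U i) \<and> (\<forall>i. bounded (U i) \<and> diameter (U i) \<le> \<delta>)}.
        \<Sum>i. ennreal (diameter (U i) powr s))"

definition hausdorff_outer_measure :: "real \<Rightarrow> 'a::metric_space set \<Rightarrow> ennreal" where
  "hausdorff_outer_measure s A = (SUP \<delta> \<in> {0<..}. hausdorff_content \<delta> s A)"

definition hausdorff_dim :: "'a::metric_space set \<Rightarrow> ennreal" where
  "hausdorff_dim A = (INF s \<in> {s. 0 < s \<and> hausdorff_outer_measure s A = 0}. ennreal s)"


section \<open>Smooth maps\<close>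

text \<open>\<open>Ck_on k f U\<close> is meant for open \<open>U\<close>; in finite dimension it says that \<open>f\<close> is of class
  \<open>C\<^sup>k\<close> on \<open>U\<close>.\<close>

fun Ck_on :: "nat \<Rightarrow> ('a::euclidean_space \<Rightarrow> 'b::euclidean_space) \<Rightarrow> 'a set \<Rightarrow> bool" where
  "Ck_on 0 f U \<longleftrightarrow> continuous_on U f"
| "Ck_on (Suc k) f U \<longleftrightarrow>
     (\<forall>x\<in>U. f differentiable (at x)) \<and> (\<forall>v. Ck_on k (\<lambda>x. frechet_derivative f (at x) v) U)"

definition smooth_on_open :: "('a::euclidean_space \<Rightarrow> 'b::euclidean_space) \<Rightarrow> 'a set \<Rightarrow> bool" where
  "smooth_on_open f U \<longleftrightarrow> open U \<and> (\<forall>k. Ck_on k f U)"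

text \<open>A map on an arbitrary subset of a Euclidean space is smooth if it extends locally to smooth
  maps on open sets of the ambient space. On a submanifold, such as an open subset of the sphere,
  this agrees with smoothness in charts.\<close>

definition smooth_on :: "('a::euclidean_space \<Rightarrow> 'b::euclidean_space) \<Rightarrow> 'a set \<Rightarrow> bool" where
  "smooth_on f S \<longleftrightarrow>
     (\<forall>x\<in>S. \<exists>U F. x \<in> U \<and> smooth_on_open F U \<and> (\<forall>y \<in> S \<inter> U. F y = f y))"

text \<open>If \<open>S\<close> is a smooth submanifold, the existence of the smooth inverse makes \<open>f ` S\<close> a smooth
  submanifold as well, and \<open>f\<close> a diffeomorphism of manifolds.\<close>

definition diffeomorphism_onto_image ::
    "('a::euclidean_space \<Rightarrow> 'b::euclidean_space) \<Rightarrow> 'a set \<Rightarrow> bool" where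
  "diffeomorphism_onto_image f S \<longleftrightarrow>
     smooth_on f S \<and> (\<exists>g. smooth_on g (f ` S) \<and> (\<forall>x\<in>S. g (f x) = x))"


section \<open>Sobolev spaces on the unit sphere\<close>

text \<open>The surface measure of the unit sphere in polar coordinates: the measure of \<open>A\<close> is
  \<open>DIM('a)\<close> times the volume of the cone \<open>{t *\<^sub>R x | t x. 0 < t \<and> t < 1 \<and> x \<in> A}\<close>.\<close>

definition sphere_measure :: "'a::euclidean_space measure" where
  "sphere_measure =
     scale_measure (of_nat DIM('a))
       (distr (restrict_space lborel (ball 0 1 - {0})) (restrict_space borel (sphere 0 1)) sgn)"

text \<open>Smooth tangent vector fields, given by smooth fields on the whole space. Since the sphere is
  compact, all of its smooth tangent fields arise in this way.\<close>

definition sphere_vector_fields :: "('a::euclidean_space \<Rightarrow> 'a) set" where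
  "sphere_vector_fields = {X. smooth_on_open X UNIV \<and> (\<forall>x \<in> sphere 0 1. X x \<bullet> x = 0)}"

text \<open>The intrinsic divergence is the trace of the derivative over the tangent space \<open>x\<^sup>\<bottom>\<close>, which
  is the full trace minus the normal contribution. It only depends on \<open>X\<close> on the sphere.\<close>

definition sphere_div :: "('a::euclidean_space \<Rightarrow> 'a) \<Rightarrow> 'a \<Rightarrow> real" where
  "sphere_div X x =
     (\<Sum>b\<in>Basis. frechet_derivative X (at x) b \<bullet> b) - frechet_derivative X (at x) x \<bullet> x"

definition sphere_Lp :: "real \<Rightarrow> ('a::euclidean_space \<Rightarrow> 'b::euclidean_space) \<Rightarrow> bool" where
  "sphere_Lp p u \<longleftrightarrow>
     u \<in> borel_measurable sphere_measure \<and> integrable sphere_measure (\<lambda>x. norm (u x) powr p)"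

definition sphere_weak_gradient :: "('a::euclidean_space \<Rightarrow> real) \<Rightarrow> ('a \<Rightarrow> 'a) \<Rightarrow> bool" where
  "sphere_weak_gradient u G \<longleftrightarrow>
     (AE x in sphere_measure. G x \<bullet> x = 0) \<and>
     (\<forall>X \<in> sphere_vector_fields.
        (LINT x|sphere_measure. G x \<bullet> X x) = - (LINT x|sphere_measure. u x * sphere_div X x))"

text \<open>For \<open>p \<ge> 1\<close>. Both integrals in \<open>sphere_weak_gradient\<close> then converge, as \<open>u\<close> and \<open>G\<close> are
  in \<open>L\<^sup>p\<close>, the measure is finite and \<open>X\<close> is smooth.\<close>

definition sphere_W1p :: "real \<Rightarrow> ('a::euclidean_space \<Rightarrow> real) set" where
  "sphere_W1p p = {u. sphere_Lp p u \<and> (\<exists>G. sphere_Lp p G \<and> sphere_weak_gradient u G)}"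

end

theory Submission
  imports Defs
begin

text \<open>
  The sphere is deformed step by step, \<open>\<Psi>\<^sub>0, \<Psi>\<^sub>1, \<dots>\<close>, by homeomorphisms of the whole space that are
  diffeomorphisms away from the origin. Each step grows thin fingers out of the sphere into small
  neighbourhoods of pieces of \<open>C\<close>; from the tips of these fingers the next step grows thinner fingers
  towards smaller pieces. The maps converge uniformly, and the limit \<open>f\<close> differs from \<open>\<Psi>\<^sub>k\<close> only on finitely
  many small caps. A point that lies in such caps at every stage is sent into \<open>C\<close>, every other point
  has a neighbourhood on which \<open>f\<close> agrees with some \<open>\<Psi>\<^sub>k\<close>, and every point of \<open>C\<close> is reached. Hence
  \<open>f\<close> maps \<open>f\<^sup>-\<^sup>1(C)\<close> homeomorphically onto \<open>C\<close> and is a diffeomorphism off \<open>f\<^sup>-\<^sup>1(C)\<close>. The radii of the caps may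
  shrink as fast as one likes, which makes the dimension of \<open>f\<^sup>-\<^sup>1(C)\<close> zero.

  A finger is a composition \<open>\<Phi> \<circ> \<Psi>\<^sub>k \<circ> \<sigma>\<close> (\<open>finger_move\<close>). Here \<open>\<sigma>\<close> is a radial graph: it raises a straight spike
  over a tiny cap of the round sphere. The diffeomorphism \<open>\<Phi>\<close> has compact support off the image of the
  ball and drags the end of the spike to its goal (\<open>diffeo_moving_point\<close>). Embeddedness is therefore
  automatic, and the energy is under control although \<open>\<Phi>\<close> is not: \<open>\<Phi>\<close> is chosen first, and then the
  spike is made so thin that its energy is small even after multiplication with the Lipschitz constant of
  \<open>\<Phi> \<circ> \<Psi>\<^sub>k\<close>. This is possible because points have \<open>n\<close>-capacity zero in dimension \<open>n \<ge> 2\<close> (\<open>low_energy_spike\<close>).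

  The fingers need room. A totally disconnected compact set is covered by finitely many disjoint small
  continua that do not separate space, obtained by filling the holes of the components of a thin
  neighbourhood (\<open>totally_disconnected_filled_cover\<close>). Unicoherence of Euclidean space, and the fact that a
  straight segment does not separate an open connected set in dimension at least three, keep the
  remaining regions connected while the continua are served one after the other.

  For the Sobolev property, the total \<open>n\<close>-energies of the \<open>\<Psi>\<^sub>k\<close> are bounded, the gradients are eventually
  constant off the null set \<open>f\<^sup>-\<^sup>1(C)\<close>, and the measures of the caps tend to zero. The weak gradient equation passes
  to the limit from the smooth maps \<open>\<Psi>\<^sub>k\<close>, for which it is the divergence theorem on the sphere.
\<close>

section \<open>Calculus of smooth maps\<close>

lemma Ck_on_cong:
  assumes "open U" "\<And>x. x \<in> U \<Longrightarrow> f x = g x"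
  shows "Ck_on k f U \<longleftrightarrow> Ck_on k g U"
proof -
  have imp: "Ck_on k g U" if "Ck_on k f U" "\<And>x. x \<in> U \<Longrightarrow> f x = g x" for k and f g :: "'a \<Rightarrow> 'b"
    using that
  proof (induction k arbitrary: f g)
    case 0
    then show ?case using continuous_on_cong[of U U f g] by simp
  next
    case (Suc k)
    have d: "g differentiable (at x) \<and> frechet_derivative g (at x) = frechet_derivative f (at x)"
      if x: "x \<in> U" for x
    proof -
      have "f differentiable (at x)" using Suc.prems x by simp
      then have "(f has_derivative frechet_derivative f (at x)) (at x)"
        using frechet_derivative_works by blast
      then have "(g has_derivative frechet_derivative f (at x)) (at x)"
        by (rule has_derivative_transform_within_open[OF _ \<open>open U\<close> x]) (simp add: Suc.prems)
      then show ?thesis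
        by (metis differentiable_def frechet_derivative_at)
    qed
    show ?case
      using Suc.IH[of "\<lambda>x. frechet_derivative f (at x) _" "\<lambda>x. frechet_derivative g (at x) _"] Suc.prems d
      by auto
  qed
  show ?thesis using imp[of k f g] imp[of k g f] assms(2) by auto
qed

lemma Ck_on_subset:
  assumes "Ck_on k f U" "V \<subseteq> U"
  shows "Ck_on k f V"
  using assms
  by (induction k arbitrary: f) (auto intro: continuous_on_subset)

lemma Ck_on_SucD:
  assumes "Ck_on (Suc k) f U"
  shows "Ck_on k f U"
  using assms
proof (induction k arbitrary: f)
  case 0
  then show ?case
    by (auto intro!: continuous_at_imp_continuous_on differentiable_imp_continuous_within)
next
  case (Suc k)
  then show ?case by (metis Ck_on.simps(2))
qed

lemma Ck_on_SucI:
  assumes "\<And>x. x \<in> U \<Longrightarrow> (f has_derivative f' x) (at x)" "\<And>v. Ck_on k (\<lambda>x. f' x v) U" "open U"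
  shows "Ck_on (Suc k) f U"
proof -
  have "frechet_derivative f (at x) = f' x" if "x \<in> U" for x
    using assms(1)[OF that] frechet_derivative_at by metis
  then have "Ck_on k (\<lambda>x. frechet_derivative f (at x) v) U" for v
    using Ck_on_cong[OF \<open>open U\<close>, of "\<lambda>x. frechet_derivative f (at x) v" "\<lambda>x. f' x v" k] assms(2) by auto
  then show ?thesis using assms(1) differentiable_def by fastforce
qed

lemma Ck_on_SucE:
  assumes "Ck_on (Suc k) f U"
  obtains f' where "\<And>x. x \<in> U \<Longrightarrow> (f has_derivative f' x) (at x)" "\<And>v. Ck_on k (\<lambda>x. f' x v) U"
  using assms that[of "\<lambda>x. frechet_derivative f (at x)"] frechet_derivative_works by force

lemma Ck_on_const: "open U \<Longrightarrow> Ck_on k (\<lambda>x. c) U"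
proof (induction k arbitrary: c)
  case (Suc k)
  show ?case
    by (rule Ck_on_SucI[where f' = "\<lambda>x v. 0"]) (use Suc in auto)
qed simp

lemma Ck_on_linear:
  assumes "bounded_linear f" "open U"
  shows "Ck_on k f U"
proof (cases k)
  case 0
  then show ?thesis using assms linear_continuous_on by auto
next
  case (Suc j)
  show ?thesis unfolding Suc
    by (rule Ck_on_SucI[where f' = "\<lambda>x. f"])
      (use assms Ck_on_const bounded_linear_imp_has_derivative in auto)
qed

lemma Ck_on_add:
  assumes "Ck_on k f U" "Ck_on k g U" "open U"
  shows "Ck_on k (\<lambda>x. f x + g x) U"
  using assms(1,2)
proof (induction k arbitrary: f g)
  case 0
  then show ?case by (auto intro: continuous_intros)
next
  case (Suc k)
  obtain f' g' where "\<And>x. x \<in> U \<Longrightarrow> (f has_derivative f' x) (at x)" "\<And>v. Ck_on k (\<lambda>x. f' x v) U"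
     "\<And>x. x \<in> U \<Longrightarrow> (g has_derivative g' x) (at x)" "\<And>v. Ck_on k (\<lambda>x. g' x v) U"
    using Suc.prems by (metis Ck_on_SucE)
  then show ?case
    by (intro Ck_on_SucI[where f' = "\<lambda>x v. f' x v + g' x v"])
      (auto intro: Suc.IH has_derivative_add assms(3))
qed

lemma Ck_on_bilinear:
  fixes f :: "'d::euclidean_space \<Rightarrow> 'a::euclidean_space" and g :: "'d \<Rightarrow> 'b::euclidean_space"
    and prod :: "'a \<Rightarrow> 'b \<Rightarrow> 'c::euclidean_space"
  assumes B: "bounded_bilinear prod" and "Ck_on k f U" "Ck_on k g U" "open U"
  shows "Ck_on k (\<lambda>x. prod (f x) (g x)) U"
  using assms(2,3)
proof (induction k arbitrary: f g)
  case 0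
  then show ?case using bounded_bilinear.continuous_on[OF B] by auto
next
  case (Suc k)
  obtain f' g' where "\<And>x. x \<in> U \<Longrightarrow> (f has_derivative f' x) (at x)" "\<And>v. Ck_on k (\<lambda>x. f' x v) U"
     "\<And>x. x \<in> U \<Longrightarrow> (g has_derivative g' x) (at x)" "\<And>v. Ck_on k (\<lambda>x. g' x v) U"
    using Suc.prems by (metis Ck_on_SucE)
  moreover have "Ck_on k f U" "Ck_on k g U"
    using Suc.prems Ck_on_SucD by auto
  ultimately show ?case
    by (intro Ck_on_SucI[where f' = "\<lambda>x v. prod (f x) (g' x v) + prod (f' x v) (g x)"])
      (auto intro!: Ck_on_add Suc.IH bounded_bilinear.FDERIV[OF B] assms(4))
qed

lemma Ck_on_compose_linear:
  assumes "bounded_linear L" "Ck_on k f U" "open U"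
  shows "Ck_on k (\<lambda>x. L (f x)) U"
  using assms(2)
proof (induction k arbitrary: f)
  case 0
  then show ?case using bounded_linear.continuous_on[OF assms(1)] by auto
next
  case (Suc k)
  obtain f' where "\<And>x. x \<in> U \<Longrightarrow> (f has_derivative f' x) (at x)" "\<And>v. Ck_on k (\<lambda>x. f' x v) U"
    using Suc.prems by (metis Ck_on_SucE)
  then show ?case
    by (intro Ck_on_SucI[where f' = "\<lambda>x v. L (f' x v)"])
      (auto intro!: Suc.IH bounded_linear.has_derivative[OF assms(1)] assms(3))
qed

lemma Ck_on_sum:
  assumes "\<And>i. i \<in> I \<Longrightarrow> Ck_on k (f i) U" "open U"
  shows "Ck_on k (\<lambda>x. \<Sum>i\<in>I. f i x) U"
  using assms by (induction I rule: infinite_finite_induct) (auto intro: Ck_on_const Ck_on_add)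

text \<open>Expanding the inner derivative in the standard basis writes the derivative of \<open>g \<circ> f\<close> as a sum of
  products of maps of class \<open>C\<^sup>k\<close>, to which the induction hypothesis and the product rule apply.\<close>

lemma Ck_on_compose:
  fixes f :: "'a::euclidean_space \<Rightarrow> 'b::euclidean_space" and g :: "'b \<Rightarrow> 'c::euclidean_space"
  assumes "Ck_on k g V" "Ck_on k f U" "f ` U \<subseteq> V" "open U" "open V"
  shows "Ck_on k (\<lambda>x. g (f x)) U"
  using assms(1,2)
proof (induction k arbitrary: g)
  case 0
  then show ?case using continuous_on_compose2[of V g U f] assms(3) by auto
next
  case (Suc k)
  obtain f' g' where f': "\<And>x. x \<in> U \<Longrightarrow> (f has_derivative f' x) (at x)" "\<And>v. Ck_on k (\<lambda>x. f' x v) U"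
    and g': "\<And>x. x \<in> V \<Longrightarrow> (g has_derivative g' x) (at x)" "\<And>v. Ck_on k (\<lambda>x. g' x v) V"
    using Suc.prems by (metis Ck_on_SucE)
  have fk: "Ck_on k f U" using Suc.prems Ck_on_SucD by auto
  show ?case
  proof (rule Ck_on_SucI[where f' = "\<lambda>x v. \<Sum>b\<in>Basis. (f' x v \<bullet> b) *\<^sub>R g' (f x) b"])
    fix x assume x: "x \<in> U"
    then have fx: "f x \<in> V" using assms(3) by auto
    have "((\<lambda>x. g (f x)) has_derivative (\<lambda>v. g' (f x) (f' x v))) (at x)"
      using diff_chain_at[OF f'(1)[OF x] g'(1)[OF fx]] by (simp add: o_def)
    moreover have "g' (f x) (f' x v) = (\<Sum>b\<in>Basis. (f' x v \<bullet> b) *\<^sub>R g' (f x) b)" for v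
    proof -
      have L: "linear (g' (f x))" using g'(1)[OF fx] has_derivative_linear by auto
      have "g' (f x) (f' x v) = g' (f x) (\<Sum>b\<in>Basis. (f' x v \<bullet> b) *\<^sub>R b)"
        by (simp add: euclidean_representation)
      then show ?thesis by (simp only: linear_sum[OF L] linear_scale[OF L])
    qed
    ultimately show "((\<lambda>x. g (f x)) has_derivative (\<lambda>v. \<Sum>b\<in>Basis. (f' x v \<bullet> b) *\<^sub>R g' (f x) b)) (at x)"
      by simp
  next
    fix v
    show "Ck_on k (\<lambda>x. \<Sum>b\<in>Basis. (f' x v \<bullet> b) *\<^sub>R g' (f x) b) U"
    proof (rule Ck_on_sum)
      fix b :: 'b assume "b \<in> Basis"
      show "Ck_on k (\<lambda>x. (f' x v \<bullet> b) *\<^sub>R g' (f x) b) U"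
        by (intro Ck_on_bilinear[OF bounded_bilinear_scaleR] Suc.IH[of "\<lambda>y. g' y b"] g'(2) fk \<open>open U\<close>
             Ck_on_compose_linear[OF bounded_linear_inner_left f'(2)])
    qed fact
  qed fact
qed

lemma Ck_on_real:
  fixes f f' :: "real \<Rightarrow> real"
  assumes "\<And>x. x \<in> U \<Longrightarrow> (f has_field_derivative f' x) (at x)" "Ck_on k f' U" "open U"
  shows "Ck_on (Suc k) f U"
  by (rule Ck_on_SucI[where f' = "\<lambda>x v. f' x * v"])
    (use assms in \<open>auto simp: has_field_derivative_def intro!: Ck_on_bilinear[OF bounded_bilinear_mult] Ck_on_const\<close>)

lemma smooth_on_open_cong:
  "\<lbrakk>smooth_on_open f U; \<And>x. x \<in> U \<Longrightarrow> f x = g x\<rbrakk> \<Longrightarrow> smooth_on_open g U"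
  unfolding smooth_on_open_def using Ck_on_cong by blast

lemma smooth_on_open_subset: "\<lbrakk>smooth_on_open f U; open V; V \<subseteq> U\<rbrakk> \<Longrightarrow> smooth_on_open f V"
  unfolding smooth_on_open_def using Ck_on_subset by blast

lemma smooth_on_open_const: "open U \<Longrightarrow> smooth_on_open (\<lambda>x. c) U"
  by (simp add: smooth_on_open_def Ck_on_const)

lemma smooth_on_open_linear: "bounded_linear f \<Longrightarrow> open U \<Longrightarrow> smooth_on_open f U"
  by (simp add: smooth_on_open_def Ck_on_linear)

lemma smooth_on_open_id: "open U \<Longrightarrow> smooth_on_open (\<lambda>x. x) U"
  by (simp add: smooth_on_open_linear bounded_linear_ident)

lemma smooth_on_open_add:
  "smooth_on_open f U \<Longrightarrow> smooth_on_open g U \<Longrightarrow> smooth_on_open (\<lambda>x. f x + g x) U"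
  by (simp add: smooth_on_open_def Ck_on_add)

lemma smooth_on_open_sum:
  "open U \<Longrightarrow> (\<And>i. i \<in> I \<Longrightarrow> smooth_on_open (f i) U) \<Longrightarrow> smooth_on_open (\<lambda>x. \<Sum>i\<in>I. f i x) U"
  by (simp add: smooth_on_open_def Ck_on_sum)

lemma smooth_on_open_compose_linear:
  "bounded_linear L \<Longrightarrow> smooth_on_open f U \<Longrightarrow> smooth_on_open (\<lambda>x. L (f x)) U"
  by (simp add: smooth_on_open_def Ck_on_compose_linear)

lemma smooth_on_open_minus: "smooth_on_open f U \<Longrightarrow> smooth_on_open (\<lambda>x. - f x) U"
  by (rule smooth_on_open_compose_linear[OF bounded_linear_minus[OF bounded_linear_ident]])

lemma smooth_on_open_diff:
  "smooth_on_open f U \<Longrightarrow> smooth_on_open g U \<Longrightarrow> smooth_on_open (\<lambda>x. f x - g x) U"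
  using smooth_on_open_add[OF _ smooth_on_open_minus, of f U g] by simp

lemma smooth_on_open_scaleR:
  "smooth_on_open f U \<Longrightarrow> smooth_on_open g U \<Longrightarrow> smooth_on_open (\<lambda>x. f x *\<^sub>R g x) U"
  by (simp add: smooth_on_open_def Ck_on_bilinear[OF bounded_bilinear_scaleR])

lemma smooth_on_open_mult:
  fixes f g :: "_ \<Rightarrow> real"
  shows "smooth_on_open f U \<Longrightarrow> smooth_on_open g U \<Longrightarrow> smooth_on_open (\<lambda>x. f x * g x) U"
  by (simp add: smooth_on_open_def Ck_on_bilinear[OF bounded_bilinear_mult])

lemma smooth_on_open_inner:
  "smooth_on_open f U \<Longrightarrow> smooth_on_open g U \<Longrightarrow> smooth_on_open (\<lambda>x. f x \<bullet> g x) U"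
  by (simp add: smooth_on_open_def Ck_on_bilinear[OF bounded_bilinear_inner])

lemma smooth_on_open_compose:
  "smooth_on_open g V \<Longrightarrow> smooth_on_open f U \<Longrightarrow> f ` U \<subseteq> V \<Longrightarrow> smooth_on_open (\<lambda>x. g (f x)) U"
  unfolding smooth_on_open_def using Ck_on_compose[of _ g V f U] by auto

lemma smooth_on_open_local:
  assumes "open U" "\<And>x. x \<in> U \<Longrightarrow> \<exists>V. x \<in> V \<and> smooth_on_open f V"
  shows "smooth_on_open f U"
proof -
  have "Ck_on k f U" if "\<And>x. x \<in> U \<Longrightarrow> \<exists>V. x \<in> V \<and> open V \<and> Ck_on k f V" for k and f :: "'a \<Rightarrow> 'b"
    using that
  proof (induction k arbitrary: f)
    case 0
    then show ?case
      by (metis Ck_on.simps(1) continuous_at_imp_continuous_on continuous_on_eq_continuous_at)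
  next
    case (Suc k)
    then show ?case by (metis Ck_on.simps(2))
  qed
  note Ck = this
  show ?thesis
    unfolding smooth_on_open_def
  proof (intro conjI allI)
    fix k
    show "Ck_on k f U"
    proof (rule Ck)
      fix x assume "x \<in> U"
      then obtain V where "x \<in> V" "smooth_on_open f V" using assms(2) by blast
      then show "\<exists>V. x \<in> V \<and> open V \<and> Ck_on k f V"
        unfolding smooth_on_open_def by (intro exI[of _ V]) simp
    qed
  qed fact
qed

lemma smooth_on_open_differentiable:
  "smooth_on_open f U \<Longrightarrow> x \<in> U \<Longrightarrow> f differentiable (at x)"
  unfolding smooth_on_open_def by (metis Ck_on.simps(2))

lemma smooth_on_open_has_derivative:
  "smooth_on_open f U \<Longrightarrow> x \<in> U \<Longrightarrow> (f has_derivative frechet_derivative f (at x)) (at x)"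
  using smooth_on_open_differentiable frechet_derivative_works by blast

lemma smooth_on_open_frechet:
  "smooth_on_open f U \<Longrightarrow> smooth_on_open (\<lambda>x. frechet_derivative f (at x) v) U"
  unfolding smooth_on_open_def by (metis Ck_on.simps(2))

lemma smooth_on_open_continuous: "smooth_on_open f U \<Longrightarrow> continuous_on U f"
  unfolding smooth_on_open_def by (metis Ck_on.simps(1))

lemma smooth_on_open_open: "smooth_on_open f U \<Longrightarrow> open U"
  by (simp add: smooth_on_open_def)

lemma Ck_on_sin_cos: "Ck_on k (sin :: real \<Rightarrow> real) UNIV \<and> Ck_on k (cos :: real \<Rightarrow> real) UNIV"
proof (induction k)
  case (Suc k)
  have "Ck_on k (\<lambda>x. - sin x :: real) UNIV"
    using Suc Ck_on_compose_linear[OF bounded_linear_minus[OF bounded_linear_ident], of k sin UNIV] by (auto simp del: Ck_on.simps)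
  then show ?case
    using Suc Ck_on_real[of UNIV sin cos k] Ck_on_real[of UNIV cos "\<lambda>x. - sin x" k] DERIV_sin DERIV_cos
    by (auto simp del: Ck_on.simps(2))
qed (auto intro: continuous_intros)

lemma Ck_on_inverse: "Ck_on k (inverse :: real \<Rightarrow> real) (-{0})"
proof (induction k)
  case (Suc k)
  have "Ck_on k (\<lambda>x. - (inverse x * inverse x) :: real) (-{0})"
    using Ck_on_compose_linear[OF bounded_linear_minus[OF bounded_linear_ident]
        Ck_on_bilinear[OF bounded_bilinear_mult Suc Suc]] by (auto simp del: Ck_on.simps)
  then show ?case
    by (intro Ck_on_real[of _ inverse "\<lambda>x. - (inverse x * inverse x)"])
      (auto intro!: derivative_eq_intros)
qed (auto intro: continuous_intros)

lemma smooth_on_open_sin: "smooth_on_open f U \<Longrightarrow> smooth_on_open (\<lambda>x. sin (f x) :: real) U"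
  by (rule smooth_on_open_compose[of sin UNIV]) (auto simp: smooth_on_open_def Ck_on_sin_cos)

lemma smooth_on_open_cos: "smooth_on_open f U \<Longrightarrow> smooth_on_open (\<lambda>x. cos (f x) :: real) U"
  by (rule smooth_on_open_compose[of cos UNIV]) (auto simp: smooth_on_open_def Ck_on_sin_cos)

lemma smooth_on_open_inverse:
  "smooth_on_open f U \<Longrightarrow> (\<And>x. x \<in> U \<Longrightarrow> f x \<noteq> 0) \<Longrightarrow> smooth_on_open (\<lambda>x. inverse (f x) :: real) U"
  by (rule smooth_on_open_compose[of inverse "-{0}"]) (auto simp: smooth_on_open_def Ck_on_inverse)

lemma Ck_on_sqrt: "Ck_on k sqrt {0<..}"
proof (induction k)
  case 0
  then show ?case by (auto intro: continuous_intros)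
next
  case (Suc k)
  have "Ck_on k (\<lambda>x. inverse (sqrt x)) {0<..}"
    by (rule Ck_on_compose[OF Ck_on_inverse Suc]) auto
  then have "Ck_on k (\<lambda>x. inverse (sqrt x) / 2) {0<..}"
    by (rule Ck_on_compose_linear[OF bounded_linear_divide]) auto
  then show ?case
    by (intro Ck_on_real[of _ sqrt "\<lambda>x. inverse (sqrt x) / 2"]) (auto intro!: derivative_eq_intros)
qed

lemma smooth_on_open_norm: "smooth_on_open (norm :: 'a::euclidean_space \<Rightarrow> real) (-{0})"
proof -
  have "smooth_on_open (\<lambda>x::'a. sqrt (x \<bullet> x)) (-{0})"
    by (rule smooth_on_open_compose[of sqrt "{0<..}"])
      (auto simp: smooth_on_open_def[of sqrt] Ck_on_sqrt intro!: smooth_on_open_inner smooth_on_open_id)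
  then show ?thesis by (simp add: norm_eq_sqrt_inner[abs_def])
qed

lemma smooth_on_open_sgn: "smooth_on_open (sgn :: 'a::euclidean_space \<Rightarrow> 'a) (-{0})"
  unfolding sgn_div_norm[abs_def]
  by (intro smooth_on_open_scaleR smooth_on_open_inverse smooth_on_open_norm smooth_on_open_id) auto

text \<open>The extension by zero of \<open>t\<^sup>-\<^sup>m exp (- 1 / t)\<close>. The whole family is treated at once because the derivative of
  each member is a linear combination of other members.\<close>

definition flat :: "nat \<Rightarrow> real \<Rightarrow> real" where
  "flat m t = (if t > 0 then inverse t ^ m * exp (- inverse t) else 0)"

lemma flat_le:
  assumes "t > 0"
  shows "flat m t \<le> fact (m + 2) * t\<^sup>2"
proof -
  have "inverse t ^ (m + 2) / fact (m + 2) \<le> exp (inverse t)"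
    unfolding exp_def using assms
    by (intro order_trans[OF _ sum_le_suminf[of "\<lambda>n. inverse t ^ n /\<^sub>R fact n" "{m + 2}"]] summable_exp_generic)
       (auto simp: divide_inverse mult.commute simp del: fact_Suc power_Suc add_2_eq_Suc add_2_eq_Suc')
  then have "fact (m + 2) * (inverse t ^ (m + 2) / fact (m + 2)) * exp (- inverse t)
      \<le> fact (m + 2) * exp (inverse t) * exp (- inverse t)"
    by (intro mult_right_mono mult_left_mono) auto
  then have "inverse t ^ (m + 2) * exp (- inverse t) \<le> fact (m + 2)"
    by (simp only: mult.assoc exp_minus_inverse times_divide_eq_right
        nonzero_mult_div_cancel_left[OF fact_nonzero] mult_1_right)
  then have "inverse t ^ (m + 2) * exp (- inverse t) * t\<^sup>2 \<le> fact (m + 2) * t\<^sup>2"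
    by (intro mult_right_mono) auto
  moreover have "inverse t ^ (m + 2) * exp (- inverse t) * t\<^sup>2 = flat m t"
    using assms by (simp add: flat_def power_add field_simps power2_eq_square)
  ultimately show ?thesis by simp
qed

lemma flat_nonneg: "0 \<le> flat m t"
  by (simp add: flat_def)

lemma flat_derivative:
  "(flat m has_field_derivative (flat (m + 2) t - m * flat (m + 1) t)) (at t)"
proof -
  consider "t < 0" | "t = 0" | "t > 0" by linarith
  then show ?thesis
  proof cases
    case 1
    have "((\<lambda>t. 0) has_field_derivative 0) (at t)" by simp
    then have "(flat m has_field_derivative 0) (at t)"
      by (rule DERIV_cong_ev[THEN iffD1, rotated -1])
         (auto simp: flat_def eventually_nhds 1 intro!: exI[of _ "{..<0}"])
    then show ?thesis using 1 by (simp add: flat_def)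
  next
    case 2
    have "((\<lambda>h. flat m h / h) \<longlongrightarrow> 0) (at 0)"
    proof (rule Lim_null_comparison)
      show "\<forall>\<^sub>F h in at 0. norm (flat m h / h) \<le> fact (m + 2) * \<bar>h\<bar>"
      proof (rule always_eventually, rule allI)
        fix h
        show "norm (flat m h / h) \<le> fact (m + 2) * \<bar>h\<bar>"
          using flat_le[of h m] flat_nonneg[of m h]
          by (cases "h > 0")
            (auto simp: flat_def[of m h] pos_divide_le_eq power2_eq_square mult.assoc mult_nonneg_nonpos simp del: fact_Suc)
      qed
      show "((\<lambda>h. fact (m + 2) * \<bar>h\<bar>) \<longlongrightarrow> 0) (at (0::real))"
        by (auto intro!: tendsto_eq_intros)
    qed
    then show ?thesis using 2 by (simp add: DERIV_def flat_def)
  next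
    case 3
    have "((\<lambda>t. inverse t ^ m * exp (- inverse t)) has_field_derivative
        (flat (m + 2) t - m * flat (m + 1) t)) (at t)"
      using 3
      by (auto intro!: derivative_eq_intros simp: flat_def) (cases m; simp add: field_simps power2_eq_square)
    then show ?thesis
      by (rule DERIV_cong_ev[THEN iffD1, rotated -1])
         (use 3 in \<open>auto simp: flat_def eventually_nhds intro!: exI[of _ "{0<..}"]\<close>)
  qed
qed

lemma Ck_on_flat: "Ck_on k (flat m) UNIV"
proof (induction k arbitrary: m)
  case 0
  then show ?case
    using flat_derivative DERIV_isCont by (fastforce intro: continuous_at_imp_continuous_on)
next
  case (Suc k)
  have "Ck_on k (\<lambda>t. flat (m + 2) t + (- m) * flat (m + 1) t) UNIV"
    by (intro Ck_on_add Suc Ck_on_bilinear[OF bounded_bilinear_mult] Ck_on_const) auto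
  then show ?case
    by (intro Ck_on_real[where f' = "\<lambda>t. flat (m + 2) t - m * flat (m + 1) t"])
       (use flat_derivative in auto)
qed

definition cutoff :: "real \<Rightarrow> real" where
  "cutoff q = flat 0 (1 - q) / (flat 0 (1 - q) + flat 0 (q - 1/2))"

lemma flat_0_pos: "t > 0 \<Longrightarrow> flat 0 t > 0"
  by (simp add: flat_def)

lemma cutoff_denominator_pos: "flat 0 (1 - q) + flat 0 (q - 1/2) > 0"
  using flat_0_pos[of "1 - q"] flat_0_pos[of "q - 1/2"] flat_nonneg[of 0 "1 - q"] flat_nonneg[of 0 "q - 1/2"]
  by (cases "q < 1") auto

lemma cutoff_bounds: "0 \<le> cutoff q" "cutoff q \<le> 1"
  using cutoff_denominator_pos[of q] flat_nonneg by (auto simp: cutoff_def field_simps)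

lemma cutoff_eq_1: "q \<le> 1/2 \<Longrightarrow> cutoff q = 1"
  using cutoff_denominator_pos[of q] by (simp add: cutoff_def flat_def)

lemma cutoff_eq_0: "q \<ge> 1 \<Longrightarrow> cutoff q = 0"
  by (simp add: cutoff_def flat_def)

lemma smooth_on_open_cutoff: "smooth_on_open f U \<Longrightarrow> smooth_on_open (\<lambda>x. cutoff (f x)) U"
proof -
  have fl: "smooth_on_open (\<lambda>x. flat 0 (g x)) UNIV" if "smooth_on_open g UNIV" for g :: "real \<Rightarrow> real"
    by (rule smooth_on_open_compose[OF _ that, of _ UNIV]) (auto simp: smooth_on_open_def Ck_on_flat)
  have "smooth_on_open cutoff UNIV"
    unfolding cutoff_def[abs_def] divide_inverse
    by (intro smooth_on_open_mult smooth_on_open_inverse smooth_on_open_add fl smooth_on_open_diff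
          smooth_on_open_id smooth_on_open_const) (use cutoff_denominator_pos in \<open>auto simp: less_le\<close>)
  then show "smooth_on_open f U \<Longrightarrow> smooth_on_open (\<lambda>x. cutoff (f x)) U"
    by (rule smooth_on_open_compose) auto
qed

section \<open>Connectedness of regions in Euclidean space\<close>

lemma connected_thickening:
  fixes T :: "'a::real_normed_vector set"
  assumes "connected T"
  shows "connected (\<Union>x\<in>T. ball x r)"
proof -
  have "(\<Union>x\<in>T. ball x r) = (\<lambda>(x, y). x + y) ` (T \<times> ball 0 r)"
  proof -
    have "y \<in> (\<lambda>(x, y). x + y) ` (T \<times> ball 0 r)" if "x \<in> T" "y \<in> ball x r" for x y
      using that by (intro image_eqI[of _ _ "(x, y - x)"]) (auto simp: dist_norm norm_minus_commute)
    then show ?thesis by (auto simp: dist_norm)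
  qed
  moreover have "connected ((\<lambda>(x, y). x + y) ` (T \<times> ball 0 r))"
    using assms by (intro connected_continuous_image connected_Times)
      (auto intro!: continuous_intros simp: case_prod_unfold)
  ultimately show ?thesis by simp
qed

lemma negligible_line:
  fixes s :: "'a::euclidean_space"
  assumes "2 \<le> DIM('a)" "L \<subseteq> range (\<lambda>r. r *\<^sub>R s)"
  shows "negligible L"
proof -
  have "dim (span {s}) < DIM('a)" using dim_le_card'[of "{s}"] assms(1) by (simp del: dim_insert dim_singleton)
  then have "negligible (span {s})" by (rule negligible_lowdim)
  then show ?thesis by (rule negligible_subset) (use assms(2) in \<open>simp add: span_singleton\<close>)
qed

text \<open>Two points off the line can be joined through a third one. It has to avoid the planes that each of
  them spans with the line, and these are null sets in dimension at least three.\<close>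

lemma connected_convex_diff_line:
  fixes s :: "'a::euclidean_space"
  assumes U: "open U" "convex U" and dim: "3 \<le> DIM('a)" and L: "L \<subseteq> range (\<lambda>r. r *\<^sub>R s)"
  shows "connected (U - L)"
proof -
  let ?l = "range (\<lambda>r. r *\<^sub>R s)"
  have neg: "negligible (span {a, s})" for a
    by (rule negligible_lowdim) (use dim dim_le_card'[of "{a, s}"] card_insert_le_m1[of 2 "{s}" a] in auto)
  have negl: "negligible ?l"
    by (rule negligible_subset[OF neg[of s]]) (auto simp: span_breakdown_eq)
  have "\<exists>m\<in>U - ?l. closed_segment a m \<subseteq> U - ?l \<and> closed_segment b m \<subseteq> U - ?l"
    if ab: "a \<in> U - ?l" "b \<in> U - ?l" for a b
  proof -
    have "\<not> U \<subseteq> span {a, s} \<union> span {b, s}"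
      using neg[of a] neg[of b] open_not_negligible[OF U(1)] negligible_Un negligible_subset ab by blast
    then obtain m where m: "m \<in> U" "m \<notin> span {a, s}" "m \<notin> span {b, s}" by blast
    have seg: "closed_segment c m \<subseteq> U - ?l" if c: "c \<in> U - ?l" "m \<notin> span {c, s}" for c
    proof
      fix x assume x: "x \<in> closed_segment c m"
      then obtain u where u: "x = (1 - u) *\<^sub>R c + u *\<^sub>R m" by (auto simp: closed_segment_def)
      have "x \<notin> ?l"
      proof
        assume "x \<in> ?l"
        then obtain r where r: "x = r *\<^sub>R s" by auto
        show False
        proof (cases "u = 0")
          case True
          then show False using u r c by auto
        next
          case False
          have "u *\<^sub>R m = r *\<^sub>R s - (1 - u) *\<^sub>R c" using u r by (simp add: algebra_simps)
          then have "u *\<^sub>R m \<in> span {c, s}" by (metis insertI1 insertI2 span_base span_diff span_scale)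
          then have "m \<in> span {c, s}" using False
            by (metis span_scale[of "u *\<^sub>R m" _ "inverse u"] left_inverse scaleR_one scaleR_scaleR)
          then show False using c by simp
        qed
      qed
      moreover have "x \<in> U" using x c m U(2) closed_segment_subset by blast
      ultimately show "x \<in> U - ?l" by simp
    qed
    have "m \<notin> ?l"
      using m(2) by (auto intro: span_scale span_base)
    then show ?thesis using seg ab m by (intro bexI[of _ m]) auto
  qed
  note join = this
  have "path_component (U - ?l) a b" if ab: "a \<in> U - ?l" "b \<in> U - ?l" for a b
  proof -
    obtain m where m: "closed_segment a m \<subseteq> U - ?l" "closed_segment b m \<subseteq> U - ?l" using join[OF ab] by blast
    have seg: "path_component (U - ?l) c m" if "closed_segment c m \<subseteq> U - ?l" for c
      unfolding path_component_def using that by (intro exI[of _ "linepath c m"]) auto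
    show ?thesis using path_component_trans[OF seg[OF m(1)] path_component_sym[OF seg[OF m(2)]]] .
  qed
  then have "connected (U - ?l)"
    by (simp add: path_connected_component path_connected_imp_connected)
  then show ?thesis
  proof (rule connected_intermediate_closure)
    have "U \<subseteq> closure (U - ?l)"
    proof
      fix x assume x: "x \<in> U"
      show "x \<in> closure (U - ?l)"
        unfolding closure_iff_nhds_not_empty
      proof (intro allI impI)
        fix A V assume "V \<subseteq> A" "open V" "x \<in> V"
        then have "\<not> V \<inter> U \<subseteq> ?l"
          using x negl open_not_negligible[of "V \<inter> U"] negligible_subset U(1) by (metis IntI empty_iff open_Int)
        then show "(U - ?l) \<inter> A \<noteq> {}" using \<open>V \<subseteq> A\<close> by blast
      qed
    qed
    then show "U - L \<subseteq> closure (U - ?l)" by blast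
  qed (use L in blast)
qed

text \<open>A part of a line has codimension at least two, so by the convex case it separates no ball;
  a separation of the complement would therefore extend to the whole open set.\<close>

lemma connected_open_diff_line:
  fixes s :: "'a::euclidean_space"
  assumes W: "open W" "connected W" and dim: "3 \<le> DIM('a)" and L: "L \<subseteq> range (\<lambda>r. r *\<^sub>R s)"
  shows "connected (W - L)"
proof (rule ccontr)
  assume "\<not> connected (W - L)"
  then obtain A B where AB: "closedin (top_of_set (W - L)) A" "closedin (top_of_set (W - L)) B"
    "A \<union> B = W - L" "A \<inter> B = {}" "A \<noteq> {}" "B \<noteq> {}"
    by (auto simp: connected_closedin_eq)
  have loc: "\<exists>e>0. ball x e \<subseteq> W \<and> (ball x e - L \<subseteq> A \<or> ball x e - L \<subseteq> B) \<and> ball x e - L \<noteq> {}"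
    if "x \<in> W" for x
  proof -
    obtain e where e: "e > 0" "ball x e \<subseteq> W" using openE[OF W(1) \<open>x \<in> W\<close>] by metis
    have c: "connected (ball x e - L)" by (rule connected_convex_diff_line) (use dim L in auto)
    have "ball x e - L \<subseteq> A \<or> ball x e - L \<subseteq> B"
    proof (rule ccontr)
      assume "\<not> ?thesis"
      then have "A \<inter> (ball x e - L) \<noteq> {}" "B \<inter> (ball x e - L) \<noteq> {}" using AB(3) e by blast+
      moreover have "closedin (top_of_set (ball x e - L)) (X \<inter> (ball x e - L))"
        if X: "closedin (top_of_set (W - L)) X" for X
      proof -
        obtain S where "closed S" "X = (W - L) \<inter> S" using X by (auto simp: closedin_closed)
        moreover have "(W - L) \<inter> S \<inter> (ball x e - L) = (ball x e - L) \<inter> S" using e(2) by blast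
        ultimately show ?thesis by (auto simp: closedin_closed)
      qed
      note this[OF AB(1)] this[OF AB(2)]
      moreover have "A \<inter> (ball x e - L) \<union> B \<inter> (ball x e - L) = ball x e - L" using AB(3) e(2) by blast
      moreover have "A \<inter> (ball x e - L) \<inter> (B \<inter> (ball x e - L)) = {}" using AB(4) by blast
      ultimately show False
        using c unfolding connected_closedin_eq by blast
    qed
    moreover have "negligible L"
      using negligible_line[OF _ L] dim by simp
    then have "ball x e - L \<noteq> {}"
      using open_not_negligible[of "ball x e"] e negligible_subset[of L "ball x e"] by auto
    ultimately show ?thesis using e by blast
  qed
  \<comment> \<open>The open sets of points near which only one side of the separation is present.\<close>
  define A' where "A' = {x\<in>W. \<exists>e>0. ball x e - L \<subseteq> A \<and> ball x e \<subseteq> W}"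
  define B' where "B' = {x\<in>W. \<exists>e>0. ball x e - L \<subseteq> B \<and> ball x e \<subseteq> W}"
  have opn: "open {x\<in>W. \<exists>e>0. ball x e - L \<subseteq> X \<and> ball x e \<subseteq> W}" for X
    unfolding open_contains_ball
  proof
    fix x assume "x \<in> {x\<in>W. \<exists>e>0. ball x e - L \<subseteq> X \<and> ball x e \<subseteq> W}"
    then obtain e where e: "e > 0" "ball x e - L \<subseteq> X" "ball x e \<subseteq> W" by auto
    have "ball y (e/2) \<subseteq> ball x e" if "y \<in> ball x (e/2)" for y
      using that by (auto simp: dist_commute intro: dist_triangle_half_l[THEN less_le_trans])
        (smt (verit) dist_commute dist_triangle field_sum_of_halves)
    then have "ball x (e/2) \<subseteq> {x\<in>W. \<exists>e>0. ball x e - L \<subseteq> X \<and> ball x e \<subseteq> W}"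
      using e by (auto intro!: exI[of _ "e/2"]) fastforce+
    then show "\<exists>e>0. ball x e \<subseteq> {x\<in>W. \<exists>e>0. ball x e - L \<subseteq> X \<and> ball x e \<subseteq> W}"
      using e(1) by (intro exI[of _ "e/2"]) auto
  qed
  have "A' \<union> B' = W" using loc unfolding A'_def B'_def by blast
  moreover have "A' \<inter> B' = {}"
  proof (rule ccontr)
    assume "A' \<inter> B' \<noteq> {}"
    then obtain x e f where x: "x \<in> W" "e > 0" "f > 0" "ball x e - L \<subseteq> A" "ball x f - L \<subseteq> B"
      unfolding A'_def B'_def by blast
    obtain g where "g > 0" "ball x g - L \<noteq> {}" using loc[OF x(1)] by blast
    have "negligible L"
      using negligible_line[OF _ L] dim by simp
    then have "ball x (min e f) - L \<noteq> {}"
      using open_not_negligible[of "ball x (min e f)"] x negligible_subset[of L "ball x (min e f)"] by auto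
    moreover have "ball x (min e f) - L \<subseteq> A \<inter> B" using x by auto
    ultimately show False using AB(4) by blast
  qed
  moreover have "A \<subseteq> A'" "B \<subseteq> B'"
  proof -
    have "x \<in> A'" if "x \<in> A" for x
    proof -
      have "x \<in> W" "x \<notin> L" using that AB(3) by auto
      with loc[of x] obtain e where e: "e > 0" "ball x e \<subseteq> W" "ball x e - L \<subseteq> A \<or> ball x e - L \<subseteq> B" by auto
      moreover have "x \<in> ball x e - L" using e(1) \<open>x \<notin> L\<close> by simp
      ultimately have "ball x e - L \<subseteq> A" using that AB(4) by blast
      then show ?thesis unfolding A'_def using e \<open>x \<in> W\<close> by blast
    qed
    moreover have "x \<in> B'" if "x \<in> B" for x
    proof -
      have "x \<in> W" "x \<notin> L" using that AB(3) by auto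
      with loc[of x] obtain e where e: "e > 0" "ball x e \<subseteq> W" "ball x e - L \<subseteq> A \<or> ball x e - L \<subseteq> B" by auto
      moreover have "x \<in> ball x e - L" using e(1) \<open>x \<notin> L\<close> by simp
      ultimately have "ball x e - L \<subseteq> B" using that AB(4) by blast
      then show ?thesis unfolding B'_def using e \<open>x \<in> W\<close> by blast
    qed
    ultimately show "A \<subseteq> A'" "B \<subseteq> B'" by auto
  qed
  ultimately show False
    using connectedD[OF \<open>connected W\<close> opn[of A, folded A'_def] opn[of B, folded B'_def]] AB(5,6) by blast
qed

text \<open>Finitely many balls that cover \<open>Z\<close> are joined by paths to a continuum inside \<open>W\<close>, which is then
  thickened.\<close>

lemma compact_in_connected_open:
  fixes W :: "'a::euclidean_space set"
  assumes W: "open W" "connected W" and Z: "compact Z" "Z \<subseteq> W"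
  obtains V where "open V" "connected V" "Z \<subseteq> V" "compact (closure V)" "closure V \<subseteq> W"
proof (cases "Z = {}")
  case True
  then show ?thesis using that[of "{}"] by simp
next
  case False
  then obtain a where a: "a \<in> Z" by blast
  obtain e where e: "e > 0" "(\<Union>x\<in>Z. cball x e) \<subseteq> W"
    using compact_subset_open_imp_cball_epsilon_subset[OF Z(1) W(1) Z(2)] by blast
  obtain F where F: "F \<subseteq> Z" "finite F" "Z \<subseteq> (\<Union>x\<in>F. ball x e)"
    by (rule compactE_image[OF Z(1), of Z "\<lambda>x. ball x e"]) (use e in auto)
  have "path_connected W" using W connected_open_path_connected by blast
  then have "\<forall>z\<in>F. \<exists>g. path g \<and> path_image g \<subseteq> W \<and> pathstart g = a \<and> pathfinish g = z"
    unfolding path_connected_def using a F(1) Z(2) by (meson in_mono)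
  then obtain g where g: "\<And>z. z \<in> F \<Longrightarrow> path (g z) \<and> path_image (g z) \<subseteq> W \<and> pathstart (g z) = a \<and> pathfinish (g z) = z"
    by metis
  define T where "T = (\<Union>z\<in>F. path_image (g z) \<union> cball z e)"
  have "compact T" unfolding T_def using F(2) g by (intro compact_UN) (auto intro!: compact_Un compact_path_image)
  have "T \<subseteq> W" unfolding T_def using g e F(1) by blast
  have "connected T"
    unfolding T_def
  proof (rule connected_Union)
    show "\<Inter> ((\<lambda>z. path_image (g z) \<union> cball z e) ` F) \<noteq> {}"
      using g by (metis (mono_tags, lifting) INT_I UnI1 empty_iff pathstart_in_path_image)
  next
    fix S assume "S \<in> (\<lambda>z. path_image (g z) \<union> cball z e) ` F"
    then obtain z where z: "z \<in> F" "S = path_image (g z) \<union> cball z e" by blast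
    have "z \<in> path_image (g z)" using g[OF z(1)] by (metis pathfinish_in_path_image)
    then show "connected S" using g[OF z(1)] e z(2)
      by (auto intro!: connected_Un connected_path_image)
  qed
  obtain m where m: "m > 0" "(\<Union>x\<in>T. cball x m) \<subseteq> W"
    using compact_subset_open_imp_cball_epsilon_subset[OF \<open>compact T\<close> W(1) \<open>T \<subseteq> W\<close>] by blast
  define V where "V = (\<Union>x\<in>T. ball x m)"
  have cm: "compact (\<Union>x\<in>T. cball x m)" using \<open>compact T\<close> by (rule compact_minkowski_sum_cball)
  have clV: "closure V \<subseteq> (\<Union>x\<in>T. cball x m)"
    unfolding V_def by (rule closure_minimal) (use cm compact_imp_closed in auto)
  show ?thesis
  proof (rule that)
    show "open V" unfolding V_def by auto
    show "connected V" unfolding V_def by (rule connected_thickening) fact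
    show "Z \<subseteq> V" 
    proof
      fix x assume "x \<in> Z"
      then obtain f where "f \<in> F" "x \<in> ball f e" using F(3) by blast
      then have "x \<in> T" unfolding T_def by (intro UN_I[of f]) auto
      then show "x \<in> V" unfolding V_def using m(1) by (intro UN_I[of x]) auto
    qed
    show "compact (closure V)"
      using cm clV by (metis closed_closure closed_Int_compact inf.absorb_iff1)
    show "closure V \<subseteq> W" using clV m by blast
  qed
qed

definition totally_disconnected :: "'a::topological_space set \<Rightarrow> bool" where
  "totally_disconnected D \<longleftrightarrow> (\<forall>Y\<subseteq>D. connected Y \<longrightarrow> (\<exists>a. Y \<subseteq> {a}))"

text \<open>By the Sura-Bura theorem every point of \<open>D\<close> has a small neighbourhood in \<open>D\<close> that is open and compact,
  hence at a positive distance from the rest of \<open>D\<close>. A connected set inside a sufficiently thin thickening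
  of \<open>D\<close> cannot jump over this gap.\<close>

lemma totally_disconnected_small_thickening:
  fixes D :: "'a::euclidean_space set"
  assumes D: "compact D" "totally_disconnected D" and e: "e > 0"
  obtains r where "r > 0"
    "\<And>Y. \<lbrakk>connected Y; Y \<noteq> {}; Y \<subseteq> (\<Union>x\<in>D. cball x r)\<rbrakk> \<Longrightarrow> \<exists>x\<in>D. Y \<subseteq> ball x e"
proof -
  have "\<exists>K r. x \<in> K \<and> openin (top_of_set D) K \<and> r > 0 \<and>
     (\<forall>q Y. 0 < q \<and> q \<le> r \<and> connected Y \<and> Y \<subseteq> (\<Union>x\<in>D. cball x q) \<and> Y \<inter> (\<Union>x\<in>K. cball x q) \<noteq> {} \<longrightarrow> Y \<subseteq> ball x e)"
    if x: "x \<in> D" for x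
  proof -
    have "{x} \<in> components D"
    proof -
      have "connected_component_set D x \<subseteq> {x}"
      proof -
        obtain a where a: "connected_component_set D x \<subseteq> {a}"
          using D(2) connected_component_subset[of D x] connected_connected_component[of D x]
          unfolding totally_disconnected_def by blast
        moreover have "x \<in> connected_component_set D x" using x by simp
        ultimately show ?thesis by blast
      qed
      then have "connected_component_set D x = {x}" using x by auto
      then show ?thesis using x by (metis componentsI)
    qed
    then obtain K where K: "openin (top_of_set D) K" "compact K" "{x} \<subseteq> K" "K \<subseteq> ball x (e/2)"
      using Sura_Bura_clopen_subset[of D "{x}" "ball x (e/2)"] D(1) e closed_imp_locally_compact compact_imp_closed
      by (metis centre_in_ball compact_sing empty_subsetI half_gt_zero insert_subset open_ball)
    have "closed (D - K)" using K(1) D(1)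
      by (metis closedin_closed_trans closedin_diff closedin_subtopology_refl compact_imp_closed topspace_euclidean_subtopology closedin_topspace)
    then have cD: "compact (D - K)" using D(1) by (metis Diff_subset closed_Int_compact inf.absorb_iff1)
    obtain d where d: "d > 0" "\<And>a b. a \<in> K \<Longrightarrow> b \<in> D - K \<Longrightarrow> d \<le> dist a b"
      using separate_compact_closed[OF K(2) \<open>closed (D - K)\<close>] by auto
    have "Y \<subseteq> ball x e" if q: "0 < q" "q \<le> min (d/3) (e/3)" "connected Y" "Y \<subseteq> (\<Union>x\<in>D. cball x q)"
       "Y \<inter> (\<Union>x\<in>K. cball x q) \<noteq> {}" for q Y
    proof -
      let ?A = "\<Union>x\<in>K. cball x q" and ?B = "\<Union>x\<in>D - K. cball x q"
      have cl: "closed ?A" "closed ?B"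
        using K(2) cD compact_minkowski_sum_cball compact_imp_closed by blast+
      have "a \<in> K \<Longrightarrow> b \<in> D - K \<Longrightarrow> y \<in> cball a q \<Longrightarrow> y \<notin> cball b q" for a b y
        using d(2)[of a b] q(2) d(1) dist_triangle2[of a b y] by (auto simp: dist_commute)
      then have "?A \<inter> ?B = {}" by blast
      moreover have "Y \<subseteq> ?A \<union> ?B" using q(4) by auto
      ultimately have "?B \<inter> Y = {}"
        using connected_closedD[OF q(3) _ _ cl] q(5) by blast
      then have "Y \<subseteq> ?A" using \<open>Y \<subseteq> ?A \<union> ?B\<close> by blast
      also have "\<dots> \<subseteq> ball x e"
      proof
        fix y assume "y \<in> ?A"
        then obtain z where "z \<in> K" "dist z y \<le> q" by auto
        then have "dist x z < e/2" "dist z y \<le> e/3" using K(4) q(2) by auto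
        then show "y \<in> ball x e" using dist_triangle[of x y z] e by auto
      qed
      finally show ?thesis .
    qed
    then show ?thesis using K d(1) e by (intro exI[of _ K] exI[of _ "min (d/3) (e/3)"]) auto
  qed
  then obtain K r where K: "\<And>x. x \<in> D \<Longrightarrow> x \<in> K x \<and> openin (top_of_set D) (K x) \<and> r x > 0"
    and Kr: "\<And>x q Y. \<lbrakk>x \<in> D; 0 < q; q \<le> r x; connected Y; Y \<subseteq> (\<Union>x\<in>D. cball x q); Y \<inter> (\<Union>x\<in>K x. cball x q) \<noteq> {}\<rbrakk> \<Longrightarrow> Y \<subseteq> ball x e"
    by metis
  obtain U where U: "\<And>x. x \<in> D \<Longrightarrow> open (U x) \<and> K x = D \<inter> U x"
    using K unfolding openin_open by metis
  obtain F where F: "F \<subseteq> D" "finite F" "D \<subseteq> (\<Union>x\<in>F. U x)"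
    by (rule compactE_image[OF D(1), of D U]) (use U K in auto)
  define q where "q = Min (insert 1 (r ` F))"
  have q: "q > 0" "\<And>x. x \<in> F \<Longrightarrow> q \<le> r x"
    unfolding q_def using F K by (auto simp: Min_le_iff)
  show ?thesis
  proof (rule that[OF q(1)])
    fix Y :: "'a set" assume Y: "connected Y" "Y \<noteq> {}" "Y \<subseteq> (\<Union>x\<in>D. cball x q)"
    then obtain y d where y: "y \<in> Y" "d \<in> D" "y \<in> cball d q" by blast
    obtain x where x: "x \<in> F" "d \<in> U x" using F \<open>d \<in> D\<close> by blast
    have "x \<in> D" using x F by blast
    have "d \<in> K x" using U[OF \<open>x \<in> D\<close>] x y by blast
    then have "y \<in> Y \<inter> (\<Union>x\<in>K x. cball x q)" using y by blast
    then have "Y \<inter> (\<Union>x\<in>K x. cball x q) \<noteq> {}" by blast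
    then have "Y \<subseteq> ball x e" by (rule Kr[OF \<open>x \<in> D\<close> q(1) q(2)[OF x(1)] Y(1,3)])
    then show "\<exists>x\<in>D. Y \<subseteq> ball x e" using \<open>x \<in> F\<close> F by blast
  qed
qed

text \<open>Each of two disjoint continua lies in a single component of the complement of the other. If both lie
  outside each other, then so do the filled sets, which are connected.\<close>

lemma filled_continua_nested_or_disjoint:
  fixes K L :: "'a::euclidean_space set"
  assumes K: "compact K" "connected K" "K \<noteq> {}" and L: "compact L" "connected L" "L \<noteq> {}"
    and "K \<inter> L = {}"
  shows "K \<union> inside K \<subseteq> L \<union> inside L \<or> L \<union> inside L \<subseteq> K \<union> inside K \<or> (K \<union> inside K) \<inter> (L \<union> inside L) = {}"
proof -
  have dich: "B \<subseteq> inside A \<or> B \<subseteq> outside A" if "compact A" "connected B" "A \<inter> B = {}" for A B :: "'a set"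
  proof -
    have "open (inside A)" "open (outside A)"
      using that by (auto simp: open_inside open_outside compact_imp_closed)
    moreover have "B \<subseteq> inside A \<union> outside A" "inside A \<inter> outside A \<inter> B = {}" using that(3) by auto
    ultimately have "inside A \<inter> B = {} \<or> outside A \<inter> B = {}"
      using connectedD[OF that(2)] by metis
    then show ?thesis using \<open>B \<subseteq> inside A \<union> outside A\<close> by blast
  qed
  consider "L \<subseteq> inside K" | "K \<subseteq> inside L" | "L \<subseteq> outside K" "K \<subseteq> outside L"
    using dich[of K L] dich[of L K] assms by blast
  then show ?thesis
  proof cases
    case 1
    then show ?thesis using inside_inside_compact_connected[of L K] assms compact_imp_closed by blast
  next
    case 2
    then show ?thesis using inside_inside_compact_connected[of K L] assms compact_imp_closed by blast
  next
    case 3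
    have "(K \<union> inside K) \<inter> L = {}" using 3(1) by (auto simp: union_with_inside)
    moreover have "connected (K \<union> inside K)" using K connected_with_inside compact_imp_closed by blast
    ultimately have "K \<union> inside K \<subseteq> inside L \<or> K \<union> inside K \<subseteq> outside L" using dich[of L "K \<union> inside K"] L(1) by blast
    moreover have "inside L \<inter> outside L = {}" by simp
    ultimately have "K \<union> inside K \<subseteq> outside L" using 3(2) K(3) by blast
    then show ?thesis by (auto simp: union_with_inside)
  qed
qed

text \<open>Two disjoint closed sets have complements that cover the space, so unicoherence applies to these
  complements.\<close>

lemma nonseparating_disjoint_Union:
  fixes \<P> :: "'a::euclidean_space set set"
  assumes "finite \<P>" "pairwise disjnt \<P>" "\<And>P. P \<in> \<P> \<Longrightarrow> compact P \<and> connected (- P)"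
  shows "connected (- \<Union>\<P>)"
  using assms
proof (induction \<P> rule: finite_induct)
  case (insert P \<P>)
  have "closed (\<Union>\<P>)" using insert by (intro closed_Union) (auto intro: compact_imp_closed)
  moreover have "P \<inter> \<Union>\<P> = {}" using insert.prems(1) insert.hyps(2) by (auto simp: pairwise_insert disjnt_def)
  ultimately have "connected (- P \<inter> - \<Union>\<P>)"
    using insert by (intro open_unicoherent_UNIV) (auto simp: open_Compl compact_imp_closed pairwise_insert)
  moreover have "- \<Union>(insert P \<P>) = - P \<inter> - \<Union>\<P>" by blast
  ultimately show ?case by (simp only:)
next
  case empty
  show ?case by (simp add: convex_connected)
qed

text \<open>Again unicoherence: \<open>R\<close> and the complement of \<open>Z\<close> cover the space.\<close>

lemma connected_diff_nonseparating:
  fixes R :: "'a::euclidean_space set"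
  assumes "open R" "connected R" "compact Z" "Z \<subseteq> R" "connected (- Z)"
  shows "connected (R - Z)"
  unfolding Diff_eq using assms by (intro open_unicoherent_UNIV) (auto simp: open_Compl compact_imp_closed)

text \<open>The covering sets are the maximal ones among the filled components of a thin thickening of \<open>D\<close>. A
  component of the thickening contains a whole ball of fixed radius about one of its points in \<open>D\<close>, so there
  are only finitely many, and the filling of a set stays in every ball that contains the set.\<close>

lemma totally_disconnected_filled_cover:
  fixes D :: "'a::euclidean_space set"
  assumes D: "compact D" "totally_disconnected D" and R: "open R" "D \<subseteq> R" and e: "e > 0" and dim: "2 \<le> DIM('a)"
  obtains \<P> where "finite \<P>" "pairwise disjnt \<P>" "D \<subseteq> \<Union>\<P>"
    "\<And>P. P \<in> \<P> \<Longrightarrow> compact P \<and> connected P \<and> connected (- P) \<and> P \<subseteq> R \<and> P \<inter> D \<noteq> {} \<and> (\<exists>x. P \<subseteq> ball x e)"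
proof -
  obtain e1 where e1: "e1 > 0" "(\<Union>x\<in>D. ball x e1) \<subseteq> R"
    using compact_subset_open_imp_ball_epsilon_subset[OF D(1) R] by blast
  obtain r where r: "r > 0"
    "\<And>Y. \<lbrakk>connected Y; Y \<noteq> {}; Y \<subseteq> (\<Union>x\<in>D. cball x r)\<rbrakk> \<Longrightarrow> \<exists>x\<in>D. Y \<subseteq> ball x (min e e1)"
    using totally_disconnected_small_thickening[OF D, of "min e e1"] e e1 by auto
  define M where "M = (\<Union>x\<in>D. cball x r)"
  have cM: "compact M" unfolding M_def using D(1) by (rule compact_minkowski_sum_cball)
  have ballK: "cball x r \<subseteq> K" if "K \<in> components M" "x \<in> D" "cball x r \<inter> K \<noteq> {}" for K x
    by (rule components_maximal[OF that(1)]) (use that in \<open>auto simp: M_def\<close>)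
  have comp: "compact K \<and> connected K \<and> K \<noteq> {} \<and> (\<exists>x\<in>D. x \<in> K) \<and> (\<exists>x\<in>D. K \<subseteq> ball x (min e e1))"
    if "K \<in> components M" for K
  proof -
    have *: "compact K" "connected K" "K \<noteq> {}" "K \<subseteq> M"
      using compact_components[OF cM that] in_components_connected[OF that] in_components_nonempty[OF that]
        in_components_subset[OF that] by auto
    moreover obtain y x where yx: "y \<in> K" "x \<in> D" "y \<in> cball x r" using * unfolding M_def by blast
    have "cball x r \<subseteq> K" using ballK[OF that yx(2)] yx by blast
    then have "x \<in> K" using r(1) by (simp add: subset_iff)
    ultimately show ?thesis using r(2)[of K] \<open>x \<in> D\<close> unfolding M_def by blast
  qed
  obtain F where F: "F \<subseteq> D" "finite F" "D \<subseteq> (\<Union>x\<in>F. ball x r)"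
    by (rule compactE_image[OF D(1), of D "\<lambda>x. ball x r"]) (use r in auto)
  have "components M \<subseteq> (\<lambda>x. connected_component_set M x) ` F"
  proof
    fix K assume K: "K \<in> components M"
    then obtain x where "x \<in> D" "x \<in> K" using comp by blast
    then obtain f where f: "f \<in> F" "x \<in> ball f r" using F by blast
    then have "x \<in> cball f r \<inter> K" using \<open>x \<in> K\<close> by simp
    then have "cball f r \<inter> K \<noteq> {}" by blast
    then have "cball f r \<subseteq> K" using ballK[OF K, of f] f F by blast
    then have "f \<in> K" using r(1) by auto
    then have "connected_component_set M f = K" using K by (metis components_iff connected_component_eq)
    then show "K \<in> (\<lambda>x. connected_component_set M x) ` F" using f by blast
  qed
  then have finM: "finite (components M)" using F(2) finite_surj by blast
  define fill where "fill = (\<lambda>K::'a set. K \<union> inside K)"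
  define \<F> where "\<F> = fill ` components M"
  have fin: "finite \<F>" unfolding \<F>_def using finM by simp
  define \<P> where "\<P> = {P \<in> \<F>. \<forall>Q\<in>\<F>. P \<subseteq> Q \<longrightarrow> Q = P}"
  show ?thesis
  proof (rule that)
    show "finite \<P>" unfolding \<P>_def using fin by simp
    show "pairwise disjnt \<P>"
    proof (rule pairwiseI)
      fix P Q assume PQ: "P \<in> \<P>" "Q \<in> \<P>" "P \<noteq> Q"
      then obtain K L where KL: "K \<in> components M" "L \<in> components M" "P = fill K" "Q = fill L"
        unfolding \<P>_def \<F>_def by blast
      have "K \<inter> L = {}" using KL PQ components_nonoverlap by blast
      then have "P \<subseteq> Q \<or> Q \<subseteq> P \<or> P \<inter> Q = {}"
        using filled_continua_nested_or_disjoint[of K L] comp KL by (simp add: fill_def)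
      then show "disjnt P Q" using PQ unfolding \<P>_def disjnt_def by blast
    qed
    show "D \<subseteq> \<Union>\<P>"
    proof
      fix x assume "x \<in> D"
      then have "x \<in> M" unfolding M_def using r(1) by (intro UN_I[of x]) auto
      then obtain K where "K \<in> components M" "x \<in> K" by (metis UnionE Union_components)
      then have "fill K \<in> \<F>" "x \<in> fill K" unfolding \<F>_def fill_def by auto
      then obtain P where "P \<in> \<F>" "fill K \<subseteq> P" "\<forall>Q\<in>\<F>. P \<subseteq> Q \<longrightarrow> Q = P"
        using finite_has_maximal2[OF fin, of "fill K"] by metis
      then show "x \<in> \<Union>\<P>" unfolding \<P>_def using \<open>x \<in> fill K\<close> by blast
    qed
    fix P assume "P \<in> \<P>"
    then obtain K where K: "K \<in> components M" "P = fill K" unfolding \<P>_def \<F>_def by blast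
    note c = comp[OF K(1)]
    have "connected P" unfolding K fill_def using c connected_with_inside compact_imp_closed by blast
    moreover have "- P = outside K" unfolding K fill_def by (simp add: union_with_inside)
    then have "connected (- P)" "open (- P)"
      using connected_outside[OF _ dim, of K] open_outside[of K] c compact_imp_bounded compact_imp_closed by auto
    moreover have "bounded P" unfolding K fill_def using c bounded_inside[of K] compact_imp_bounded by auto
    then have "compact P" using \<open>open (- P)\<close> by (simp add: closed_def compact_eq_bounded_closed)
    moreover obtain x where x: "x \<in> D" "K \<subseteq> ball x (min e e1)" using c by blast
    have "P \<subseteq> ball x (min e e1)"
      using outside_subset_convex[of "ball x (min e e1)" K] x(2) \<open>- P = outside K\<close> by auto
    moreover have "P \<inter> D \<noteq> {}" unfolding K fill_def using c by blast
    ultimately show "compact P \<and> connected P \<and> connected (- P) \<and> P \<subseteq> R \<and> P \<inter> D \<noteq> {} \<and> (\<exists>x. P \<subseteq> ball x e)"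
    proof -
      have "ball x (min e e1) \<subseteq> ball x e" "ball x (min e e1) \<subseteq> ball x e1" by auto
      moreover have "ball x e1 \<subseteq> R" using e1(2) x(1) by blast
      moreover note \<open>P \<subseteq> ball x (min e e1)\<close>
      ultimately have "P \<subseteq> R" "P \<subseteq> ball x e" by (meson order_trans)+
      then show ?thesis
        using \<open>connected P\<close> \<open>connected (- P)\<close> \<open>compact P\<close> \<open>P \<inter> D \<noteq> {}\<close> by blast
    qed
  qed
qed

section \<open>Diffeomorphisms that move a point\<close>

text \<open>The inverse is part of the data: its smoothness can be read off from the formula for a twist and is
  inherited by compositions.\<close>

definition diffeo_pair :: "('a::euclidean_space \<Rightarrow> 'a) \<Rightarrow> ('a \<Rightarrow> 'a) \<Rightarrow> bool" where
  "diffeo_pair F G \<longleftrightarrow> smooth_on_open F UNIV \<and> smooth_on_open G UNIV \<and> (\<forall>x. G (F x) = x) \<and> (\<forall>x. F (G x) = x)"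

text \<open>For orthonormal \<open>e\<close> and \<open>f\<close> this is the rotation by the angle \<open>t\<close> in their plane, extended by the identity on the
  orthogonal complement.\<close>

definition plane_rot :: "'a::euclidean_space \<Rightarrow> 'a \<Rightarrow> real \<Rightarrow> 'a \<Rightarrow> 'a" where
  "plane_rot e f t y = y + ((cos t - 1) * (y \<bullet> e) - sin t * (y \<bullet> f)) *\<^sub>R e
                         + ((cos t - 1) * (y \<bullet> f) + sin t * (y \<bullet> e)) *\<^sub>R f"

context
  fixes e f :: "'a::euclidean_space"
  assumes ef: "e \<bullet> e = 1" "f \<bullet> f = 1" "e \<bullet> f = 0"
begin

lemma plane_rot_inner:
  "plane_rot e f t y \<bullet> e = cos t * (y \<bullet> e) - sin t * (y \<bullet> f)"
  "plane_rot e f t y \<bullet> f = cos t * (y \<bullet> f) + sin t * (y \<bullet> e)"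
  using ef by (auto simp: plane_rot_def inner_simps inner_commute[of f e] algebra_simps)

lemma plane_rot_isometry: "plane_rot e f t y \<bullet> plane_rot e f t y = y \<bullet> y"
proof -
  define p q where "p = y \<bullet> e" and "q = y \<bullet> f"
  define c s where "c = cos t" and "s = sin t"
  have cs: "s * s = 1 - c * c" using sin_squared_eq[of t] by (simp add: c_def s_def power2_eq_square)
  have exp: "(y + A *\<^sub>R e + B *\<^sub>R f) \<bullet> (y + A *\<^sub>R e + B *\<^sub>R f) = y \<bullet> y + 2 * (A * p + B * q) + (A * A + B * B)" for A B
  proof -
    have "y \<bullet> e = p" "y \<bullet> f = q" "e \<bullet> y = p" "f \<bullet> y = q" "f \<bullet> e = 0"
      using ef(3) by (auto simp: p_def q_def inner_commute)
    then show ?thesis using ef by (simp add: inner_add_left inner_add_right algebra_simps)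
  qed
  have "plane_rot e f t y \<bullet> plane_rot e f t y
     = y \<bullet> y + 2 * (((c - 1) * p - s * q) * p + ((c - 1) * q + s * p) * q)
       + (((c - 1) * p - s * q) * ((c - 1) * p - s * q) + ((c - 1) * q + s * p) * ((c - 1) * q + s * p))"
    unfolding plane_rot_def p_def[symmetric] q_def[symmetric] c_def[symmetric] s_def[symmetric] exp by simp
  also have "\<dots> = y \<bullet> y + (p * p + q * q) * (2 * (c - 1) + (c - 1) * (c - 1) + s * s)"
    by (simp add: algebra_simps)
  also have "\<dots> = y \<bullet> y" unfolding cs by (simp add: algebra_simps)
  finally show ?thesis .
qed

lemma plane_rot_inverse: "plane_rot e f (- t) (plane_rot e f t y) = y"
proof -
  define p q where "p = y \<bullet> e" and "q = y \<bullet> f"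
  define c s where "c = cos t" and "s = sin t"
  have cs: "s * s = 1 - c * c" using sin_squared_eq[of t] by (simp add: c_def s_def power2_eq_square)
  have "plane_rot e f (- t) (plane_rot e f t y) = y + ((c - 1) * p - s * q + (c - 1) * (c * p - s * q) + s * (c * q + s * p)) *\<^sub>R e
     + ((c - 1) * q + s * p + (c - 1) * (c * q + s * p) - s * (c * p - s * q)) *\<^sub>R f"
    unfolding plane_rot_def[of e f "- t"] plane_rot_inner
    by (simp add: plane_rot_def p_def q_def c_def s_def scaleR_add_left scaleR_diff_left)
  also have "(c - 1) * p - s * q + (c - 1) * (c * p - s * q) + s * (c * q + s * p) = p * (c * c + s * s - 1)"
    by (simp add: algebra_simps)
  also have "(c - 1) * q + s * p + (c - 1) * (c * q + s * p) - s * (c * p - s * q) = q * (c * c + s * s - 1)"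
    by (simp add: algebra_simps)
  finally show ?thesis unfolding cs by simp
qed

lemma smooth_on_open_plane_rot:
  assumes "smooth_on_open g U" "smooth_on_open h U"
  shows "smooth_on_open (\<lambda>x. plane_rot e f (g x) (h x)) U"
  unfolding plane_rot_def
  using assms smooth_on_open_open[OF assms(1)]
  by (intro smooth_on_open_add smooth_on_open_scaleR smooth_on_open_diff smooth_on_open_mult smooth_on_open_cos
        smooth_on_open_sin smooth_on_open_inner smooth_on_open_const)

end

text \<open>A twist: each sphere about the midpoint \<open>a\<close> of \<open>p\<close> and \<open>q\<close> is rotated by an angle that depends
  only on its radius and equals \<open>\<pi>\<close> on the sphere through \<open>p\<close> and \<open>q\<close>. The angle is invariant under the
  twist, so the inverse is the twist by the opposite angle.\<close>

lemma diffeo_twist: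
  fixes p q :: "'a::euclidean_space"
  assumes dim: "2 \<le> DIM('a)" and "p \<noteq> q"
  obtains F G where "diffeo_pair F G" "F p = q" "\<And>x. x \<notin> cball (midpoint p q) (dist p q) \<Longrightarrow> F x = x"
proof -
  define a where "a = midpoint p q"
  define d where "d = p - a"
  define r where "r = dist p q"
  have r: "r > 0" using assms by (simp add: r_def)
  have d: "d = (1/2) *\<^sub>R (p - q)" unfolding d_def a_def midpoint_def
    by (simp add: algebra_simps flip: scaleR_add_left)
  have dr: "d \<bullet> d = r\<^sup>2 / 4" unfolding d r_def dist_norm
    by (simp add: dot_square_norm power2_eq_square)
  then have "d \<noteq> 0" using r by auto
  obtain y where y: "y \<noteq> 0" "orthogonal d y" using orthogonal_to_vector_exists[OF dim] by blast
  define e f where "e = sgn d" and "f = sgn y"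
  have ef: "e \<bullet> e = 1" "f \<bullet> f = 1" "e \<bullet> f = 0"
    using y \<open>d \<noteq> 0\<close> by (auto simp: e_def f_def orthogonal_def sgn_div_norm dot_square_norm power2_eq_square)
  define th where "th = (\<lambda>z::'a. pi * cutoff ((z \<bullet> z) * inverse (r\<^sup>2)))"
  define F where "F = (\<lambda>x. a + plane_rot e f (th (x - a)) (x - a))"
  define G where "G = (\<lambda>x. a + plane_rot e f (- th (x - a)) (x - a))"
  have th_rot: "th (plane_rot e f t z) = th z" for t z
    by (simp add: th_def plane_rot_isometry[OF ef])
  have sm: "smooth_on_open (\<lambda>x. th (x - a)) UNIV"
    unfolding th_def
    by (intro smooth_on_open_mult smooth_on_open_cutoff smooth_on_open_inner smooth_on_open_diff
        smooth_on_open_const smooth_on_open_id) auto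
  have smid: "smooth_on_open (\<lambda>x. x - a) UNIV"
    by (intro smooth_on_open_diff smooth_on_open_const smooth_on_open_id) auto
  show ?thesis
  proof (rule that[of F G])
    have "smooth_on_open F UNIV" "smooth_on_open G UNIV"
      unfolding F_def G_def
      by (intro smooth_on_open_add smooth_on_open_const smooth_on_open_plane_rot smooth_on_open_minus sm smid ef; simp)+
    moreover have "G (F x) = x" "F (G x) = x" for x
      using plane_rot_inverse[OF ef, of "th (x - a)" "x - a"] plane_rot_inverse[OF ef, of "- th (x - a)" "x - a"]
      by (auto simp: F_def G_def th_rot)
    ultimately show "diffeo_pair F G" by (simp add: diffeo_pair_def)
    have "th d = pi" using r by (simp add: th_def dr cutoff_eq_1)
    then have "F p = a + plane_rot e f pi d" by (simp add: F_def d_def)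
    also have "plane_rot e f pi d = d - 2 *\<^sub>R (d \<bullet> e) *\<^sub>R e"
      using y(2) by (simp add: plane_rot_def f_def sgn_div_norm orthogonal_def algebra_simps)
    also have "(d \<bullet> e) *\<^sub>R e = d" using \<open>d \<noteq> 0\<close>
      by (simp add: e_def sgn_div_norm dot_square_norm power2_eq_square divide_inverse mult.assoc)
    finally have "F p = a - d" by (simp add: algebra_simps scaleR_2)
    then show "F p = q" by (simp add: d_def a_def midpoint_def algebra_simps flip: scaleR_add_left scaleR_2)
    fix x assume "x \<notin> cball (midpoint p q) (dist p q)"
    then have "r < norm (x - a)" by (simp add: a_def r_def dist_norm norm_minus_commute)
    then have "r\<^sup>2 \<le> (x - a) \<bullet> (x - a)" using r
      by (simp add: dot_square_norm power_mono)
    then have "1 \<le> ((x - a) \<bullet> (x - a)) * inverse (r\<^sup>2)" using r by (simp add: field_simps)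
    then have "th (x - a) = 0" by (simp add: th_def cutoff_eq_0)
    then show "F x = x" by (simp add: F_def plane_rot_def)
  qed
qed

text \<open>Being movable into one another inside \<open>W\<close> is an equivalence relation with open classes, because a
  twist in a small ball moves its centre to any nearby point.\<close>

lemma diffeo_moving_point:
  fixes W :: "'a::euclidean_space set"
  assumes dim: "2 \<le> DIM('a)" and W: "open W" "connected W" "p \<in> W" "q \<in> W"
  obtains F G K where "diffeo_pair F G" "compact K" "K \<subseteq> W" "\<And>x. x \<notin> K \<Longrightarrow> F x = x" "F p = q"
proof -
  define M where "M = (\<lambda>p q. \<exists>F G K. diffeo_pair F G \<and> compact K \<and> K \<subseteq> W \<and> (\<forall>x. x \<notin> K \<longrightarrow> F x = x) \<and> F p = q)"
  have "M p q"
  proof (rule connected_equivalence_relation[OF W(2-4)])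
    fix x y assume "M x y"
    then obtain F G K where *: "diffeo_pair F G" "compact K" "K \<subseteq> W" "\<forall>x. x \<notin> K \<longrightarrow> F x = x" "F x = y"
      unfolding M_def by blast
    then have "diffeo_pair G F" "\<forall>x. x \<notin> K \<longrightarrow> G x = x" "G y = x" unfolding diffeo_pair_def by metis+
    then show "M y x" unfolding M_def using * by blast
  next
    fix x y z assume "M x y" "M y z"
    obtain F G K where *: "diffeo_pair F G" "compact K" "K \<subseteq> W" "\<forall>x. x \<notin> K \<longrightarrow> F x = x" "F x = y"
      using \<open>M x y\<close> unfolding M_def by blast
    obtain F' G' K' where **: "diffeo_pair F' G'" "compact K'" "K' \<subseteq> W" "\<forall>x. x \<notin> K' \<longrightarrow> F' x = x" "F' y = z"
      using \<open>M y z\<close> unfolding M_def by blast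
    have "diffeo_pair (\<lambda>x. F' (F x)) (\<lambda>x. G (G' x))"
      using * ** unfolding diffeo_pair_def
      using smooth_on_open_compose[of F' UNIV F UNIV] smooth_on_open_compose[of G UNIV G' UNIV] by simp
    moreover have "compact (K \<union> K')" "K \<union> K' \<subseteq> W" "\<forall>x. x \<notin> K \<union> K' \<longrightarrow> F' (F x) = x" "F' (F x) = z"
      using * ** by auto
    ultimately show "M x z" unfolding M_def by blast
  next
    fix a assume a: "a \<in> W"
    obtain r where r: "r > 0" "cball a r \<subseteq> W" using W(1) a open_contains_cball by blast
    have "M a x" if x: "x \<in> ball a (r/2)" for x
    proof (cases "x = a")
      case True
      have "diffeo_pair (\<lambda>x::'a. x) (\<lambda>x. x)" by (simp add: diffeo_pair_def smooth_on_open_id)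
      then show ?thesis unfolding M_def using True by blast
    next
      case False
      obtain F G where FG: "diffeo_pair F G" "F a = x" "\<And>y. y \<notin> cball (midpoint a x) (dist a x) \<Longrightarrow> F y = y"
        using diffeo_twist[OF dim, of a x] False by metis
      have "cball (midpoint a x) (dist a x) \<subseteq> cball a r"
      proof
        fix y assume "y \<in> cball (midpoint a x) (dist a x)"
        then show "y \<in> cball a r"
          using x dist_triangle[of a y "midpoint a x"] dist_midpoint(1)[of a x] r(1)
          by (simp add: mem_cball mem_ball)
      qed
      then have "cball (midpoint a x) (dist a x) \<subseteq> W" using r(2) by blast
      then show ?thesis unfolding M_def using FG compact_cball by blast
    qed
    moreover have "openin (top_of_set W) (ball a (r/2))"
      using r by (intro open_subset) (auto simp: subset_iff)
    ultimately show "\<exists>T. openin (top_of_set W) T \<and> a \<in> T \<and> (\<forall>x\<in>T. M a x)"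
      using r(1) by (intro exI[of _ "ball a (r/2)"]) auto
  qed
  then show ?thesis using that unfolding M_def by blast
qed

section \<open>The divergence theorem on the sphere\<close>

abbreviation punctured_ball :: "'a::euclidean_space set" where
  "punctured_ball \<equiv> ball 0 1 - {0}"

lemma space_sphere_measure [simp]: "space (sphere_measure :: 'a::euclidean_space measure) = sphere 0 1"
  by (simp add: sphere_measure_def space_scale_measure space_restrict_space)

lemma sets_sphere_measure [simp, measurable_cong]:
  "sets (sphere_measure :: 'a::euclidean_space measure) = sets (restrict_space borel (sphere 0 1))"
  by (simp add: sphere_measure_def)

lemma borel_measurable_sphere_continuous:
  fixes f :: "'a::euclidean_space \<Rightarrow> 'b::topological_space"
  shows "continuous_on (sphere 0 1) f \<Longrightarrow> f \<in> borel_measurable sphere_measure"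
  using borel_measurable_continuous_on_restrict[of "sphere 0 1" f]
  by (simp cong: measurable_cong_sets)

lemma sgn_measurable_sphere [measurable]:
  "sgn \<in> measurable (restrict_space lborel (punctured_ball :: 'a::euclidean_space set)) (restrict_space borel (sphere 0 1))"
  by (rule measurable_restrict_space3) (auto simp: norm_sgn)

lemma emeasure_sphere:
  fixes A :: "'a::euclidean_space set"
  assumes "A \<in> sets borel"
  shows "emeasure sphere_measure (sphere 0 1 \<inter> A)
    = of_nat DIM('a) * emeasure lborel {x \<in> punctured_ball. sgn x \<in> A}"
proof -
  have m: "sphere 0 1 \<inter> A \<in> sets (restrict_space borel (sphere 0 1 :: 'a set))"
    using assms by (auto simp: sets_restrict_space)
  have "sgn -` (sphere 0 1 \<inter> A) \<inter> space (restrict_space lborel punctured_ball) = {x \<in> punctured_ball. sgn x \<in> A}"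
    by (auto simp: space_restrict_space norm_sgn)
  then have "emeasure sphere_measure (sphere 0 1 \<inter> A)
      = of_nat DIM('a) * emeasure (restrict_space lborel punctured_ball) {x \<in> punctured_ball. sgn x \<in> A}"
    using m by (simp add: sphere_measure_def emeasure_distr)
  then show ?thesis by (subst (asm) emeasure_restrict_space) auto
qed

lemma finite_sphere_measure: "finite_measure (sphere_measure :: 'a::euclidean_space measure)"
proof
  have "emeasure (sphere_measure :: 'a measure) (sphere 0 1 \<inter> UNIV) \<le> of_nat DIM('a) * emeasure lborel (ball (0::'a) 1)"
    unfolding emeasure_sphere[OF borel_open[OF open_UNIV]] by (intro mult_left_mono emeasure_mono) auto
  also have "\<dots> < \<infinity>" using emeasure_lborel_ball_finite[of "0::'a" 1] by (simp add: ennreal_mult_less_top of_nat_less_top)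
  finally show "emeasure (sphere_measure :: 'a measure) (space sphere_measure) \<noteq> \<infinity>" by auto
qed

lemma integral_sphere_measure:
  fixes f :: "'a::euclidean_space \<Rightarrow> real"
  assumes [measurable]: "f \<in> borel_measurable sphere_measure"
  shows "integral\<^sup>L sphere_measure f = DIM('a) * (LINT x|lborel. indicator punctured_ball x * f (sgn x))"
proof -
  let ?N = "distr (restrict_space lborel punctured_ball) (restrict_space borel (sphere 0 1)) sgn :: 'a measure"
  have f: "f \<in> borel_measurable (restrict_space borel (sphere 0 1))"
    using assms by (simp cong: measurable_cong_sets)
  have dens: "sphere_measure = density ?N (\<lambda>_. ennreal (real DIM('a)))"
    by (rule measure_eqI) (auto simp: sphere_measure_def emeasure_density_const ennreal_of_nat_eq_real_of_nat)
  have "integral\<^sup>L sphere_measure f = integral\<^sup>L ?N (\<lambda>x. real DIM('a) * f x)"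
    unfolding dens by (subst integral_real_density) (use f in auto)
  also have "\<dots> = DIM('a) * integral\<^sup>L ?N f" by simp
  also have "integral\<^sup>L ?N f = integral\<^sup>L (restrict_space lborel punctured_ball) (\<lambda>x. f (sgn x))"
    by (rule integral_distr[OF sgn_measurable_sphere f])
  also have "\<dots> = (LINT x|lborel. indicator punctured_ball x * f (sgn x))"
    by (subst integral_restrict_space) auto
  finally show ?thesis .
qed

lemma integrable_sphere_continuous:
  fixes f :: "'a::euclidean_space \<Rightarrow> 'b::{banach, second_countable_topology}"
  assumes "continuous_on (sphere 0 1) f"
  shows "integrable sphere_measure f"
proof -
  interpret finite_measure "sphere_measure :: 'a measure" by (rule finite_sphere_measure)
  have "compact (f ` sphere 0 1)" using assms compact_continuous_image compact_sphere by blast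
  then obtain B where B: "\<And>x. x \<in> sphere 0 1 \<Longrightarrow> norm (f x) \<le> B"
    using compact_imp_bounded bounded_iff by (metis (mono_tags, lifting) image_eqI)
  show ?thesis
    by (rule integrable_const_bound[of _ B]) (use assms B in \<open>auto intro!: AE_I2 borel_measurable_sphere_continuous\<close>)
qed

text \<open>The cone over a cap of radius \<open>r\<close> is a tube of radius \<open>r\<close> about a unit segment and is covered by
  about \<open>1/r\<close> balls of radius \<open>2r\<close>.\<close>

lemma emeasure_cap_le:
  fixes s :: "'a::euclidean_space"
  assumes s: "norm s = 1" and r: "0 < r" "r \<le> 1"
  shows "emeasure sphere_measure (sphere 0 1 \<inter> ball s r)
    \<le> ennreal (2 * DIM('a) * unit_ball_vol DIM('a) * 2 ^ DIM('a) * r ^ (DIM('a) - 1))"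
proof -
  define m where "m = nat \<lfloor>1 / r\<rfloor>"
  have sub: "{x \<in> punctured_ball. sgn x \<in> ball s r} \<subseteq> (\<Union>j\<le>m. ball ((j * r) *\<^sub>R s) (2 * r))"
  proof
    fix x assume "x \<in> {x \<in> punctured_ball. sgn x \<in> ball s r}"
    then have x: "x \<noteq> 0" "norm x < 1" "norm (sgn x - s) < r" by (auto simp: dist_norm norm_minus_commute)
    define j where "j = nat \<lfloor>norm x / r\<rfloor>"
    have "j \<le> m" unfolding j_def m_def using x r by (intro nat_mono floor_mono divide_right_mono) auto
    have jr: "real j = of_int \<lfloor>norm x / r\<rfloor>" unfolding j_def using r by simp
    have "j * r \<le> norm x" "norm x < j * r + r"
    proof -
      have "real j \<le> norm x / r" "norm x / r < real j + 1" unfolding jr by linarith+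
      then show "j * r \<le> norm x" "norm x < j * r + r"
        using r by (simp_all add: pos_le_divide_eq pos_divide_less_eq distrib_right)
    qed
    then have 1: "norm ((norm x - j * r) *\<^sub>R s) < r" using s by simp
    have "x - (j * r) *\<^sub>R s = norm x *\<^sub>R (sgn x - s) + (norm x - j * r) *\<^sub>R s"
      using x by (simp add: algebra_simps sgn_div_norm)
    also have "norm \<dots> \<le> norm x * norm (sgn x - s) + norm ((norm x - j * r) *\<^sub>R s)"
      using norm_triangle_ineq by (metis norm_scaleR abs_norm_cancel)
    also have "\<dots> < 1 * r + r"
      using x 1 by (intro add_le_less_mono mult_mono) auto
    finally have "dist ((j * r) *\<^sub>R s) x < 2 * r" by (simp add: dist_norm norm_minus_commute)
    then show "x \<in> (\<Union>j\<le>m. ball ((j * r) *\<^sub>R s) (2 * r))" using \<open>j \<le> m\<close> by auto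
  qed
  have "emeasure lborel {x \<in> punctured_ball. sgn x \<in> ball s r} \<le> emeasure lborel (\<Union>j\<le>m. ball ((j * r) *\<^sub>R s) (2 * r))"
    using sub by (intro emeasure_mono) auto
  also have "\<dots> \<le> (\<Sum>j\<le>m. emeasure lborel (ball ((real j * r) *\<^sub>R s) (2 * r)))"
    by (intro emeasure_subadditive_finite) auto
  also have "\<dots> = (\<Sum>j\<le>m. ennreal (unit_ball_vol DIM('a) * (2 * r) ^ DIM('a)))"
    using r by (intro sum.cong refl emeasure_ball) auto
  also have "\<dots> = ennreal ((real m + 1) * (unit_ball_vol DIM('a) * (2 * r) ^ DIM('a)))"
    using r by (simp add: ennreal_mult'' ennreal_of_nat_eq_real_of_nat add.commute flip: ennreal_plus)
  also have "\<dots> \<le> ennreal (2 / r * (unit_ball_vol DIM('a) * (2 * r) ^ DIM('a)))"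
  proof (intro ennreal_leI mult_right_mono)
    have "real m \<le> 1 / r" unfolding m_def using r by simp
    then show "real m + 1 \<le> 2 / r" using r by (simp add: field_simps)
  qed (use r in auto)
  also have "2 / r * (unit_ball_vol DIM('a) * (2 * r) ^ DIM('a)) = 2 * unit_ball_vol DIM('a) * 2 ^ DIM('a) * r ^ (DIM('a) - 1)"
    using r power_minus_mult[of "DIM('a)" r] by (simp add: power_mult_distrib field_simps)
  finally have "of_nat DIM('a) * emeasure lborel {x \<in> punctured_ball. sgn x \<in> ball s r}
     \<le> of_nat DIM('a) * ennreal (2 * unit_ball_vol DIM('a) * 2 ^ DIM('a) * r ^ (DIM('a) - 1))"
    by (intro mult_left_mono) auto
  also have "\<dots> = ennreal (2 * DIM('a) * unit_ball_vol DIM('a) * 2 ^ DIM('a) * r ^ (DIM('a) - 1))"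
  proof -
    have "of_nat DIM('a) * ennreal c = ennreal (real DIM('a) * c)" if "c \<ge> 0" for c
      using that by (simp add: ennreal_of_nat_eq_real_of_nat ennreal_mult)
    from this[of "2 * unit_ball_vol DIM('a) * 2 ^ DIM('a) * r ^ (DIM('a) - 1)"] show ?thesis
      using r by (simp add: mult.assoc mult.left_commute)
  qed
  finally show ?thesis by (subst emeasure_sphere) auto
qed

lemma integral_lborel_translate:
  fixes g :: "'a::euclidean_space \<Rightarrow> real"
  assumes "g \<in> borel_measurable borel"
  shows "(LINT x|lborel. g (x + c)) = integral\<^sup>L lborel g"
proof -
  have "integral\<^sup>L lborel g = integral\<^sup>L (distr lborel borel ((+) c)) g" by (simp only: lborel_distr_plus)
  also have "\<dots> = (LINT x|lborel. g (c + x))" by (rule integral_distr) (use assms in auto)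
  finally show ?thesis by (simp add: add.commute)
qed

text \<open>The integrals of the difference quotients vanish by translation invariance, and dominated convergence
  carries this over to the derivative.\<close>

lemma integral_directional_derivative_eq_0:
  fixes g :: "'a::euclidean_space \<Rightarrow> real"
  assumes g: "smooth_on_open g UNIV" and supp: "\<And>x. x \<notin> ball 0 1 \<Longrightarrow> g x = 0"
  shows "integrable lborel (\<lambda>x. frechet_derivative g (at x) b)"
    "(LINT x|lborel. frechet_derivative g (at x) b) = 0"
proof -
  define D where "D = (\<lambda>x. frechet_derivative g (at x) b)"
  have der: "(g has_derivative frechet_derivative g (at x)) (at x)" for x
    using smooth_on_open_has_derivative[OF g] by simp
  have contD: "continuous_on UNIV D"
    unfolding D_def by (rule smooth_on_open_continuous[OF smooth_on_open_frechet[OF g]])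
  have contg: "continuous_on UNIV g" by (rule smooth_on_open_continuous[OF g])
  have D0: "D x = 0" if "x \<notin> cball 0 1" for x
  proof -
    have "((\<lambda>x. 0) has_derivative (\<lambda>x. 0)) (at x)" by simp
    then have "(g has_derivative (\<lambda>x. 0)) (at x)"
      by (rule has_derivative_transform_within_open[of _ _ _ _ "- cball 0 1"])
        (use that supp in \<open>auto simp: open_Compl\<close>)
    then show ?thesis using frechet_derivative_at D_def by metis
  qed
  obtain M where M: "\<And>x. \<bar>D x\<bar> \<le> M"
  proof -
    have "compact (D ` cball 0 1)"
      by (intro compact_continuous_image continuous_on_subset[OF contD]) auto
    then obtain M where "\<forall>x\<in>cball 0 1. norm (D x) \<le> M" using compact_imp_bounded bounded_iff by (metis (mono_tags, lifting) image_eqI)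
    then have "\<bar>D x\<bar> \<le> max M 0" for x using D0[of x] by (cases "x \<in> cball 0 1") (fastforce simp: le_max_iff_disj)+
    then show ?thesis using that by blast
  qed
  have M0: "0 \<le> M" using M[of 0] by linarith
  define q where "q = (\<lambda>k::nat. \<lambda>x. (g (x + (1 / Suc k) *\<^sub>R b) - g x) * Suc k)"
  define w where "w = (\<lambda>x::'a. M * indicator (ball 0 (1 + norm b)) x :: real)"
  have lin: "linear (frechet_derivative g (at x))" for x using der has_derivative_linear by blast
  have along: "((\<lambda>t. g (x + t *\<^sub>R b)) has_real_derivative D (x + t *\<^sub>R b)) (at t)" for x t
  proof -
    have "((\<lambda>t. x + t *\<^sub>R b) has_derivative (\<lambda>h. h *\<^sub>R b)) (at t)"
      by (auto intro!: derivative_eq_intros)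
    from diff_chain_at[OF this der]
    have "((\<lambda>t. g (x + t *\<^sub>R b)) has_derivative (\<lambda>h. frechet_derivative g (at (x + t *\<^sub>R b)) (h *\<^sub>R b))) (at t)"
      by (simp add: o_def)
    moreover have "(\<lambda>h. frechet_derivative g (at (x + t *\<^sub>R b)) (h *\<^sub>R b)) = (*) (D (x + t *\<^sub>R b))"
      by (simp add: fun_eq_iff D_def linear_scale[OF lin] mult.commute)
    ultimately show ?thesis unfolding has_field_derivative_def by simp
  qed
  have qM: "\<bar>q k x\<bar> \<le> M" for k x
  proof -
    have "\<exists>t. 0 < t \<and> t < 1 / Suc k \<and> g (x + (1 / Suc k) *\<^sub>R b) - g (x + 0 *\<^sub>R b) = (1 / Suc k - 0) * D (x + t *\<^sub>R b)"
      using MVT2[of 0 "1 / Suc k" "\<lambda>t. g (x + t *\<^sub>R b)" "\<lambda>t. D (x + t *\<^sub>R b)"] along by auto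
    then obtain t where "g (x + (1 / Suc k) *\<^sub>R b) - g x = (1 / Suc k) * D (x + t *\<^sub>R b)" by auto
    then have "q k x = D (x + t *\<^sub>R b)" unfolding q_def by simp
    then show ?thesis using M by simp
  qed
  have q0: "q k x = 0" if "x \<notin> ball 0 (1 + norm b)" for k x
  proof -
    have nx: "1 + norm b \<le> norm x" using that by simp
    have "norm ((1 / Suc k) *\<^sub>R b) \<le> norm b" by (simp add: divide_le_eq mult_left_le mult_le_cancel_left1)
    then have "1 \<le> norm (x + (1 / Suc k) *\<^sub>R b)" using nx norm_diff_ineq[of x "(1 / Suc k) *\<^sub>R b"] by linarith
    moreover have "1 \<le> norm x" using nx norm_ge_zero[of b] by linarith
    ultimately show ?thesis using supp[of x] supp[of "x + (1 / Suc k) *\<^sub>R b"] unfolding q_def by (simp add: not_less)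
  qed
  have qlim: "(\<lambda>k. q k x) \<longlonglongrightarrow> D x" for x
  proof -
    have "(\<lambda>h. (g (x + h *\<^sub>R b) - g x) / h) \<midarrow>0\<rightarrow> D x" using along[of x 0] by (simp add: DERIV_def)
    then have "(\<lambda>k. (g (x + (1 / Suc k) *\<^sub>R b) - g x) / (1 / Suc k)) \<longlonglongrightarrow> D x"
      by (rule filterlim_compose) (auto simp: filterlim_at simp del: of_nat_Suc intro!: LIMSEQ_Suc lim_1_over_n)
    then show ?thesis unfolding q_def by simp
  qed
  have w: "integrable lborel w"
    unfolding w_def using emeasure_lborel_ball_finite by (intro integrable_mult_right integrable_real_indicator) auto
  have mq: "q k \<in> borel_measurable lborel" for k
  proof -
    have "continuous_on UNIV (\<lambda>x. g (x + (1 / real (Suc k)) *\<^sub>R b))"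
      by (rule continuous_on_compose2[OF contg]) (auto intro!: continuous_intros)
    then have "continuous_on UNIV (q k)" unfolding q_def by (intro continuous_intros contg)
    then show ?thesis using borel_measurable_continuous_onI by auto
  qed
  have mD: "D \<in> borel_measurable lborel" using contD borel_measurable_continuous_onI by auto
  have bnd: "norm (q k x) \<le> w x" for k x
    using qM[of k x] q0[of x k] M0 by (auto simp: w_def indicator_def)
  show "integrable lborel (\<lambda>x. frechet_derivative g (at x) b)"
    using integrable_dominated_convergence[where s=q, OF mD mq w] qlim bnd by (simp add: D_def)
  have "(\<lambda>k. integral\<^sup>L lborel (q k)) \<longlonglongrightarrow> integral\<^sup>L lborel D"
    using integral_dominated_convergence[where s=q, OF mD mq w] qlim bnd by simp
  moreover have "integral\<^sup>L lborel (q k) = 0" for k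
  proof -
    have ig: "integrable lborel g"
    proof -
      have "integrable lborel (\<lambda>x. indicator (cball 0 1) x *\<^sub>R g x)"
        by (rule borel_integrable_compact) (use contg continuous_on_subset in auto)
      moreover have "(\<lambda>x. indicator (cball 0 1) x *\<^sub>R g x) = g"
        using supp by (auto simp: indicator_def fun_eq_iff)
      ultimately show ?thesis by simp
    qed
    have mg: "g \<in> borel_measurable borel" using contg borel_measurable_continuous_onI by auto
    have "integrable lborel (\<lambda>x. g (x + c))" for c
    proof -
      have "integrable (distr lborel borel ((+) c)) g" using ig by (simp only: lborel_distr_plus)
      then show ?thesis using integrable_distr_eq[of "(+) c" lborel borel g] mg by (simp add: add.commute)
    qed
    then have "integral\<^sup>L lborel (q k) = ((LINT x|lborel. g (x + (1 / Suc k) *\<^sub>R b)) - integral\<^sup>L lborel g) * Suc k"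
      unfolding q_def using ig by simp
    then show ?thesis using integral_lborel_translate[OF mg] by simp
  qed
  ultimately show "(LINT x|lborel. frechet_derivative g (at x) b) = 0"
    by (simp add: D_def LIMSEQ_const_iff)
qed

lemma has_derivative_sgn:
  fixes x :: "'a::euclidean_space"
  assumes "x \<noteq> 0"
  shows "(sgn has_derivative (\<lambda>v. (v - (v \<bullet> sgn x) *\<^sub>R sgn x) /\<^sub>R norm x)) (at x)"
proof -
  have "((\<lambda>x. inverse (norm x) *\<^sub>R x) has_derivative
     (\<lambda>v. inverse (norm x) *\<^sub>R v + (- (inverse (norm x) * (v \<bullet> sgn x) * inverse (norm x))) *\<^sub>R x)) (at x)"
    using assms by (auto intro!: derivative_eq_intros has_derivative_norm simp: fun_eq_iff)
  moreover have "inverse (norm x) *\<^sub>R v + (- (inverse (norm x) * (v \<bullet> sgn x) * inverse (norm x))) *\<^sub>R x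
     = (v - (v \<bullet> sgn x) *\<^sub>R sgn x) /\<^sub>R norm x" for v
    by (simp add: sgn_div_norm algebra_simps)
  ultimately show ?thesis by (simp add: sgn_div_norm[abs_def])
qed

definition tangential :: "'a::euclidean_space \<Rightarrow> 'a \<Rightarrow> 'a" where
  "tangential y v = v - (v \<bullet> y) *\<^sub>R y"

lemma sum_Basis_linear:
  fixes L :: "'a::euclidean_space \<Rightarrow> 'b::real_vector"
  assumes "linear L"
  shows "(\<Sum>b\<in>Basis. (v \<bullet> b) *\<^sub>R L b) = L v"
  using euclidean_representation[of v] by (metis (mono_tags, lifting) assms linear_scale linear_sum sum.cong)

lemma sphere_div_continuous:
  fixes X :: "'a::euclidean_space \<Rightarrow> 'a"
  assumes X: "smooth_on_open X UNIV"
  shows "continuous_on A (sphere_div X)"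
proof -
  have 1: "continuous_on A (\<lambda>y. frechet_derivative X (at y) v)" for v
    by (rule continuous_on_subset[OF smooth_on_open_continuous[OF smooth_on_open_frechet[OF X]]]) auto
  have "linear (frechet_derivative X (at y))" for y
    using smooth_on_open_has_derivative[OF X, of y] has_derivative_linear by auto
  then have "frechet_derivative X (at y) y = (\<Sum>b\<in>Basis. (y \<bullet> b) *\<^sub>R frechet_derivative X (at y) b)" for y
    by (rule sum_Basis_linear[symmetric])
  then have "continuous_on A (\<lambda>y. frechet_derivative X (at y) y)" using 1 by (auto intro!: continuous_intros)
  then show ?thesis unfolding sphere_div_def[abs_def] using 1 by (intro continuous_intros)
qed

text \<open>A tangential field \<open>U X\<close> on the sphere, extended by zero-homogeneity and multiplied by a radial
  function \<open>\<mu>\<close>, has divergence \<open>\<mu>(r) / r\<close> times the spherical divergence, because the radial derivative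
  of \<open>\<mu>\<close> meets only the vanishing radial component of \<open>X\<close>.\<close>

lemma divergence_radial_extension:
  fixes X :: "'a::euclidean_space \<Rightarrow> 'a" and U :: "'a \<Rightarrow> real"
  assumes X: "X \<in> sphere_vector_fields" and U: "smooth_on_open U (- {0})"
    and \<mu>: "smooth_on_open \<mu> UNIV" and x: "x \<noteq> 0"
  shows "(\<Sum>b\<in>Basis. frechet_derivative (\<lambda>x. (\<mu> (norm x) * U (sgn x)) * (X (sgn x) \<bullet> b)) (at x) b)
    = \<mu> (norm x) / norm x * (frechet_derivative U (at (sgn x)) (X (sgn x)) + U (sgn x) * sphere_div X (sgn x))"
proof -
  define y where "y = sgn x"
  have y: "norm y = 1" "y \<noteq> 0" "y \<bullet> y = 1" using x by (auto simp: y_def norm_sgn sgn_zero_iff dot_square_norm)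
  have Xy: "X y \<bullet> y = 0" and smX: "smooth_on_open X UNIV" using X y by (auto simp: sphere_vector_fields_def)
  define DU where "DU = frechet_derivative U (at y)"
  define DX where "DX = frechet_derivative X (at y)"
  define P where "P = (\<lambda>v. tangential y v /\<^sub>R norm x)"
  have dU: "(U has_derivative DU) (at y)" unfolding DU_def by (rule smooth_on_open_has_derivative[OF U]) (use y in auto)
  have dX: "(X has_derivative DX) (at y)" unfolding DX_def by (rule smooth_on_open_has_derivative[OF smX]) auto
  have lU: "linear DU" and lX: "linear DX" using dU dX has_derivative_linear by auto
  have ds: "(sgn has_derivative P) (at x)"
    using has_derivative_sgn[OF x] by (simp add: P_def tangential_def y_def)
  have dn: "(norm has_derivative (\<lambda>v. v \<bullet> y)) (at x)" using has_derivative_norm[OF x] by (simp add: y_def)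
  obtain \<mu>' where d\<mu>: "(\<mu> has_derivative (\<lambda>h. h * \<mu>')) (at (norm x))"
  proof -
    have "\<mu> differentiable (at (norm x))" using smooth_on_open_differentiable[OF \<mu>] by simp
    then obtain D where "(\<mu> has_real_derivative D) (at (norm x))" using real_differentiable_def by blast
    moreover have "(*) D = (\<lambda>h. h * D)" by (simp add: fun_eq_iff)
    ultimately show ?thesis using that[of D] by (simp add: has_field_derivative_def)
  qed
  have c1: "((\<lambda>x. \<mu> (norm x)) has_derivative (\<lambda>v. (v \<bullet> y) * \<mu>')) (at x)"
    using diff_chain_at[OF dn d\<mu>] by (simp add: o_def)
  have c2: "((\<lambda>x. U (sgn x)) has_derivative (\<lambda>v. DU (P v))) (at x)"
    using diff_chain_at[OF ds, of U DU] dU by (simp add: o_def y_def)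
  have c3: "((\<lambda>x. X (sgn x)) has_derivative (\<lambda>v. DX (P v))) (at x)"
    using diff_chain_at[OF ds, of X DX] dX by (simp add: o_def y_def)
  have fd: "frechet_derivative (\<lambda>x. (\<mu> (norm x) * U (sgn x)) * (X (sgn x) \<bullet> b)) (at x) v
     = (\<mu> (norm x) * U y) * (DX (P v) \<bullet> b) + (\<mu> (norm x) * DU (P v) + (v \<bullet> y) * \<mu>' * U y) * (X y \<bullet> b)" for b v
    using frechet_derivative_at[OF has_derivative_mult[OF has_derivative_mult[OF c1 c2] has_derivative_inner_left[OF c3, of b]]]
    by (simp add: y_def fun_eq_iff)
  have s1: "(\<Sum>b\<in>Basis. DX (P b) \<bullet> b) = sphere_div X y / norm x"
  proof -
    have "(\<Sum>b\<in>Basis. DX (P b) \<bullet> b) = (\<Sum>b\<in>Basis. (DX b \<bullet> b - (b \<bullet> y) * (DX y \<bullet> b)) / norm x)"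
      by (simp add: P_def tangential_def linear_scale[OF lX] linear_diff[OF lX] inner_diff_left divide_inverse mult.commute)
    also have "\<dots> = ((\<Sum>b\<in>Basis. DX b \<bullet> b) - (\<Sum>b\<in>Basis. (y \<bullet> b) * (DX y \<bullet> b))) / norm x"
      by (simp add: sum_subtractf inner_commute flip: sum_divide_distrib)
    also have "(\<Sum>b\<in>Basis. (y \<bullet> b) * (DX y \<bullet> b)) = DX y \<bullet> y"
      by (subst inner_commute) (rule euclidean_inner[symmetric])
    finally show ?thesis by (simp add: sphere_div_def DX_def)
  qed
  have s2: "(\<Sum>b\<in>Basis. DU (P b) * (X y \<bullet> b)) = DU (X y) / norm x"
  proof -
    have lP: "linear (\<lambda>v. DU (P v))"
      using c2 has_derivative_linear by blast
    have "(\<Sum>b\<in>Basis. DU (P b) * (X y \<bullet> b)) = (\<Sum>b\<in>Basis. (X y \<bullet> b) *\<^sub>R DU (P b))" by (simp add: mult.commute)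
    also have "\<dots> = DU (P (X y))" by (rule sum_Basis_linear[OF lP])
    also have "\<dots> = DU (X y) / norm x" using Xy by (simp add: P_def tangential_def linear_scale[OF lU] divide_inverse mult.commute)
    finally show ?thesis .
  qed
  have s3: "(\<Sum>b\<in>Basis. (b \<bullet> y) * (X y \<bullet> b)) = 0"
    using euclidean_inner[of "X y" y] Xy by (simp add: inner_commute mult.commute)
  have "(\<Sum>b\<in>Basis. frechet_derivative (\<lambda>x. (\<mu> (norm x) * U (sgn x)) * (X (sgn x) \<bullet> b)) (at x) b)
    = \<mu> (norm x) * U y * (\<Sum>b\<in>Basis. DX (P b) \<bullet> b) + \<mu> (norm x) * (\<Sum>b\<in>Basis. DU (P b) * (X y \<bullet> b))
      + \<mu>' * U y * (\<Sum>b\<in>Basis. (b \<bullet> y) * (X y \<bullet> b))"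
    unfolding fd by (simp add: sum.distrib sum_distrib_left algebra_simps)
  also have "\<dots> = \<mu> (norm x) / norm x * (DU (X y) + U y * sphere_div X y)"
    unfolding s1 s2 s3 using x by (simp add: field_simps)
  finally show ?thesis by (simp add: DU_def y_def)
qed

text \<open>A smooth function with values in \<open>[0, 1]\<close>, supported in the open unit interval on \<open>[0, \<infinity>)\<close>, which tends
  to \<open>1\<close> there as \<open>j\<close> grows.\<close>

definition radial_cutoff :: "nat \<Rightarrow> real \<Rightarrow> real" where
  "radial_cutoff j r = (1 - cutoff (real (Suc j) * r)) * (1 - cutoff (real (Suc j) * (1 - r)))"

lemma radial_cutoff_bounds: "0 \<le> radial_cutoff j r" "radial_cutoff j r \<le> 1"
  using cutoff_bounds[of "real (Suc j) * r"] cutoff_bounds[of "real (Suc j) * (1 - r)"]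
  by (auto simp: radial_cutoff_def intro: mult_nonneg_nonneg mult_le_one)

lemma radial_cutoff_tendsto:
  assumes "0 < r" "r < 1"
  shows "(\<lambda>j. radial_cutoff j r) \<longlonglongrightarrow> 1"
proof -
  obtain k where k: "inverse (real (Suc k)) < min r (1 - r)" using reals_Archimedean[of "min r (1 - r)"] assms by auto
  have "radial_cutoff j r = 1" if "j \<ge> k" for j
  proof -
    have "inverse (real (Suc j)) \<le> inverse (real (Suc k))" using that by (intro le_imp_inverse_le) auto
    then have "inverse (real (Suc j)) < r" "inverse (real (Suc j)) < 1 - r" using k by linarith+
    then have "1 \<le> Suc j * r" "1 \<le> Suc j * (1 - r)"
      by (simp_all add: inverse_eq_divide pos_divide_less_eq mult.commute del: of_nat_Suc)
    then show ?thesis by (simp add: radial_cutoff_def cutoff_eq_0 del: of_nat_Suc)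
  qed
  then show ?thesis by (intro tendsto_eventually eventually_sequentiallyI)
qed

text \<open>With \<open>\<mu>(r) = r \<chi>(r)\<close>, where \<open>\<chi>\<close> is a radial cutoff, the radial extension has divergence \<open>\<chi>(|x|) h(x / |x|)\<close>
  and compact support in the punctured ball. Its integral vanishes, and \<open>\<chi> \<rightarrow> 1\<close> turns it into the integral of \<open>h\<close>
  against the surface measure, which is defined by the same cone.\<close>

lemma spherical_divergence_theorem:
  fixes X :: "'a::euclidean_space \<Rightarrow> 'a" and U :: "'a \<Rightarrow> real"
  assumes X: "X \<in> sphere_vector_fields" and U: "smooth_on_open U (- {0})"
  defines "h \<equiv> \<lambda>y. frechet_derivative U (at y) (X y) + U y * sphere_div X y"
  shows "continuous_on (sphere 0 1) h" "(LINT y|sphere_measure. h y) = 0"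
proof -
  have smX: "smooth_on_open X UNIV" using X by (simp add: sphere_vector_fields_def)
  have cU: "continuous_on (sphere 0 1) U"
    by (rule continuous_on_subset[OF smooth_on_open_continuous[OF U]]) auto
  have fU: "continuous_on (sphere 0 1) (\<lambda>y. frechet_derivative U (at y) v)" for v
    by (rule continuous_on_subset[OF smooth_on_open_continuous[OF smooth_on_open_frechet[OF U]]]) auto
  have cX: "continuous_on (sphere 0 1) X"
    by (rule continuous_on_subset[OF smooth_on_open_continuous[OF smX]]) auto
  have expand: "frechet_derivative U (at y) v = (\<Sum>b\<in>Basis. (v \<bullet> b) *\<^sub>R frechet_derivative U (at y) b)"
    if "y \<in> sphere 0 1" for y v
  proof -
    have "y \<noteq> 0" using that by auto
    then have "linear (frechet_derivative U (at y))"
      using smooth_on_open_has_derivative[OF U, of y] has_derivative_linear by simp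
    then show ?thesis by (rule sum_Basis_linear[symmetric])
  qed
  have c1: "continuous_on (sphere 0 1) (\<lambda>y. frechet_derivative U (at y) (X y))"
    by (subst continuous_on_cong[OF refl expand]) (auto intro!: continuous_intros fU cX)
  show ch: "continuous_on (sphere 0 1) h"
    unfolding h_def by (intro continuous_intros c1 cU sphere_div_continuous[OF smX])
  obtain M where M: "\<And>y. y \<in> sphere 0 1 \<Longrightarrow> \<bar>h y\<bar> \<le> M"
  proof -
    have "compact (h ` sphere 0 1)" using ch compact_continuous_image compact_sphere by blast
    then show ?thesis using that compact_imp_bounded bounded_iff by (metis (mono_tags, lifting) image_eqI real_norm_def)
  qed
  have int0: "integrable lborel (\<lambda>x. radial_cutoff j (norm x) * h (sgn x)) \<and>
     (LINT x|lborel. radial_cutoff j (norm x) * h (sgn x)) = 0" for j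
  proof -
    define \<mu> where "\<mu> = (\<lambda>r. r * radial_cutoff j r)"
    have sm\<mu>: "smooth_on_open \<mu> UNIV"
      unfolding \<mu>_def radial_cutoff_def
      by (intro smooth_on_open_mult smooth_on_open_diff smooth_on_open_cutoff smooth_on_open_const smooth_on_open_id) auto
    define W where "W = (\<lambda>b x. (\<mu> (norm x) * U (sgn x)) * (X (sgn x) \<bullet> b))"
    define d where "d = 1 / (2 * real (Suc j))"
    have W0: "W b x = 0" if "x \<in> ball 0 d" for b x
    proof -
      have "real (Suc j) * norm x \<le> 1/2" using that unfolding d_def by (simp add: field_simps)
      then show ?thesis by (simp add: W_def \<mu>_def radial_cutoff_def cutoff_eq_1 del: of_nat_Suc)
    qed
    have smW: "smooth_on_open (W b) UNIV" for b
    proof (rule smooth_on_open_local)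
      fix x :: 'a
      show "\<exists>V. x \<in> V \<and> smooth_on_open (W b) V"
      proof (cases "x = 0")
        case True
        have "smooth_on_open (\<lambda>x. 0::real) (ball (0::'a) d)" by (simp add: smooth_on_open_const)
        then have "smooth_on_open (W b) (ball 0 d)" by (rule smooth_on_open_cong) (use W0 in simp)
        then show ?thesis using True by (intro exI[of _ "ball 0 d"]) (auto simp: d_def)
      next
        case False
        have "smooth_on_open (W b) (-{0})"
          unfolding W_def
          by (intro smooth_on_open_mult smooth_on_open_inner smooth_on_open_const
              smooth_on_open_compose[OF sm\<mu> smooth_on_open_norm] smooth_on_open_compose[OF U smooth_on_open_sgn]
              smooth_on_open_compose[OF smX smooth_on_open_sgn]) (auto simp: sgn_zero_iff)
        then show ?thesis using False by (intro exI[of _ "- {0}"]) simp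
      qed
    qed simp
    have out: "W b x = 0" if "x \<notin> ball 0 1" for b x
    proof -
      have "real (Suc j) * (1 - norm x) \<le> 1/2" using that mult_nonneg_nonpos[of "real (Suc j)" "1 - norm x"] by simp
      then show ?thesis by (simp add: W_def \<mu>_def radial_cutoff_def cutoff_eq_1 del: of_nat_Suc)
    qed
    have eq: "(\<Sum>b\<in>Basis. frechet_derivative (W b) (at x) b) = radial_cutoff j (norm x) * h (sgn x)" for x
    proof (cases "x = 0")
      case True
      have "frechet_derivative (W b) (at x) b = 0" for b
      proof -
        have "((\<lambda>x. 0) has_derivative (\<lambda>x. 0)) (at x)" by simp
        then have "(W b has_derivative (\<lambda>x. 0)) (at x)"
          by (rule has_derivative_transform_within_open[of _ _ _ _ "ball 0 d"]) (use True W0 in \<open>auto simp: d_def\<close>)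
        then show ?thesis using frechet_derivative_at by metis
      qed
      then show ?thesis using True by (simp add: radial_cutoff_def cutoff_eq_1)
    next
      case False
      then show ?thesis
        using divergence_radial_extension[OF X U sm\<mu> False] unfolding W_def h_def by (simp add: \<mu>_def)
    qed
    have "integrable lborel (\<lambda>x. \<Sum>b\<in>Basis. frechet_derivative (W b) (at x) b)"
      "(LINT x|lborel. (\<Sum>b\<in>Basis. frechet_derivative (W b) (at x) b)) = 0"
      using integral_directional_derivative_eq_0[OF smW out] by simp_all
    then show ?thesis unfolding eq by simp
  qed
  have bint: "integrable lborel (\<lambda>x. M * indicator (ball (0::'a) 1) x)"
    using emeasure_lborel_ball_finite by (intro integrable_mult_right integrable_real_indicator) auto
  have mh: "(\<lambda>x. indicator punctured_ball x * h (sgn x)) \<in> borel_measurable lborel"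
  proof -
    have "continuous_on punctured_ball (\<lambda>x. h (sgn x))"
      by (rule continuous_on_compose2[OF ch]) (auto intro!: continuous_on_sgn continuous_intros simp: norm_sgn split: if_splits)
    then have "(\<lambda>x. if x \<in> punctured_ball then h (sgn x) else 0) \<in> borel_measurable borel"
      by (intro borel_measurable_continuous_on_if) auto
    moreover have "(\<lambda>x. indicator punctured_ball x * h (sgn x)) = (\<lambda>x. if x \<in> punctured_ball then h (sgn x) else 0)"
      by (auto simp: indicator_def fun_eq_iff)
    ultimately show ?thesis by simp
  qed
  have "(\<lambda>j. LINT x|lborel. radial_cutoff j (norm x) * h (sgn x)) \<longlonglongrightarrow> (LINT x|lborel. indicator punctured_ball x * h (sgn x))"
  proof (rule integral_dominated_convergence[OF mh _ bint])
    show "(\<lambda>x. radial_cutoff j (norm x) * h (sgn x)) \<in> borel_measurable lborel" for j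
      using int0 by (blast intro: borel_measurable_integrable)
    have zero: "radial_cutoff j (norm x) = 0" if "x \<notin> punctured_ball" for j and x :: 'a
    proof (cases "x = 0")
      case False
      then have "real (Suc j) * (1 - norm x) \<le> 1/2" using that mult_nonneg_nonpos[of "real (Suc j)" "1 - norm x"] by simp
      then show ?thesis by (simp add: radial_cutoff_def cutoff_eq_1 del: of_nat_Suc)
    qed (simp add: radial_cutoff_def cutoff_eq_1)
    show "AE x in lborel. (\<lambda>j. radial_cutoff j (norm x) * h (sgn x)) \<longlonglongrightarrow> indicator punctured_ball x * h (sgn x)"
    proof (rule AE_I2)
      fix x :: 'a
      show "(\<lambda>j. radial_cutoff j (norm x) * h (sgn x)) \<longlonglongrightarrow> indicator punctured_ball x * h (sgn x)"
      proof (cases "x \<in> punctured_ball")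
        case True
        then show ?thesis using tendsto_mult_right[OF radial_cutoff_tendsto[of "norm x"], of "h (sgn x)"] by simp
      qed (simp add: zero)
    qed
    show "AE x in lborel. norm (radial_cutoff j (norm x) * h (sgn x)) \<le> M * indicator (ball 0 1) x" for j
    proof (rule AE_I2)
      fix x :: 'a
      show "norm (radial_cutoff j (norm x) * h (sgn x)) \<le> M * indicator (ball 0 1) x"
      proof (cases "x \<in> punctured_ball")
        case True
        then have "\<bar>h (sgn x)\<bar> \<le> M" using M[of "sgn x"] by (simp add: norm_sgn)
        then have "\<bar>radial_cutoff j (norm x)\<bar> * \<bar>h (sgn x)\<bar> \<le> 1 * M"
          using radial_cutoff_bounds[of j "norm x"] by (intro mult_mono) auto
        then show ?thesis using True by (simp add: abs_mult)
      next
        case False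
        have "sgn (SOME b. b \<in> Basis) \<in> sphere (0::'a) 1" using SOME_Basis nonzero_Basis by (simp add: norm_sgn)
        then have "0 \<le> M" using M abs_ge_zero order_trans by blast
        then show ?thesis using zero[OF False] by simp
      qed
    qed
  qed
  then have "(LINT x|lborel. indicator punctured_ball x * h (sgn x)) = 0"
    using int0 by (simp add: LIMSEQ_const_iff)
  then show "(LINT y|sphere_measure. h y) = 0"
    using integral_sphere_measure[OF borel_measurable_sphere_continuous[OF ch]] by simp
qed

definition sphere_grad :: "('a::euclidean_space \<Rightarrow> real) \<Rightarrow> 'a \<Rightarrow> 'a" where
  "sphere_grad U y = tangential y (\<Sum>b\<in>Basis. frechet_derivative U (at y) b *\<^sub>R b)"

lemma sphere_weak_gradient_smooth:
  fixes U :: "'a::euclidean_space \<Rightarrow> real"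
  assumes U: "smooth_on_open U (- {0})"
  shows "sphere_weak_gradient U (sphere_grad U)"
  unfolding sphere_weak_gradient_def
proof (intro conjI ballI AE_I2)
  fix x :: 'a assume "x \<in> space sphere_measure"
  then show "sphere_grad U x \<bullet> x = 0" by (simp add: sphere_grad_def tangential_def inner_diff_left dot_square_norm)
next
  fix X :: "'a \<Rightarrow> 'a" assume X: "X \<in> sphere_vector_fields"
  have smX: "smooth_on_open X UNIV" using X by (simp add: sphere_vector_fields_def)
  have eq: "sphere_grad U y \<bullet> X y = frechet_derivative U (at y) (X y)" if y: "y \<in> sphere 0 1" for y
  proof -
    have "y \<noteq> 0" using y by auto
    then have "linear (frechet_derivative U (at y))"
      using smooth_on_open_has_derivative[OF U, of y] has_derivative_linear by simp
    then have "frechet_derivative U (at y) (X y) = (\<Sum>b\<in>Basis. frechet_derivative U (at y) b *\<^sub>R b) \<bullet> X y"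
      using sum_Basis_linear[of "frechet_derivative U (at y)" "X y", symmetric]
      by (simp add: inner_sum_left inner_sum_right mult.commute inner_commute)
    moreover have "y \<bullet> X y = 0" using X y by (simp add: sphere_vector_fields_def inner_commute)
    ultimately show ?thesis by (simp add: sphere_grad_def tangential_def inner_diff_left)
  qed
  have cU: "continuous_on (sphere 0 1) (\<lambda>y. U y * sphere_div X y)"
    by (intro continuous_intros sphere_div_continuous[OF smX] continuous_on_subset[OF smooth_on_open_continuous[OF U]]) auto
  note h = spherical_divergence_theorem[OF X U]
  have "(LINT y|sphere_measure. sphere_grad U y \<bullet> X y) = (LINT y|sphere_measure.
      (frechet_derivative U (at y) (X y) + U y * sphere_div X y) - U y * sphere_div X y)"
    by (rule Bochner_Integration.integral_cong) (use eq in auto)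
  also have "\<dots> = 0 - (LINT y|sphere_measure. U y * sphere_div X y)"
    using h by (subst Bochner_Integration.integral_diff) (auto intro!: integrable_sphere_continuous cU)
  finally show "(LINT y|sphere_measure. sphere_grad U y \<bullet> X y) = - (LINT y|sphere_measure. U y * sphere_div X y)"
    by simp
qed

section \<open>Spikes of small energy\<close>

text \<open>An upper bound for the operator norm of the derivative that is visibly continuous for smooth \<open>F\<close>.\<close>

definition dnorm :: "('a::euclidean_space \<Rightarrow> 'b::euclidean_space) \<Rightarrow> 'a \<Rightarrow> real" where
  "dnorm F x = (\<Sum>b\<in>Basis. norm (frechet_derivative F (at x) b))"

lemma dnorm_nonneg: "0 \<le> dnorm F x"
  by (simp add: dnorm_def sum_nonneg)

lemma norm_derivative_le_dnorm:
  assumes "linear (frechet_derivative F (at x))"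
  shows "norm (frechet_derivative F (at x) v) \<le> norm v * dnorm F x"
proof -
  have "norm (frechet_derivative F (at x) v) = norm (\<Sum>b\<in>Basis. (v \<bullet> b) *\<^sub>R frechet_derivative F (at x) b)"
    using sum_Basis_linear[OF assms, of v] by simp
  also have "\<dots> \<le> (\<Sum>b\<in>Basis. norm v * norm (frechet_derivative F (at x) b))"
    by (rule sum_norm_le) (auto intro!: mult_right_mono Basis_le_norm)
  finally show ?thesis by (simp add: dnorm_def sum_distrib_left)
qed

lemma dnorm_continuous_on:
  assumes "smooth_on_open F U" "A \<subseteq> U"
  shows "continuous_on A (dnorm F)"
  unfolding dnorm_def
  by (intro continuous_intros continuous_on_subset[OF smooth_on_open_continuous[OF smooth_on_open_frechet] assms(2)] assms(1))

lemma dnorm_cong_open: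
  assumes "open V" "x \<in> V" "\<And>y. y \<in> V \<Longrightarrow> F y = G y" "F differentiable (at x)"
  shows "dnorm G x = dnorm F x"
  using frechet_derivative_transform_within_open[OF assms(4,1,2,3)] by (simp add: dnorm_def)

lemma cutoff_derivative:
  obtains c' M where "\<And>q. (cutoff has_real_derivative c' q) (at q)" "0 \<le> M" "\<And>q. \<bar>c' q\<bar> \<le> M"
    "\<And>q. q < 1/2 \<Longrightarrow> c' q = 0" "\<And>q. q > 1 \<Longrightarrow> c' q = 0"
proof -
  have sm: "smooth_on_open cutoff UNIV" using smooth_on_open_cutoff[OF smooth_on_open_id[OF open_UNIV]] .
  define c' where "c' q = frechet_derivative cutoff (at q) 1" for q
  have der: "(cutoff has_real_derivative c' q) (at q)" for q
  proof -
    have d: "(cutoff has_derivative frechet_derivative cutoff (at q)) (at q)"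
      using smooth_on_open_has_derivative[OF sm] by simp
    then have "linear (frechet_derivative cutoff (at q))" by (rule has_derivative_linear)
    then have "frechet_derivative cutoff (at q) h = c' q * h" for h
      unfolding c'_def using linear_scale[of "frechet_derivative cutoff (at q)" h 1] by (simp add: mult.commute)
    then have "frechet_derivative cutoff (at q) = (*) (c' q)" by auto
    then show ?thesis using d by (simp add: has_field_derivative_def)
  qed
  have cont: "continuous_on UNIV c'"
    unfolding c'_def by (rule smooth_on_open_continuous[OF smooth_on_open_frechet[OF sm]])
  have z1: "c' q = 0" if "q < 1/2" for q
  proof -
    have "((\<lambda>q. 1) has_real_derivative 0) (at q)" by simp
    then have "(cutoff has_real_derivative 0) (at q)"
      by (rule has_field_derivative_transform_within_open[of _ _ _ "{..<1/2}"]) (use that in \<open>auto simp: cutoff_eq_1\<close>)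
    then show ?thesis using der DERIV_unique by blast
  qed
  have z2: "c' q = 0" if "q > 1" for q
  proof -
    have "((\<lambda>q. 0) has_real_derivative 0) (at q)" by simp
    then have "(cutoff has_real_derivative 0) (at q)"
      by (rule has_field_derivative_transform_within_open[of _ _ _ "{1<..}"]) (use that in \<open>auto simp: cutoff_eq_0\<close>)
    then show ?thesis using der DERIV_unique by blast
  qed
  have "compact (c' ` {1/2..1})" by (intro compact_continuous_image continuous_on_subset[OF cont]) auto
  then obtain M where "\<forall>q\<in>{1/2..1}. norm (c' q) \<le> M"
    using compact_imp_bounded bounded_iff by (metis (mono_tags, lifting) image_eqI)
  then have "\<bar>c' q\<bar> \<le> max M 0" for q
    using z1[of q] z2[of q] by (cases "q < 1/2"; cases "q > 1") (auto simp: le_max_iff_disj)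
  then show ?thesis using that[of c' "max M 0"] der z1 z2 by auto
qed

text \<open>Points have zero \<open>n\<close>-capacity in dimension \<open>n \<ge> 2\<close>: averaging \<open>m\<close> cutoffs at the scales
  \<open>w 2\<^sup>-\<^sup>j\<close> gives a spike whose gradients at different scales have disjoint supports and equal energies,
  so its energy is of order \<open>m\<^sup>1\<^sup>-\<^sup>n\<close>.\<close>

lemma low_energy_spike:
  fixes s :: "'a::euclidean_space"
  assumes dim: "3 \<le> DIM('a)" and s: "norm s = 1" and W: "0 < W" and H: "0 < H" and \<epsilon>: "0 < \<epsilon>"
  obtains h :: "'a \<Rightarrow> real" and w v where
    "smooth_on_open h UNIV" "0 < v" "0 < w" "w \<le> W" "\<And>x. 0 \<le> h x" "\<And>x. h x \<le> H"
    "\<And>x. dist s x < v \<Longrightarrow> h x = H" "\<And>x. w \<le> dist s x \<Longrightarrow> h x = 0"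
    "(\<integral>\<^sup>+x. indicator (ball s (2 * w)) x * ennreal ((1 + dnorm h x) ^ (DIM('a) - 1)) \<partial>sphere_measure) \<le> ennreal \<epsilon>"
proof -
  define n where "n = DIM('a) - 1"
  have n: "2 \<le> n" using dim by (simp add: n_def)
  obtain c' M where c': "\<And>q. (cutoff has_real_derivative c' q) (at q)" "0 \<le> M" "\<And>q. \<bar>c' q\<bar> \<le> M"
    "\<And>q. q < 1/2 \<Longrightarrow> c' q = 0" "\<And>q. q > 1 \<Longrightarrow> c' q = 0" using cutoff_derivative by metis
  define K where "K = 2 * DIM('a) * unit_ball_vol DIM('a) * 2 ^ DIM('a)"
  have K: "0 \<le> K" by (simp add: K_def)
  define L where "L = 4 * M * DIM('a) * H"
  have L: "0 \<le> L" using c'(2) H by (simp add: L_def)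
  have capK: "emeasure sphere_measure (sphere 0 1 \<inter> ball s r) \<le> ennreal (K * r ^ n)" if "0 < r" "r \<le> 1" for r
    using emeasure_cap_le[OF s that] by (simp add: K_def n_def)
  \<comment> \<open>The radius \<open>w\<close> makes the measure of the cap small; the number \<open>m\<close> of scales, chosen later, makes the
    gradient part of the energy small, which does not depend on \<open>w\<close>.\<close>
  define w where "w = min (min W (1/2)) (\<epsilon> / (2 ^ n * (K + 1) * 4))"
  have w: "0 < w" "w \<le> W" "w \<le> 1/2" using W \<epsilon> K by (auto simp: w_def)
  have w\<epsilon>: "2 ^ n * K * (2 * w) \<le> \<epsilon> / 2"
  proof -
    have "2 ^ n * K * (2 * w) \<le> 2 ^ n * (K + 1) * (2 * w)" using K w by (intro mult_right_mono mult_left_mono) auto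
    also have "\<dots> \<le> 2 ^ n * (K + 1) * (2 * (\<epsilon> / (2 ^ n * (K + 1) * 4)))"
      using K by (intro mult_left_mono) (auto simp: w_def)
    also have "\<dots> = \<epsilon> / 2"
    proof -
      have gen: "c * (2 * (\<epsilon> / (c * 4))) = \<epsilon> / 2" if "c > 0" for c :: real using that by simp
      show ?thesis by (rule gen) (use K in auto)
    qed
    finally show ?thesis .
  qed
  obtain m :: nat where m: "2 ^ n * K * L ^ n / (\<epsilon> / 2) < real m" using reals_Archimedean2 by blast
  have m0: "0 < m" using m K L \<epsilon> by (metis divide_nonneg_pos half_gt_zero leD mult_nonneg_nonneg of_nat_0 neq0_conv zero_le_numeral zero_le_power)
  define t where "t j x = (4 ^ j / w\<^sup>2) * ((x - s) \<bullet> (x - s))" for j :: nat and x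
  have t_norm: "t j x = (2 ^ j * dist s x / w)\<^sup>2" for j x
  proof -
    have "(4::real) ^ j = (2 ^ j)\<^sup>2" by (simp add: power2_eq_square flip: power_mult_distrib)
    then show ?thesis by (simp add: t_def dot_square_norm dist_norm norm_minus_commute power_mult_distrib power_divide)
  qed
  define h where "h x = (H / m) * (\<Sum>j<m. cutoff (t j x))" for x
  have sm: "smooth_on_open h UNIV"
    unfolding h_def t_def
    by (intro smooth_on_open_mult smooth_on_open_sum smooth_on_open_cutoff smooth_on_open_inner smooth_on_open_diff
        smooth_on_open_const smooth_on_open_id) auto
  define v where "v = w / 2 ^ m"
  have h_zero: "h x = 0" if "w \<le> dist s x" for x
  proof -
    have "1 \<le> t j x" for j
    proof -
      have "1 * w \<le> 2 ^ j * dist s x" using that w by (intro mult_mono) auto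
      then have "1 \<le> 2 ^ j * dist s x / w" using w by (simp add: field_simps)
      then show ?thesis unfolding t_norm by (rule one_le_power)
    qed
    then show ?thesis by (simp add: h_def cutoff_eq_0)
  qed
  have h_top: "h x = H" if "dist s x < v" for x
  proof -
    have "t j x \<le> 1/2" if "j < m" for j
    proof -
      have "2 * 2 ^ j * dist s x \<le> 2 ^ m * dist s x"
        using power_increasing[of "Suc j" m "2::real"] that by (intro mult_right_mono) auto
      also have "\<dots> \<le> w" using \<open>dist s x < v\<close> by (simp add: v_def field_simps)
      finally have "2 ^ j * dist s x / w \<le> 1/2" using w by (simp add: field_simps)
      then have "(2 ^ j * dist s x / w)\<^sup>2 \<le> (1/2)\<^sup>2" using w by (intro power_mono) auto
      also have "(1/2)\<^sup>2 \<le> (1/2 :: real)" by (simp add: power2_eq_square)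
      finally show ?thesis unfolding t_norm .
    qed
    then show ?thesis using m0 by (simp add: h_def cutoff_eq_1)
  qed
  define D where "D j x b = c' (t j x) * (4 ^ j / w\<^sup>2 * (2 * ((x - s) \<bullet> b)))" for j :: nat and x b
  have h_der: "frechet_derivative h (at x) b = (H / m) * (\<Sum>j<m. D j x b)" for x b
  proof -
    have td: "(t j has_derivative (\<lambda>b. 4 ^ j / w\<^sup>2 * (2 * ((x - s) \<bullet> b)))) (at x)" for j
    proof -
      have "((\<lambda>x. (x - s) \<bullet> (x - s)) has_derivative (\<lambda>b. 2 * ((x - s) \<bullet> b))) (at x)"
        by (auto intro!: derivative_eq_intros simp: inner_commute)
      then show ?thesis unfolding t_def[abs_def] by (rule has_derivative_mult_right)
    qed
    have "((\<lambda>x. cutoff (t j x)) has_derivative (\<lambda>b. D j x b)) (at x)" for j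
      using diff_chain_at[OF td c'(1)[unfolded has_field_derivative_def]]
      unfolding o_def D_def .
    then have "(h has_derivative (\<lambda>b. (H / m) * (\<Sum>j<m. D j x b))) (at x)"
      unfolding h_def[abs_def] by (intro has_derivative_mult_right has_derivative_sum)
    then show ?thesis by (metis frechet_derivative_at)
  qed
  define a where "a j = 2 * M * DIM('a) * 2 ^ j / w" for j :: nat
  have a: "0 \<le> a j" for j using c'(2) w by (simp add: a_def)
  define B where "B j = sphere 0 1 \<inter> ball s (2 * w / 2 ^ j)" for j :: nat
  have D_zero: "D j x b = 0" if "\<not> (1/2 \<le> t j x \<and> t j x \<le> 1)" for j x b
    using that c'(4,5) by (auto simp: D_def not_le)
  have D_le: "\<bar>D j x b\<bar> \<le> 2 * M * 2 ^ j / w \<and> dist s x \<le> w / 2 ^ j"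
    if "1/2 \<le> t j x \<and> t j x \<le> 1" "b \<in> Basis" for j x b
  proof -
    have "2 ^ j * dist s x / w \<le> 1"
      using that unfolding t_norm by (metis abs_le_square_iff abs_one abs_of_nonneg power_one abs_ge_self order_trans)
    then have d: "dist s x \<le> w / 2 ^ j" using w by (simp add: field_simps)
    have "\<bar>(x - s) \<bullet> b\<bar> \<le> dist s x" using Basis_le_norm[OF that(2), of "x - s"] by (simp add: dist_norm norm_minus_commute)
    then have "\<bar>D j x b\<bar> \<le> M * (4 ^ j / w\<^sup>2 * (2 * (w / 2 ^ j)))"
      unfolding D_def abs_mult using c'(2,3) d w by (intro mult_mono) auto
    also have "\<dots> = 2 * M * 2 ^ j / w"
    proof -
      have "(4::real) ^ j = 2 ^ j * 2 ^ j" by (simp flip: power_mult_distrib)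
      then show ?thesis using w by (simp add: power2_eq_square field_simps)
    qed
    finally show ?thesis using d by simp
  qed
  \<comment> \<open>At most one scale contributes to the gradient at a given point, as \<open>t\<close> grows by the factor four from one
    scale to the next while the derivative of the cutoff lives on \<open>[1/2, 1]\<close>.\<close>
  have dn: "dnorm h x ^ n \<le> (\<Sum>j<m. (H / m * a j) ^ n * indicator (B j) x)" if x: "x \<in> sphere 0 1" for x
  proof (cases "\<exists>j<m. 1/2 \<le> t j x \<and> t j x \<le> 1")
    case False
    then have "dnorm h x = 0" using D_zero by (simp add: dnorm_def h_der)
    then have z: "dnorm h x ^ n = 0" using n by (simp add: power_0_left)
    show ?thesis unfolding z by (intro sum_nonneg mult_nonneg_nonneg zero_le_power) (use H a in auto)
  next
    case True
    then obtain j where j: "j < m" "1/2 \<le> t j x" "t j x \<le> 1" by blast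
    have "D i x b = 0" if "i < m" "i \<noteq> j" for i b
    proof (rule D_zero, rule notI)
      assume i: "1/2 \<le> t i x \<and> t i x \<le> 1"
      have step: "4 * t p x \<le> t q x" if "p < q" for p q
      proof -
        have "(4::real) * 4 ^ p \<le> 4 ^ q" using power_increasing[of "Suc p" q "4::real"] that by simp
        then have "4 * 4 ^ p * (((x - s) \<bullet> (x - s)) / w\<^sup>2) \<le> 4 ^ q * (((x - s) \<bullet> (x - s)) / w\<^sup>2)"
          by (intro mult_right_mono) auto
        then show ?thesis by (simp add: t_def)
      qed
      show False using step[of i j] step[of j i] i j that by (cases "i < j") auto
    qed
    then have "(\<Sum>i<m. D i x b) = D j x b" for b
      using j(1) by (subst sum.remove[of _ j]) (auto intro!: sum.neutral)
    then have "dnorm h x = (\<Sum>b\<in>Basis. H / m * \<bar>D j x b\<bar>)" using H by (simp add: dnorm_def h_der abs_mult)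
    also have "\<dots> \<le> (\<Sum>b\<in>(Basis :: 'a set). H / m * (2 * M * 2 ^ j / w))"
      using D_le j H by (intro sum_mono mult_left_mono) auto
    also have "\<dots> = H / m * a j" by (simp add: a_def)
    finally have "dnorm h x ^ n \<le> (H / m * a j) ^ n" using dnorm_nonneg by (intro power_mono)
    also have "\<dots> = (H / m * a j) ^ n * indicator (B j) x"
    proof -
      have "dist s x \<le> w / 2 ^ j" using D_le[of j x "SOME b. b \<in> Basis"] j SOME_Basis by blast
      also have "\<dots> < 2 * w / 2 ^ j" using w by (intro divide_strict_right_mono) auto
      finally show ?thesis using x by (simp add: B_def)
    qed
    also have "\<dots> \<le> (\<Sum>j<m. (H / m * a j) ^ n * indicator (B j) x)"
      using j H a by (intro member_le_sum) auto
    finally show ?thesis .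
  qed
  have Bm: "B j \<in> sets sphere_measure" for j by (auto simp: B_def sets_restrict_space)
  \<comment> \<open>The \<open>n\<close>-energy is scale invariant: each scale contributes the same amount.\<close>
  have Be: "(H / m * a j) ^ n * (K * (2 * w / 2 ^ j) ^ n) = K * (L / m) ^ n" for j
    using w by (simp add: a_def L_def flip: power_mult_distrib) (simp add: field_simps)
  have "(\<integral>\<^sup>+x. indicator (ball s (2 * w)) x * ennreal ((1 + dnorm h x) ^ n) \<partial>sphere_measure)
      \<le> (\<integral>\<^sup>+x. (ennreal (2 ^ n) * indicator (B 0) x + (\<Sum>j<m. ennreal (2 ^ n * (H / m * a j) ^ n) * indicator (B j) x)) \<partial>sphere_measure)"
  proof (rule nn_integral_mono)
    fix x :: 'a assume "x \<in> space sphere_measure"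
    then have x: "x \<in> sphere 0 1" by simp
    have "(1 + dnorm h x) ^ n \<le> 2 ^ n * (1 + dnorm h x ^ n)"
    proof -
      have "1 + dnorm h x \<le> 2 * max 1 (dnorm h x)" by simp
      then have "(1 + dnorm h x) ^ n \<le> (2 * max 1 (dnorm h x)) ^ n"
        using dnorm_nonneg[of h x] by (intro power_mono) auto
      also have "\<dots> \<le> 2 ^ n * (1 + dnorm h x ^ n)"
        using dnorm_nonneg[of h x] by (cases "dnorm h x \<le> 1") (auto simp: power_mult_distrib max_def)
      finally show ?thesis .
    qed
    also have "\<dots> \<le> 2 ^ n * (1 + (\<Sum>j<m. (H / m * a j) ^ n * indicator (B j) x))"
      using dn[OF x] by simp
    finally have le: "(1 + dnorm h x) ^ n \<le> 2 ^ n + (\<Sum>j<m. 2 ^ n * (H / m * a j) ^ n * indicator (B j) x)"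
      by (simp only: distrib_left sum_distrib_left mult.assoc mult_1_right)
    have nn: "0 \<le> 2 ^ n * (H / m * a j) ^ n * indicator (B j) x" for j
      using H a by (intro mult_nonneg_nonneg zero_le_power) auto
    have "ennreal ((1 + dnorm h x) ^ n) \<le> ennreal (2 ^ n) + (\<Sum>j<m. ennreal (2 ^ n * (H / m * a j) ^ n * indicator (B j) x))"
    proof -
      have "ennreal (2 ^ n + (\<Sum>j<m. F j)) = ennreal (2 ^ n) + (\<Sum>j<m. ennreal (F j))"
        if "\<And>j. 0 \<le> F j" for F :: "nat \<Rightarrow> real"
        using that by (simp add: ennreal_plus sum_nonneg sum_ennreal)
      from this[OF nn] show ?thesis using ennreal_leI[OF le] by simp
    qed
    moreover have "ennreal (2 ^ n * (H / m * a j) ^ n * indicator (B j) x) = ennreal (2 ^ n * (H / m * a j) ^ n) * indicator (B j) x" for j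
      by (simp add: indicator_def)
    ultimately have "ennreal ((1 + dnorm h x) ^ n)
       \<le> ennreal (2 ^ n) + (\<Sum>j<m. ennreal (2 ^ n * (H / m * a j) ^ n) * indicator (B j) x)" by simp
    then show "indicator (ball s (2 * w)) x * ennreal ((1 + dnorm h x) ^ n)
       \<le> ennreal (2 ^ n) * indicator (B 0) x + (\<Sum>j<m. ennreal (2 ^ n * (H / m * a j) ^ n) * indicator (B j) x)"
      using x by (cases "x \<in> ball s (2 * w)") (auto simp: B_def[of 0])
  qed
  also have "\<dots> = ennreal (2 ^ n) * emeasure sphere_measure (B 0)
      + (\<Sum>j<m. ennreal (2 ^ n * (H / m * a j) ^ n) * emeasure sphere_measure (B j))"
  proof -
    have m: "(\<lambda>x. c * indicator (B j) x) \<in> borel_measurable sphere_measure" for c :: ennreal and j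
      using Bm[of j] by (intro borel_measurable_times_ennreal borel_measurable_indicator) auto
    have "(\<integral>\<^sup>+x. (c * indicator (B 0) x + (\<Sum>j<m. d j * indicator (B j) x)) \<partial>sphere_measure)
      = c * emeasure sphere_measure (B 0) + (\<Sum>j<m. d j * emeasure sphere_measure (B j))" for c and d :: "nat \<Rightarrow> ennreal"
      by (simp only: nn_integral_add[OF m borel_measurable_sum[OF m]] nn_integral_sum[OF m]
          nn_integral_cmult_indicator[OF Bm])
    then show ?thesis .
  qed
  also have "\<dots> \<le> ennreal (2 ^ n) * ennreal (K * (2 * w) ^ n)
      + (\<Sum>j<m. ennreal (2 ^ n * (H / m * a j) ^ n) * ennreal (K * (2 * w / 2 ^ j) ^ n))"
  proof (intro add_mono mult_left_mono sum_mono)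
    show "emeasure sphere_measure (B 0) \<le> ennreal (K * (2 * w) ^ n)"
      using capK[of "2 * w"] w by (simp add: B_def)
    show "emeasure sphere_measure (B j) \<le> ennreal (K * (2 * w / 2 ^ j) ^ n)" for j
    proof -
      have "2 * w / 2 ^ j \<le> 1" using w by (simp add: divide_le_eq order_trans[OF _ one_le_power])
      then show ?thesis unfolding B_def using w by (intro capK) auto
    qed
  qed auto
  also have "\<dots> = ennreal (2 ^ n * (K * (2 * w) ^ n) + (\<Sum>j<m. 2 ^ n * (H / m * a j) ^ n * (K * (2 * w / 2 ^ j) ^ n)))"
  proof -
    have "0 \<le> 2 ^ n * (H / m * a j) ^ n" "0 \<le> K * (2 * w / 2 ^ j) ^ n" "0 \<le> K * (2 * w) ^ n" for j
      using H a K w by auto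
    then show ?thesis by (simp add: ennreal_mult ennreal_plus sum_nonneg flip: sum_ennreal)
  qed
  also have "\<dots> \<le> ennreal \<epsilon>"
  proof (rule ennreal_leI)
    have "(2 * w) ^ n \<le> (2 * w) ^ 1" using w n by (intro power_decreasing) auto
    then have "2 ^ n * K * (2 * w) ^ n \<le> 2 ^ n * K * (2 * w)" using K by (intro mult_left_mono) auto
    then have "2 ^ n * K * (2 * w) ^ n \<le> \<epsilon> / 2" using w\<epsilon> by (rule order_trans)
    then have 1: "2 ^ n * (K * (2 * w) ^ n) \<le> \<epsilon> / 2" by (simp only: mult.assoc)
    have "(\<Sum>j<m. 2 ^ n * (H / m * a j) ^ n * (K * (2 * w / 2 ^ j) ^ n)) = real m * (2 ^ n * K * (L / m) ^ n)"
      unfolding mult.assoc[of "2 ^ n"] Be by simp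
    also have "\<dots> = 2 ^ n * K * L ^ n * (real m / real m ^ n)" by (simp add: power_divide)
    also have "\<dots> \<le> 2 ^ n * K * L ^ n * (1 / real m)"
    proof (intro mult_left_mono)
      have "real m ^ 2 \<le> real m ^ n" using m0 n by (intro power_increasing) auto
      then show "real m / real m ^ n \<le> 1 / real m" using m0 by (simp add: field_simps power2_eq_square)
    qed (use K L in auto)
    also have "\<dots> \<le> \<epsilon> / 2" using m m0 \<epsilon> by (simp add: field_simps)
    finally show "2 ^ n * (K * (2 * w) ^ n) + (\<Sum>j<m. 2 ^ n * (H / m * a j) ^ n * (K * (2 * w / 2 ^ j) ^ n)) \<le> \<epsilon>"
      using 1 by simp
  qed
  finally have energy: "(\<integral>\<^sup>+x. indicator (ball s (2 * w)) x * ennreal ((1 + dnorm h x) ^ n) \<partial>sphere_measure) \<le> ennreal \<epsilon>" .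
  have "(\<Sum>j<m. cutoff (t j x)) \<le> real m" for x
    using sum_mono[of "{..<m}" "\<lambda>j. cutoff (t j x)" "\<lambda>_. 1"] cutoff_bounds by simp
  then have "h x \<le> H" "0 \<le> h x" for x
    using m0 H cutoff_bounds by (auto simp: h_def field_simps sum_nonneg)
  then show ?thesis
    using that[OF sm, of v w] w h_zero h_top energy by (simp add: n_def v_def)
qed

text \<open>The origin is exempt because the radial maps below are positively homogeneous of degree one, hence not
  smooth there.\<close>

definition homeo_pair :: "('a::euclidean_space \<Rightarrow> 'a) \<Rightarrow> ('a \<Rightarrow> 'a) \<Rightarrow> bool" where
  "homeo_pair F G \<longleftrightarrow> (\<forall>x. G (F x) = x) \<and> (\<forall>x. F (G x) = x) \<and> continuous_on UNIV F \<and> continuous_on UNIV G \<and>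
     smooth_on_open F (- {0}) \<and> smooth_on_open G (- {F 0})"

lemma homeo_pair_diffeo_compose:
  assumes "homeo_pair F G" "diffeo_pair A B" "A (F 0) = F 0"
  shows "homeo_pair (\<lambda>x. A (F x)) (\<lambda>x. G (B x))"
proof -
  have cA: "continuous_on UNIV A" "continuous_on UNIV B"
    using assms(2) smooth_on_open_continuous unfolding diffeo_pair_def by auto
  have "A (B x) = x" for x using assms(2) by (simp add: diffeo_pair_def)
  then have "x = F 0" if "B x = F 0" for x using that assms(3) by metis
  then have im: "B ` (- {F 0}) \<subseteq> - {F 0}" by auto
  have "smooth_on_open (\<lambda>x. G (B x)) (- {F 0})"
    using assms(1,2) unfolding homeo_pair_def diffeo_pair_def
    by (intro conjI smooth_on_open_compose[of G "- {F 0}" B "- {F 0}", OF _ _ im])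
      (auto intro: smooth_on_open_subset[of B UNIV])
  moreover have "smooth_on_open (\<lambda>x. A (F x)) (- {0})"
    using assms(1,2) unfolding homeo_pair_def diffeo_pair_def
    by (intro smooth_on_open_compose[of A UNIV F "- {0}"]) auto
  ultimately show ?thesis
    using assms cA unfolding homeo_pair_def diffeo_pair_def
    by (auto intro!: continuous_on_compose2[OF cA(1)] continuous_on_compose2[of UNIV G UNIV B])
qed

lemma homeo_pair_compose:
  assumes "homeo_pair F G" "homeo_pair A B" "A 0 = 0"
  shows "homeo_pair (\<lambda>x. F (A x)) (\<lambda>x. B (G x))"
proof -
  have "B (A x) = x" "F (G x) = x" for x using assms(1,2) by (auto simp: homeo_pair_def)
  then have nz: "A x = 0 \<Longrightarrow> x = 0" and nz': "G x = 0 \<Longrightarrow> x = F 0" for x using assms(3) by metis+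
  have im: "A ` (- {0}) \<subseteq> - {0}" "G ` (- {F 0}) \<subseteq> - {0}" using nz nz' by auto
  have "smooth_on_open (\<lambda>x. F (A x)) (- {0})"
    using assms(1,2) unfolding homeo_pair_def by (intro smooth_on_open_compose[of F "- {0}" A "- {0}", OF _ _ im(1)]) auto
  moreover have "smooth_on_open (\<lambda>x. B (G x)) (- {F 0})"
    using assms unfolding homeo_pair_def by (intro smooth_on_open_compose[of B "- {0}" G "- {F 0}", OF _ _ im(2)]) (auto simp: \<open>A 0 = 0\<close>)
  ultimately show ?thesis
    using assms unfolding homeo_pair_def
    by (auto intro!: continuous_on_compose2[of UNIV F UNIV A] continuous_on_compose2[of UNIV B UNIV G])
qed

text \<open>The map preserves rays and stretches each of them by a constant factor, so its inverse is explicit.\<close>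

lemma homeo_pair_radial:
  fixes h :: "'a::euclidean_space \<Rightarrow> real"
  assumes sm: "smooth_on_open h UNIV" and h: "\<And>x. 0 \<le> h x" "\<And>x. h x \<le> 1"
  shows "homeo_pair (\<lambda>x. (1 + h (sgn x)) *\<^sub>R x) (\<lambda>x. inverse (1 + h (sgn x)) *\<^sub>R x)"
proof -
  have pos: "0 < 1 + h x" for x using h(1)[of x] by linarith
  then have nz: "1 + h x \<noteq> 0" for x by (metis less_irrefl)
  have sgn1: "sgn ((1 + h (sgn x)) *\<^sub>R x) = sgn x" "sgn (inverse (1 + h (sgn x)) *\<^sub>R x) = sgn x" for x
    using pos by (auto simp: sgn_scaleR)
  have smh: "smooth_on_open (\<lambda>x. 1 + h (sgn x)) (- {0})"
    by (intro smooth_on_open_add smooth_on_open_const smooth_on_open_compose[OF sm smooth_on_open_sgn]) auto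
  have s1: "smooth_on_open (\<lambda>x. (1 + h (sgn x)) *\<^sub>R x) (- {0})"
    by (intro smooth_on_open_scaleR smh smooth_on_open_id) auto
  have s2: "smooth_on_open (\<lambda>x. inverse (1 + h (sgn x)) *\<^sub>R x) (- {0})"
    by (intro smooth_on_open_scaleR smooth_on_open_inverse smh smooth_on_open_id nz) auto
  have c: "continuous_on UNIV f" if sm: "smooth_on_open f (- {0})" and bd: "\<And>x. norm (f x) \<le> 2 * norm x"
    for f :: "'a \<Rightarrow> 'a"
  proof -
    have "isCont f x" for x
    proof (cases "x = 0")
      case True
      have "f 0 = 0" using bd[of 0] by simp
      moreover have "(f \<longlongrightarrow> 0) (at 0)"
        by (rule Lim_null_comparison[of _ "\<lambda>x. 2 * norm x"]) (use bd in \<open>auto intro!: tendsto_eq_intros\<close>)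
      ultimately show ?thesis using True by (simp add: isCont_def)
    next
      case False
      then show ?thesis using smooth_on_open_continuous[OF sm] continuous_on_eq_continuous_at[of "- {0}" f] by auto
    qed
    then show ?thesis by (simp add: continuous_at_imp_continuous_on)
  qed
  have b1: "norm ((1 + h (sgn x)) *\<^sub>R x) \<le> 2 * norm x" for x
    using h[of "sgn x"] by (auto intro!: mult_right_mono)
  have b2: "norm (inverse (1 + h (sgn x)) *\<^sub>R x) \<le> 2 * norm x" for x
  proof -
    have "inverse (1 + h (sgn x)) \<le> 1" using h(1)[of "sgn x"] by (simp add: inverse_le_1_iff)
    then have "inverse (1 + h (sgn x)) \<le> 2" by linarith
    then show ?thesis using pos[of "sgn x"] by (auto intro!: mult_right_mono simp: less_imp_le)
  qed
  show ?thesis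
    unfolding homeo_pair_def using s1 s2 c[OF s1 b1] c[OF s2 b2] nz by (auto simp: sgn1)
qed

lemma derivative_radial_le:
  fixes h :: "'a::euclidean_space \<Rightarrow> real"
  assumes sm: "smooth_on_open h UNIV" and h: "\<And>x. 0 \<le> h x" "\<And>x. h x \<le> 1" and x: "norm x = 1"
    and v: "norm v \<le> 1"
  shows "norm (frechet_derivative (\<lambda>x. (1 + h (sgn x)) *\<^sub>R x) (at x) v) \<le> 2 * (1 + dnorm h x)"
proof -
  have x0: "x \<noteq> 0" "sgn x = x" using x by (auto simp: sgn_div_norm)
  have dh: "(h has_derivative frechet_derivative h (at x)) (at (sgn x))"
    using smooth_on_open_has_derivative[OF sm, of x] x0 by simp
  then have lin: "linear (frechet_derivative h (at x))" by (rule has_derivative_linear)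
  have "((\<lambda>x. h (sgn x)) has_derivative (\<lambda>v. frechet_derivative h (at x) (tangential x v))) (at x)"
    using diff_chain_at[OF has_derivative_sgn[OF x0(1)] dh] x x0 by (simp add: o_def tangential_def)
  then have "((\<lambda>x. (1 + h (sgn x)) *\<^sub>R x) has_derivative
      (\<lambda>v. (1 + h x) *\<^sub>R v + frechet_derivative h (at x) (tangential x v) *\<^sub>R x)) (at x)"
    using x0 by (auto intro!: derivative_eq_intros)
  from frechet_derivative_at[OF this, symmetric]
  have "norm (frechet_derivative (\<lambda>x. (1 + h (sgn x)) *\<^sub>R x) (at x) v)
     = norm ((1 + h x) *\<^sub>R v + frechet_derivative h (at x) (tangential x v) *\<^sub>R x)"
    by simp
  also have "\<dots> \<le> norm ((1 + h x) *\<^sub>R v) + norm (frechet_derivative h (at x) (tangential x v) *\<^sub>R x)"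
    by (rule norm_triangle_ineq)
  also have "norm ((1 + h x) *\<^sub>R v) \<le> 2 * 1"
    unfolding norm_scaleR using h[of x] v by (intro mult_mono) auto
  also have "norm (frechet_derivative h (at x) (tangential x v) *\<^sub>R x) \<le> norm (tangential x v) * dnorm h x"
    using norm_derivative_le_dnorm[OF lin] x by simp
  also have "norm (tangential x v) \<le> 2"
  proof -
    have "norm (tangential x v) \<le> norm v + \<bar>v \<bullet> x\<bar>"
      unfolding tangential_def using norm_triangle_ineq4[of v "(v \<bullet> x) *\<^sub>R x"] x by simp
    moreover have "\<bar>v \<bullet> x\<bar> \<le> norm v" using Cauchy_Schwarz_ineq2[of v x] x by simp
    ultimately show ?thesis using v by linarith
  qed
  finally show ?thesis using dnorm_nonneg[of h x] by (simp add: mult_right_mono)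
qed

section \<open>Growing one finger\<close>

text \<open>A thin shell over the cap of radius \<open>u\<close> about \<open>s\<close>, just outside the unit ball if \<open>b\<close> is close to \<open>1\<close>.\<close>

definition sector :: "'a::euclidean_space \<Rightarrow> real \<Rightarrow> real \<Rightarrow> 'a set" where
  "sector s u b = {x. 1 < norm x \<and> norm x < b \<and> norm (sgn x - s) < u}"

lemma sector_mono: "u \<le> u' \<Longrightarrow> b \<le> b' \<Longrightarrow> sector s u b \<subseteq> sector s u' b'"
  by (auto simp: sector_def)

lemma sector_nonzero: "x \<in> sector s u b \<Longrightarrow> x \<noteq> 0"
  by (auto simp: sector_def)

lemma sector_disjoint_cball: "sector s u b \<inter> cball 0 1 = {}"
  by (auto simp: sector_def)

lemma open_sector: "open (sector s u b)" for s :: "'a::euclidean_space"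
proof -
  have "continuous_on (- {0}) (\<lambda>x::'a. norm (sgn x - s))"
    by (intro continuous_intros continuous_on_sgn) auto
  then have "open {x \<in> - {0}. norm (sgn x - s) \<in> {..<u}}"
    by (intro continuous_open_preimage[of "- {0}", unfolded vimage_def Int_def mem_Collect_eq]) auto
  moreover have "open {x::'a. 1 < norm x \<and> norm x < b}"
    by (intro open_Collect_conj open_Collect_less continuous_intros)
  ultimately have "open ({x \<in> - {0}. norm (sgn x - s) \<in> {..<u}} \<inter> {x. 1 < norm x \<and> norm x < b})" by blast
  moreover have "{x \<in> - {0}. norm (sgn x - s) \<in> {..<u}} \<inter> {x. 1 < norm x \<and> norm x < b} = sector s u b"
    by (auto simp: sector_def)
  ultimately show ?thesis by simp
qed

text \<open>The directions in the cap form a convex cone, and the sector is a continuous image of the product of this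
  cone with an interval of radii.\<close>

lemma connected_sector:
  fixes s :: "'a::euclidean_space"
  assumes s: "norm s = 1" and u: "u \<le> 1"
  shows "connected (sector s u b)"
proof -
  define c where "c = 1 - u\<^sup>2 / 2"
  define K where "K = {z. c * norm z < z \<bullet> s}"
  have K: "z \<in> K \<longleftrightarrow> z \<noteq> 0 \<and> norm (sgn z - s) < u" if "0 \<le> u" for z
  proof (cases "z = 0")
    case False
    have ss: "s \<bullet> s = 1" using s by (simp add: dot_square_norm)
    have "(norm (sgn z - s))\<^sup>2 = 2 - 2 * (sgn z \<bullet> s)"
    proof -
      have "sgn z \<bullet> sgn z = 1" using False by (simp add: dot_square_norm norm_sgn)
      then show ?thesis using ss
        by (simp add: power2_norm_eq_inner inner_diff_left inner_diff_right) (simp add: inner_commute)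
    qed
    moreover have "norm (sgn z - s) < u \<longleftrightarrow> (norm (sgn z - s))\<^sup>2 < u\<^sup>2"
      using that power_strict_mono[of "norm (sgn z - s)" u 2] power2_less_imp_less[of "norm (sgn z - s)" u] by auto
    ultimately have "norm (sgn z - s) < u \<longleftrightarrow> c < sgn z \<bullet> s" by (auto simp: c_def)
    also have "\<dots> \<longleftrightarrow> z \<in> K" using False by (simp add: K_def sgn_div_norm field_simps)
    finally show ?thesis using False by simp
  qed (simp add: K_def)
  show ?thesis
  proof (cases "0 \<le> u")
    case False
    then have "sector s u b = {}" by (auto simp: sector_def) (smt (verit) norm_ge_zero)
    then show ?thesis by simp
  next
    case True
    have c0: "0 \<le> c" using True u power_le_one[of u 2] by (simp add: c_def)
    have "convex K"
      unfolding convex_def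
    proof (intro ballI allI impI)
      fix x y :: 'a and a d :: real
      assume xy: "x \<in> K" "y \<in> K" and ad: "0 \<le> a" "0 \<le> d" "a + d = 1"
      have "c * norm (a *\<^sub>R x + d *\<^sub>R y) \<le> c * (a * norm x + d * norm y)"
        using c0 ad norm_triangle_ineq[of "a *\<^sub>R x" "d *\<^sub>R y"] by (intro mult_left_mono) auto
      also have "\<dots> = a * (c * norm x) + d * (c * norm y)" by (simp add: algebra_simps)
      also have "\<dots> < a * (x \<bullet> s) + d * (y \<bullet> s)"
      proof (cases "a = 0")
        case True
        then show ?thesis using xy ad by (simp add: K_def)
      next
        case False
        then have "a * (c * norm x) < a * (x \<bullet> s)" using xy ad by (simp add: K_def)
        moreover have "d * (c * norm y) \<le> d * (y \<bullet> s)" using xy ad by (intro mult_left_mono) (auto simp: K_def)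
        ultimately show ?thesis by linarith
      qed
      finally show "a *\<^sub>R x + d *\<^sub>R y \<in> K" by (simp add: K_def inner_add_left)
    qed
    then have "connected (K \<times> {1<..<b})" by (intro connected_Times convex_connected) auto
    moreover have "continuous_on (K \<times> {1<..<b}) (\<lambda>(z, r). r *\<^sub>R sgn z)"
    proof -
      have "fst p \<noteq> 0" if "p \<in> K \<times> {1<..<b}" for p using that K[OF True, of "fst p"] by auto
      then show ?thesis unfolding case_prod_unfold by (intro continuous_intros continuous_on_sgn) auto
    qed
    ultimately have "connected ((\<lambda>(z, r). r *\<^sub>R sgn z) ` (K \<times> {1<..<b}))"
      by (rule connected_continuous_image[rotated])
    moreover have "(\<lambda>(z, r). r *\<^sub>R sgn z) ` (K \<times> {1<..<b}) = sector s u b"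
    proof (intro equalityI subsetI)
      fix x assume "x \<in> (\<lambda>(z, r). r *\<^sub>R sgn z) ` (K \<times> {1<..<b})"
      then obtain z r where zr: "z \<in> K" "1 < r" "r < b" "x = r *\<^sub>R sgn z" by auto
      then have "norm x = r" "sgn x = sgn z"
        using K[OF True, of z] by (auto simp: norm_sgn sgn_scaleR sgn_div_norm[of "sgn z"])
      then show "x \<in> sector s u b" using zr K[OF True, of z] by (simp add: sector_def)
    next
      fix x assume x: "x \<in> sector s u b"
      then have "x \<noteq> 0" by (rule sector_nonzero)
      then have "x \<in> K" using x K[OF True, of x] by (simp add: sector_def)
      have eq: "norm x *\<^sub>R sgn x = x" using \<open>x \<noteq> 0\<close> by (simp add: sgn_div_norm)
      show "x \<in> (\<lambda>(z, r). r *\<^sub>R sgn z) ` (K \<times> {1<..<b})"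
      proof (rule image_eqI)
        show "x = (\<lambda>(z, r). r *\<^sub>R sgn z) (x, norm x)" by (simp add: eq)
        show "(x, norm x) \<in> K \<times> {1<..<b}" using x \<open>x \<in> K\<close> by (simp add: sector_def)
      qed
    qed
    ultimately show ?thesis by simp
  qed
qed

lemma sector_norm_diff:
  assumes "x \<in> sector s u b"
  shows "norm (x - s) < (b - 1) + u"
proof -
  have x: "1 < norm x" "norm x < b" "norm (sgn x - s) < u" using assms by (auto simp: sector_def)
  have "x \<noteq> 0" using x by auto
  then have "x - sgn x = (norm x - 1) *\<^sub>R sgn x" by (simp add: sgn_div_norm algebra_simps)
  then have "norm (x - sgn x) = norm x - 1" using x \<open>x \<noteq> 0\<close> by (simp add: norm_sgn)
  then show ?thesis using x norm_triangle_ineq[of "x - sgn x" "sgn x - s"] by simp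
qed

lemma scaleR_in_sector:
  assumes "norm s = 1" "1 < r" "r < b" "0 < u"
  shows "r *\<^sub>R s \<in> sector s u b"
  using assms by (auto simp: sector_def sgn_scaleR) (simp add: sgn_div_norm)

lemma nearby_unit_vector:
  fixes s :: "'a::euclidean_space"
  assumes dim: "2 \<le> DIM('a)" and s: "norm s = 1" and u: "0 < u"
  obtains s' where "norm s' = 1" "s' \<noteq> s" "norm (s' - s) < u"
proof -
  obtain y where y: "y \<noteq> 0" "orthogonal s y" using orthogonal_to_vector_exists[OF dim] by blast
  define e where "e = sgn y"
  have e: "norm e = 1" "s \<bullet> e = 0" using y by (auto simp: e_def norm_sgn orthogonal_def sgn_div_norm)
  define z where "z = s + (u / 3) *\<^sub>R e"
  have "z \<bullet> e = u / 3" using e by (simp add: z_def inner_add_left dot_square_norm)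
  then have z0: "z \<noteq> 0" using u by auto
  have zs: "norm (z - s) = u / 3" using e u by (simp add: z_def)
  have "norm (sgn z - z) = \<bar>1 - norm z\<bar>"
  proof -
    have "sgn z - z = (1 - norm z) *\<^sub>R sgn z" using z0 by (simp add: sgn_div_norm algebra_simps)
    then show ?thesis using z0 by (simp add: norm_sgn)
  qed
  also have "\<dots> \<le> u / 3" using norm_triangle_ineq3[of z s] zs s by (simp add: abs_minus_commute)
  finally have "norm (sgn z - s) < u" using norm_triangle_ineq[of "sgn z - z" "z - s"] zs u by simp
  moreover have "sgn z \<bullet> e \<noteq> 0" using \<open>z \<bullet> e = u / 3\<close> u z0 by (simp add: sgn_div_norm)
  then have "sgn z \<noteq> s" using e by auto
  ultimately show ?thesis using that[of "sgn z"] z0 by (simp add: norm_sgn)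
qed

text \<open>A task asks for fingers from the cap of radius \<open>u\<close> about the tip \<open>s\<close> to the part of \<open>C\<close> in the region \<open>R\<close>. The
  region avoids the image of the ball but is reached from the outer side of the cap without leaving \<open>R\<close>.\<close>

definition valid_task :: "('a::euclidean_space \<Rightarrow> 'a) \<Rightarrow> 'a \<Rightarrow> real \<Rightarrow> 'a set \<Rightarrow> bool" where
  "valid_task \<Psi> s u R \<longleftrightarrow> norm s = 1 \<and> 0 < u \<and> u < 1 \<and> open R \<and> connected R \<and> R \<inter> \<Psi> ` cball 0 1 = {} \<and>
     \<Psi> ` sector s u (1 + u) \<subseteq> R"

definition energy :: "('a::euclidean_space \<Rightarrow> 'a) \<Rightarrow> ennreal" where
  "energy \<Psi> = (\<integral>\<^sup>+x. ennreal (dnorm \<Psi> x ^ (DIM('a) - 1)) \<partial>sphere_measure)"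

lemma homeo_pair_open_image:
  assumes "homeo_pair F G" "open A"
  shows "open (F ` A)"
proof -
  have "x \<in> F ` A" if "G x \<in> A" for x
    using that assms(1) unfolding homeo_pair_def by (intro image_eqI[of _ F "G x"]) auto
  then have "F ` A = G -` A" using assms(1) unfolding homeo_pair_def by auto
  then show ?thesis using assms open_vimage unfolding homeo_pair_def by metis
qed

lemma diffeo_support_invariant:
  assumes "diffeo_pair F G" "\<And>x. x \<notin> K \<Longrightarrow> F x = x" "K \<subseteq> A"
  shows "F x \<in> A \<longleftrightarrow> x \<in> A"
proof (cases "x \<in> K")
  case True
  have "F x \<in> K"
  proof (rule ccontr)
    assume "F x \<notin> K"
    then have "F (F x) = F x" by (rule assms(2))
    then show False using assms(1) True \<open>F x \<notin> K\<close> unfolding diffeo_pair_def by metis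
  qed
  then show ?thesis using True assms(3) by auto
next
  case False
  then show ?thesis using assms(2) by simp
qed

text \<open>Off the cap the two maps agree near the sphere. On the cap the chain rule bounds the derivative by a constant
  times \<open>1 + |\<nabla>h|\<close>, and the hypothesis on the spike absorbs the corresponding power of this constant.\<close>

lemma energy_spike_le:
  fixes E \<Psi> :: "'a::euclidean_space \<Rightarrow> 'a" and h :: "'a \<Rightarrow> real"
  defines "\<sigma> \<equiv> \<lambda>x. (1 + h (sgn x)) *\<^sub>R x"
  assumes E: "smooth_on_open E (- {0})" and sm: "smooth_on_open h UNIV" and h: "\<And>x. 0 \<le> h x" "\<And>x. h x \<le> 1"
    and M: "\<And>x. 1 \<le> norm x \<Longrightarrow> norm x \<le> 2 \<Longrightarrow> dnorm E x \<le> M" "0 < M"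
    and \<Psi>: "smooth_on_open \<Psi> (- {0})"
    and agree: "open V" "sphere 0 1 - ball s r \<subseteq> V" "\<And>x. x \<in> V \<Longrightarrow> E (\<sigma> x) = \<Psi> x"
    and spike: "(\<integral>\<^sup>+x. indicator (ball s r) x * ennreal ((1 + dnorm h x) ^ (DIM('a) - 1)) \<partial>sphere_measure)
       \<le> ennreal (\<epsilon> / (2 * M * DIM('a)) ^ (DIM('a) - 1))" and \<epsilon>: "0 < \<epsilon>"
  shows "energy (\<lambda>x. E (\<sigma> x)) \<le> energy \<Psi> + ennreal \<epsilon>"
proof -
  define n where "n = DIM('a) - 1"
  define k where "k = 2 * M * DIM('a)"
  have k: "0 < k" using M by (simp add: k_def)
  have pt: "ennreal (dnorm (\<lambda>x. E (\<sigma> x)) x ^ n)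
     \<le> ennreal (dnorm \<Psi> x ^ n) + ennreal (k ^ n) * (indicator (ball s r) x * ennreal ((1 + dnorm h x) ^ n))"
    if x: "x \<in> sphere 0 1" for x
  proof (cases "x \<in> ball s r")
    case False
    then have xV: "x \<in> V" using agree(2) x by blast
    have "x \<noteq> 0" using x by auto
    then have "dnorm (\<lambda>x. E (\<sigma> x)) x = dnorm \<Psi> x"
      by (intro dnorm_cong_open[OF agree(1) xV] smooth_on_open_differentiable[OF \<Psi>]) (use agree(3) in auto)
    then show ?thesis by simp
  next
    case True
    have x0: "x \<noteq> 0" "sgn x = x" "norm x = 1" using x by (auto simp: sgn_div_norm)
    have hx: "0 \<le> h x" "h x \<le> 1" using h by auto
    have \<sigma>x: "\<sigma> x \<noteq> 0" "1 \<le> norm (\<sigma> x)" "norm (\<sigma> x) \<le> 2" using x0 hx by (auto simp: \<sigma>_def)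
    have "smooth_on_open \<sigma> (- {0})"
      unfolding \<sigma>_def
      by (intro smooth_on_open_scaleR smooth_on_open_add smooth_on_open_const smooth_on_open_compose[OF sm smooth_on_open_sgn]
          smooth_on_open_id) auto
    then have d\<sigma>: "(\<sigma> has_derivative frechet_derivative \<sigma> (at x)) (at x)"
      using smooth_on_open_has_derivative x0 by auto
    have dE: "(E has_derivative frechet_derivative E (at (\<sigma> x))) (at (\<sigma> x))"
      using smooth_on_open_has_derivative[OF E] \<sigma>x by auto
    have "((\<lambda>x. E (\<sigma> x)) has_derivative (\<lambda>v. frechet_derivative E (at (\<sigma> x)) (frechet_derivative \<sigma> (at x) v))) (at x)"
      using diff_chain_at[OF d\<sigma> dE] by (simp add: o_def)
    from frechet_derivative_at[OF this, symmetric]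
    have "dnorm (\<lambda>x. E (\<sigma> x)) x = (\<Sum>b\<in>Basis. norm (frechet_derivative E (at (\<sigma> x)) (frechet_derivative \<sigma> (at x) b)))"
      by (simp add: dnorm_def)
    also have "\<dots> \<le> (\<Sum>b\<in>(Basis :: 'a set). 2 * (1 + dnorm h x) * M)"
    proof (rule sum_mono)
      fix b :: 'a assume b: "b \<in> Basis"
      have "norm (frechet_derivative E (at (\<sigma> x)) (frechet_derivative \<sigma> (at x) b))
          \<le> norm (frechet_derivative \<sigma> (at x) b) * dnorm E (\<sigma> x)"
        by (rule norm_derivative_le_dnorm) (use dE has_derivative_linear in blast)
      also have "\<dots> \<le> 2 * (1 + dnorm h x) * M"
        using derivative_radial_le[OF sm h x0(3), of b] b M(1)[OF \<sigma>x(2,3)] dnorm_nonneg[of E] dnorm_nonneg[of h x]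
        by (intro mult_mono) (auto simp: \<sigma>_def)
      finally show "norm (frechet_derivative E (at (\<sigma> x)) (frechet_derivative \<sigma> (at x) b)) \<le> 2 * (1 + dnorm h x) * M" .
    qed
    also have "\<dots> = k * (1 + dnorm h x)" by (simp add: k_def)
    finally have "dnorm (\<lambda>x. E (\<sigma> x)) x ^ n \<le> (k * (1 + dnorm h x)) ^ n"
      using dnorm_nonneg by (intro power_mono) auto
    then have "ennreal (dnorm (\<lambda>x. E (\<sigma> x)) x ^ n) \<le> ennreal (k ^ n) * ennreal ((1 + dnorm h x) ^ n)"
      using k by (simp add: power_mult_distrib ennreal_leI flip: ennreal_mult')
    then show ?thesis using True by (simp add: add_increasing)
  qed
  have m1: "(\<lambda>x. ennreal (dnorm \<Psi> x ^ n)) \<in> borel_measurable sphere_measure"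
    by (intro measurable_compose[OF _ measurable_ennreal] borel_measurable_power borel_measurable_sphere_continuous
        dnorm_continuous_on[OF \<Psi>]) auto
  have m2: "(\<lambda>x. indicator (ball s r) x * ennreal ((1 + dnorm h x) ^ n)) \<in> borel_measurable sphere_measure"
  proof -
    have "(\<lambda>x. indicator (ball s r) x :: ennreal) \<in> borel_measurable sphere_measure"
    proof -
      have "(indicator (ball s r) :: 'a \<Rightarrow> ennreal) \<in> borel_measurable borel"
        by (rule borel_measurable_indicator) auto
      then have "(indicator (ball s r) :: 'a \<Rightarrow> ennreal) \<in> borel_measurable (restrict_space borel (sphere 0 1))"
        by (rule measurable_restrict_space1)
      then show ?thesis by (simp cong: measurable_cong_sets)
    qed
    moreover have "(\<lambda>x. ennreal ((1 + dnorm h x) ^ n)) \<in> borel_measurable sphere_measure"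
      by (intro measurable_compose[OF _ measurable_ennreal] borel_measurable_power borel_measurable_add borel_measurable_const
          borel_measurable_sphere_continuous dnorm_continuous_on[OF sm]) auto
    ultimately show ?thesis by (rule borel_measurable_times_ennreal)
  qed
  have "energy (\<lambda>x. E (\<sigma> x)) \<le> (\<integral>\<^sup>+x. ennreal (dnorm \<Psi> x ^ n)
      + ennreal (k ^ n) * (indicator (ball s r) x * ennreal ((1 + dnorm h x) ^ n)) \<partial>sphere_measure)"
    unfolding energy_def n_def[symmetric] by (rule nn_integral_mono) (use pt in simp)
  also have "\<dots> = energy \<Psi> + ennreal (k ^ n) * (\<integral>\<^sup>+x. indicator (ball s r) x * ennreal ((1 + dnorm h x) ^ n) \<partial>sphere_measure)"
    unfolding energy_def n_def[symmetric]
    by (subst nn_integral_add[OF m1 borel_measurable_times_ennreal[OF borel_measurable_const m2]])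
       (simp add: nn_integral_cmult[OF m2])
  also have "\<dots> \<le> energy \<Psi> + ennreal (k ^ n) * ennreal (\<epsilon> / k ^ n)"
    using spike unfolding n_def[symmetric] k_def[symmetric] by (intro add_left_mono mult_left_mono) auto
  also have "ennreal (k ^ n) * ennreal (\<epsilon> / k ^ n) = ennreal \<epsilon>"
    using k \<epsilon> by (simp flip: ennreal_mult')
  finally show ?thesis .
qed

text \<open>One finger is grown from the tip \<open>s\<close> of the task with region \<open>R\<close> until it almost touches the continuum \<open>P\<close>. The
  task is thereby split in two: a task with the same tip, now next to \<open>P\<close>, and a small region \<open>R1\<close> around \<open>P\<close>; and a
  task with a new tip \<open>s2\<close> nearby, whose region \<open>R2\<close> contains the remaining continua \<open>Z\<close>. The order of the choices
  is essential. First the end of the segment \<open>[s, t]\<close> is dragged into \<open>P\<close> inside \<open>R - Z\<close>, which fixes the core of the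
  finger; the core is cut where it first meets \<open>P\<close>. Then \<open>R2\<close> is chosen off the core and off \<open>P\<close>, and only then the
  spike, thin enough to stay off \<open>P\<close> and \<open>R2\<close>. The region \<open>R1\<close> comes last and may be as thin as necessary.\<close>

lemma finger_move:
  fixes \<Psi> \<Psi>i :: "'a::euclidean_space \<Rightarrow> 'a"
  assumes dim: "3 \<le> DIM('a)" and H: "homeo_pair \<Psi> \<Psi>i" and task: "valid_task \<Psi> s u R"
    and P: "compact P" "connected P" "P \<noteq> {}" "connected (- P)" "P \<subseteq> R"
    and Z: "compact Z" "connected (- Z)" "Z \<subseteq> R" "P \<inter> Z = {}"
    and Q: "open Q" "P \<subseteq> Q" and \<epsilon>: "0 < \<epsilon>"
  obtains \<Psi>' \<Psi>i' u1 R1 s2 u2 R2 V where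
    "homeo_pair \<Psi>' \<Psi>i'" "valid_task \<Psi>' s u1 R1" "valid_task \<Psi>' s2 u2 R2"
    "P \<subseteq> R1" "R1 \<subseteq> R \<inter> Q" "Z \<subseteq> R2" "R2 \<subseteq> R" "R1 \<inter> R2 = {}"
    "cball s u1 \<subseteq> cball s u" "cball s2 u2 \<subseteq> cball s u" "cball s u1 \<inter> cball s2 u2 = {}"
    "open V" "sphere 0 1 - cball s u \<subseteq> V" "\<And>x. x \<in> V \<Longrightarrow> \<Psi>' x = \<Psi> x"
    "\<And>x. u \<le> norm (sgn x - s) \<Longrightarrow> \<Psi> x \<notin> R \<Longrightarrow> \<Psi>' x = \<Psi> x"
    "\<Psi>' ` cball 0 1 \<subseteq> \<Psi> ` cball 0 1 \<union> R"
    "\<And>x. x \<in> sphere 0 1 \<Longrightarrow> \<Psi>' x = \<Psi> x \<or> \<Psi>' x \<in> R"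
    "energy \<Psi>' \<le> energy \<Psi> + ennreal \<epsilon>"
proof -
  have s: "norm s = 1" "sgn s = s" "s \<noteq> 0" and u: "0 < u" "u < 1" and R: "open R" "connected R"
    and R\<Psi>: "R \<inter> \<Psi> ` cball 0 1 = {}" and \<Psi>R: "\<Psi> ` sector s u (1 + u) \<subseteq> R"
    using task by (auto simp: valid_task_def sgn_div_norm)
  have H': "\<And>x. \<Psi>i (\<Psi> x) = x" "\<And>x. \<Psi> (\<Psi>i x) = x" "continuous_on UNIV \<Psi>" "continuous_on UNIV \<Psi>i"
    "smooth_on_open \<Psi> (- {0})" using H by (auto simp: homeo_pair_def)
  have \<Psi>ball: "\<Psi> x \<notin> R" if "norm x \<le> 1" for x
  proof -
    have "\<Psi> x \<in> \<Psi> ` cball 0 1" using that by simp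
    then show ?thesis using R\<Psi> by blast
  qed
  have \<Psi>s: "\<Psi> s \<notin> R" using \<Psi>ball s by simp
  \<comment> \<open>A short initial segment \<open>[s, t]\<close>, whose image stays off \<open>P\<close> and \<open>Z\<close>.\<close>
  have "open (\<Psi> -` (- (P \<union> Z)))"
    using P(1) Z(1) H'(3) by (intro open_vimage open_Compl closed_Un compact_imp_closed)
  moreover have "s \<in> \<Psi> -` (- (P \<union> Z))" using \<Psi>s P(5) Z(3) by blast
  ultimately obtain d0 where d0: "d0 > 0" "ball s d0 \<subseteq> \<Psi> -` (- (P \<union> Z))"
    using openE by metis
  define \<delta> where "\<delta> = min d0 u / 2"
  have \<delta>: "0 < \<delta>" "\<delta> < d0" "\<delta> < u" using d0 u by (auto simp: \<delta>_def)
  have dist_ray: "dist s (r *\<^sub>R s) = \<bar>r - 1\<bar>" for r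
  proof -
    have "s - r *\<^sub>R s = (1 - r) *\<^sub>R s" by (simp add: algebra_simps)
    then show ?thesis using s by (simp add: dist_norm abs_minus_commute)
  qed
  have ray_off: "\<Psi> (r *\<^sub>R s) \<notin> P \<union> Z" if "1 \<le> r" "r \<le> 1 + \<delta>" for r
  proof -
    have "r *\<^sub>R s \<in> ball s d0" using that \<delta> by (simp add: dist_ray)
    then show ?thesis using d0(2) by blast
  qed
  have ray_R: "\<Psi> (r *\<^sub>R s) \<in> R" if "1 < r" "r \<le> 1 + \<delta>" for r
    using \<Psi>R scaleR_in_sector[OF s(1) that(1), of "1 + u" u] that \<delta> u by (auto simp: image_subset_iff)
  \<comment> \<open>Drag the end of the segment into \<open>P\<close>, inside \<open>R - Z\<close>.\<close>
  have RZ: "open (R - Z)" "connected (R - Z)"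
    using connected_diff_nonseparating[OF R Z(1,3,2)] R(1) compact_imp_closed[OF Z(1)] by auto
  obtain p where p: "p \<in> P" using P(3) by blast
  have tR: "\<Psi> ((1 + \<delta>) *\<^sub>R s) \<in> R - Z" using ray_R[of "1 + \<delta>"] ray_off[of "1 + \<delta>"] \<delta> by auto
  have pR: "p \<in> R - Z" using p P(5) Z(4) by blast
  have dim2: "2 \<le> DIM('a)" using dim by simp
  obtain \<Phi> \<Phi>i K where \<Phi>: "diffeo_pair \<Phi> \<Phi>i" "compact K" "K \<subseteq> R - Z" "\<And>x. x \<notin> K \<Longrightarrow> \<Phi> x = x"
      "\<Phi> (\<Psi> ((1 + \<delta>) *\<^sub>R s)) = p"
    by (rule diffeo_moving_point[OF dim2 RZ tR pR]) (rule that)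
  define E where "E x = \<Phi> (\<Psi> x)" for x
  define Ei where "Ei x = \<Psi>i (\<Phi>i x)" for x
  have E_R: "E x \<in> R \<longleftrightarrow> \<Psi> x \<in> R" for x
    unfolding E_def using diffeo_support_invariant[OF \<Phi>(1,4), where A = R and x = "\<Psi> x"] \<Phi>(3) by blast
  have E_RZ: "E x \<in> R - Z \<longleftrightarrow> \<Psi> x \<in> R - Z" for x
    unfolding E_def using diffeo_support_invariant[OF \<Phi>(1,4), where A = "R - Z" and x = "\<Psi> x"] \<Phi>(3) by blast
  have E_eq: "E x = \<Psi> x" if "\<Psi> x \<notin> R" for x
    unfolding E_def using \<Phi>(3,4) that by blast
  have E0: "E 0 = \<Psi> 0" using E_eq \<Psi>ball[of 0] by simp
  have EH: "homeo_pair E Ei"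
    unfolding E_def[abs_def] Ei_def[abs_def] using homeo_pair_diffeo_compose[OF H \<Phi>(1)] E0 by (simp add: E_def)
  have EE: "\<And>x. Ei (E x) = x" "\<And>x. E (Ei x) = x" "continuous_on UNIV E" "continuous_on UNIV Ei"
    "smooth_on_open E (- {0})" using EH by (auto simp: homeo_pair_def)
  have E_inj: "E x = E y \<longleftrightarrow> x = y" for x y using EE(1) by metis
  have "inj E" by (simp add: inj_on_def E_inj)
  have Eopen: "open (E -` A)" if "open A" for A using open_vimage[OF that EE(3)] .
  have Eimg: "E ` (E -` A) = A" for A
    using EE(2) by (auto intro: image_eqI[of _ E "Ei _"])
  have E_Z: "E (r *\<^sub>R s) \<notin> Z" if "1 \<le> r" "r \<le> 1 + \<delta>" for r
  proof (cases "r = 1")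
    case True
    then show ?thesis using E_eq[OF \<Psi>s] \<Psi>s Z(3) by auto
  next
    case False
    then show ?thesis using E_RZ[of "r *\<^sub>R s"] ray_R[of r] ray_off[of r] that by auto
  qed
  \<comment> \<open>The finger's core is cut at the first parameter \<open>r1\<close> at which it meets \<open>P\<close>.\<close>
  have cray: "continuous_on A (\<lambda>r. E (r *\<^sub>R s))" for A
    by (rule continuous_on_compose2[OF EE(3)]) (auto intro!: continuous_intros)
  obtain r1 where r1: "1 < r1" "r1 \<le> 1 + \<delta>" "E (r1 *\<^sub>R s) \<in> P"
    and r1_first: "\<And>r. 1 \<le> r \<Longrightarrow> r < r1 \<Longrightarrow> E (r *\<^sub>R s) \<notin> P"
  proof -
    let ?S = "{1..1 + \<delta>} \<inter> (\<lambda>r. E (r *\<^sub>R s)) -` P"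
    have "compact ?S"
    proof -
      have "closed ?S"
        by (rule continuous_closed_preimage[OF cray]) (use P(1) compact_imp_closed in auto)
      then show ?thesis by (metis bounded_Int bounded_closed_interval compact_eq_bounded_closed)
    qed
    moreover have "1 + \<delta> \<in> ?S" using \<delta> \<Phi>(5) p by (simp add: E_def)
    ultimately obtain r where r: "r \<in> ?S" "\<forall>t\<in>?S. r \<le> t" using compact_attains_inf[of ?S] by blast
    have "E (1 *\<^sub>R s) \<notin> P" using E_eq[OF \<Psi>s] \<Psi>s P(5) by auto
    then have "1 < r" using r(1) by (cases "r = 1") auto
    moreover have "E (t *\<^sub>R s) \<notin> P" if "1 \<le> t" "t < r" for t
      using r that by force
    ultimately show ?thesis using that[of r] r(1) by auto
  qed
  have r1_2: "r1 \<le> 2" using r1 \<delta> u by linarith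
  define seg where "seg = (\<lambda>r. r *\<^sub>R s) ` {1..r1}"
  have seg: "compact seg" unfolding seg_def by (intro compact_continuous_image continuous_intros) auto
  define Y where "Y = P \<union> E ` seg"
  have Y: "compact Y" unfolding Y_def
    using P(1) seg by (intro compact_Un compact_continuous_image continuous_on_subset[OF EE(3)]) auto
  \<comment> \<open>Removing the finger's core and \<open>P\<close> leaves \<open>R\<close> connected: in the coordinates of \<open>E\<close> the core is straight.\<close>
  have RY: "open (R - Y)" "connected (R - Y)"
  proof -
    show "open (R - Y)" using R(1) Y compact_imp_closed by blast
    have "connected (R - P)" by (rule connected_diff_nonseparating[OF R P(1,5,4)])
    then have "connected (Ei ` (R - P))"
      by (intro connected_continuous_image continuous_on_subset[OF EE(4)]) auto
    moreover have "Ei ` (R - P) = E -` (R - P)" using EE(1,2) by (auto intro: image_eqI[of _ Ei "E _"])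
    ultimately have c: "connected (E -` (R - P))" by simp
    have o: "open (E -` (R - P))" using R(1) P(1) compact_imp_closed by (intro Eopen) blast
    have "connected (E -` (R - P) - seg)"
      by (rule connected_open_diff_line[OF o c dim, of _ s]) (auto simp: seg_def)
    then have "connected (E ` (E -` (R - P) - seg))"
      by (intro connected_continuous_image continuous_on_subset[OF EE(3)]) auto
    moreover have "E ` (E -` (R - P) - seg) = R - Y"
    proof -
      have "E ` (E -` (R - P) - seg) = (R - P) - E ` seg"
        by (simp only: image_set_diff[OF \<open>inj E\<close>] Eimg)
      then show ?thesis by (auto simp: Y_def)
    qed
    ultimately show "connected (R - Y)" by simp
  qed
  have ZY: "Z \<inter> Y = {}" using Z(4) E_Z r1 unfolding Y_def seg_def by fastforce
  \<comment> \<open>A second base point for the later fingers towards \<open>Z\<close>, and their region \<open>R2\<close>.\<close>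
  obtain s2 where s2: "norm s2 = 1" "s2 \<noteq> s" "norm (s2 - s) < u"
    using nearby_unit_vector[OF dim2 s(1) u(1)] by auto
  have s2s: "sgn s2 = s2" "0 < norm (s2 - s)" using s2 by (auto simp: sgn_div_norm)
  define \<Omega> where "\<Omega> = E -` (- P) \<inter> - seg"
  have "open \<Omega>" unfolding \<Omega>_def
    using P(1) seg compact_imp_closed by (intro open_Int Eopen open_Compl) auto
  moreover have "s2 \<in> \<Omega>"
  proof -
    have "\<Psi> s2 \<notin> R" using \<Psi>ball s2 by simp
    then have "E s2 \<notin> P" using E_eq P(5) by auto
    moreover have "s2 \<notin> seg"
    proof
      assume "s2 \<in> seg"
      then obtain r where "1 \<le> r" "s2 = r *\<^sub>R s" by (auto simp: seg_def)
      then show False using s2 s by (cases "r = 1") auto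
    qed
    ultimately show ?thesis by (simp add: \<Omega>_def)
  qed
  ultimately obtain d2 where d2: "0 < d2" "ball s2 d2 \<subseteq> \<Omega>" using openE by blast
  define u2 where "u2 = Min {d2 / 4, (u - norm (s2 - s)) / 2, norm (s2 - s) / 4, u / 2}"
  have u2: "0 < u2" "u2 \<le> d2 / 4" "u2 \<le> (u - norm (s2 - s)) / 2" "u2 \<le> norm (s2 - s) / 4" "u2 \<le> u / 2"
  proof -
    show "0 < u2" using d2 s2 s2s u by (simp add: u2_def)
  qed (auto simp only: u2_def intro!: Min_le)
  have sec2_ball: "sector s2 u2 (1 + u2) \<subseteq> cball s2 (2 * u2)"
    using sector_norm_diff by (fastforce simp: dist_norm norm_minus_commute less_imp_le)
  have sec2_sec: "sector s2 u2 (1 + u2) \<subseteq> sector s u (1 + u)"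
  proof
    fix x assume "x \<in> sector s2 u2 (1 + u2)"
    then show "x \<in> sector s u (1 + u)"
      using norm_triangle_ineq[of "sgn x - s2" "s2 - s"] u2 u by (auto simp: sector_def)
  qed
  define B2 where "B2 = E ` cball s2 (2 * u2)"
  have B2: "compact B2" "B2 \<inter> Y = {}"
  proof -
    show "compact B2" unfolding B2_def
      by (intro compact_continuous_image continuous_on_subset[OF EE(3)]) auto
    have "cball s2 (2 * u2) \<subseteq> \<Omega>" using d2 u2 by (auto simp: subset_iff)
    then show "B2 \<inter> Y = {}" unfolding B2_def Y_def \<Omega>_def using E_inj by auto
  qed
  have sec2_RY: "E ` sector s2 u2 (1 + u2) \<subseteq> R - Y"
  proof -
    have "E x \<in> R" if "x \<in> sector s2 u2 (1 + u2)" for x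
      using that sec2_sec \<Psi>R E_R by blast
    moreover have "E ` sector s2 u2 (1 + u2) \<subseteq> B2" unfolding B2_def using sec2_ball by blast
    ultimately show ?thesis using B2(2) by blast
  qed
  define z0 where "z0 = (1 + u2 / 2) *\<^sub>R s2"
  have z0: "z0 \<in> sector s2 u2 (1 + u2)"
    unfolding z0_def using u2 by (intro scaleR_in_sector s2) auto
  have "compact (insert (E z0) Z)" "insert (E z0) Z \<subseteq> R - Y"
    using Z(1,3) ZY z0 sec2_RY by auto
  then obtain V2 where V2: "open V2" "connected V2" "insert (E z0) Z \<subseteq> V2" "compact (closure V2)" "closure V2 \<subseteq> R - Y"
    using compact_in_connected_open[OF RY] by metis
  define R2 where "R2 = V2 \<union> E ` sector s2 u2 (1 + u2)"
  define F2 where "F2 = closure V2 \<union> B2"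
  have F2: "closed F2" "F2 \<inter> Y = {}" "R2 \<subseteq> F2"
  proof -
    show "closed F2" unfolding F2_def using B2(1) compact_imp_closed by auto
    show "F2 \<inter> Y = {}" unfolding F2_def using V2(5) B2(2) by blast
    show "R2 \<subseteq> F2" unfolding F2_def R2_def B2_def using closure_subset[of V2] sec2_ball by blast
  qed
  have R2: "open R2" "connected R2" "R2 \<subseteq> R - Y" "Z \<subseteq> R2"
  proof -
    show "open R2" unfolding R2_def using V2(1) homeo_pair_open_image[OF EH open_sector] by blast
    have "connected (E ` sector s2 u2 (1 + u2))"
      by (intro connected_continuous_image connected_sector continuous_on_subset[OF EE(3)]) (use s2 u2 u in auto)
    then show "connected R2" unfolding R2_def using V2(2,3) z0 by (intro connected_Un) auto
    show "R2 \<subseteq> R - Y" unfolding R2_def using V2(5) closure_subset[of V2] sec2_RY by blast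
    show "Z \<subseteq> R2" unfolding R2_def using V2(3) by blast
  qed
  \<comment> \<open>The spike ends at \<open>r0 < r1\<close>, so close to \<open>r1\<close> that the rest of the core lies near \<open>P\<close> and off \<open>R2\<close>.\<close>
  have "open (E -` (R \<inter> Q \<inter> - F2))" using R(1) Q(1) F2(1) by (intro Eopen open_Int open_Compl) auto
  moreover have "r1 *\<^sub>R s \<in> E -` (R \<inter> Q \<inter> - F2)"
    using r1(3) P(5) Q(2) F2(2) by (auto simp: Y_def)
  ultimately obtain \<mu> where \<mu>: "0 < \<mu>" "ball (r1 *\<^sub>R s) \<mu> \<subseteq> E -` (R \<inter> Q \<inter> - F2)" using openE by blast
  define r0 where "r0 = max ((1 + r1) / 2) (r1 - \<mu> / 4)"
  have r0: "1 < r0" "r0 < r1" "r1 - r0 \<le> \<mu> / 4" 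
  proof -
    have ge: "r1 - \<mu> / 4 \<le> r0" "(1 + r1) / 2 \<le> r0" by (simp_all add: r0_def)
    show "1 < r0" using ge(2) r1(1) by argo
    show "r1 - r0 \<le> \<mu> / 4" using ge(1) by argo
    show "r0 < r1" using r1(1) \<mu>(1) by (simp add: r0_def)
  qed
  define seg0 where "seg0 = (\<lambda>r. r *\<^sub>R s) ` {1..r0}"
  have seg0: "compact seg0" "seg0 \<subseteq> seg"
    unfolding seg0_def seg_def using r0 by (auto intro!: compact_continuous_image continuous_intros)
  have "E ` (cball 0 1 \<union> seg0) \<inter> P = {}"
  proof -
    have "E x \<notin> P" if "norm x \<le> 1" for x using E_eq[OF \<Psi>ball[OF that]] \<Psi>ball[OF that] P(5) by auto
    moreover have "E x \<notin> P" if "x \<in> seg0" for x using that r1_first r0 by (auto simp: seg0_def)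
    ultimately show ?thesis by auto
  qed
  then have "cball 0 1 \<union> seg0 \<subseteq> E -` (- P)" by blast
  then obtain \<mu>1 where \<mu>1: "0 < \<mu>1" "(\<Union>x\<in>cball 0 1 \<union> seg0. ball x \<mu>1) \<subseteq> E -` (- P)"
    using compact_subset_open_imp_ball_epsilon_subset[of "cball 0 1 \<union> seg0" "E -` (- P)"] seg0 P(1)
      Eopen compact_imp_closed by (metis compact_Un compact_cball open_Compl)
  have "seg0 \<subseteq> E -` (- F2)" using seg0(2) F2(2) by (auto simp: Y_def)
  then obtain \<mu>2 where \<mu>2: "0 < \<mu>2" "(\<Union>x\<in>seg0. ball x \<mu>2) \<subseteq> E -` (- F2)"
    using compact_subset_open_imp_ball_epsilon_subset[OF seg0(1), of "E -` (- F2)"] F2(1) Eopen by (metis open_Compl)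
  obtain M where M: "0 < M" "\<And>x. 1 \<le> norm x \<Longrightarrow> norm x \<le> 2 \<Longrightarrow> dnorm E x \<le> M"
  proof -
    have "compact (cball (0::'a) 2 - ball 0 1)" by (rule compact_diff) auto
    then have "compact (dnorm E ` (cball 0 2 - ball 0 1))"
      by (intro compact_continuous_image dnorm_continuous_on[OF EE(5)]) auto
    then obtain M where M: "\<And>x. x \<in> cball 0 2 - ball 0 1 \<Longrightarrow> norm (dnorm E x) \<le> M"
      using compact_imp_bounded bounded_iff by (metis (mono_tags, lifting) image_eqI)
    have "dnorm E x \<le> max M 1" if "1 \<le> norm x" "norm x \<le> 2" for x
      using M[of x] that by (auto simp: le_max_iff_disj)
    then show ?thesis using that[of "max M 1"] by auto
  qed
  define W where "W = Min {\<mu>1 / 2, \<mu>2 / 2, u / 4, norm (s2 - s) / 4, \<delta> / 4}"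
  have W: "0 < W" "W \<le> \<mu>1 / 2" "W \<le> \<mu>2 / 2" "W \<le> u / 4" "W \<le> norm (s2 - s) / 4"
  proof -
    show "0 < W" using \<mu>1 \<mu>2 u s2s \<delta> by (simp add: W_def)
  qed (auto simp only: W_def intro!: Min_le)
  have \<epsilon>': "0 < \<epsilon> / (2 * M * DIM('a)) ^ (DIM('a) - 1)" using \<epsilon> M by simp
  have r00: "0 < r0 - 1" using r0 by simp
  obtain h w v where h: "smooth_on_open h UNIV" "0 < v" "0 < w" "w \<le> W" "\<And>x. 0 \<le> h x" "\<And>x. h x \<le> r0 - 1"
    "\<And>x. dist s x < v \<Longrightarrow> h x = r0 - 1" "\<And>x. w \<le> dist s x \<Longrightarrow> h x = 0"
    "(\<integral>\<^sup>+x. indicator (ball s (2 * w)) x * ennreal ((1 + dnorm h x) ^ (DIM('a) - 1)) \<partial>sphere_measure)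
       \<le> ennreal (\<epsilon> / (2 * M * DIM('a)) ^ (DIM('a) - 1))"
    by (rule low_energy_spike[OF dim s(1) W(1) r00 \<epsilon>']) (rule that)
  have h1: "h x \<le> 1" for x using h(6)[of x] r0 r1_2 by linarith
  define \<sigma> where "\<sigma> x = (1 + h (sgn x)) *\<^sub>R x" for x
  define \<Psi>' where "\<Psi>' x = E (\<sigma> x)" for x
  define \<Psi>i' where "\<Psi>i' x = inverse (1 + h (sgn (Ei x))) *\<^sub>R Ei x" for x
  have \<sigma>H: "homeo_pair \<sigma> (\<lambda>x. inverse (1 + h (sgn x)) *\<^sub>R x)"
    unfolding \<sigma>_def[abs_def] by (rule homeo_pair_radial[OF h(1,5) h1])
  have \<Psi>'H: "homeo_pair \<Psi>' \<Psi>i'"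
    unfolding \<Psi>'_def[abs_def] \<Psi>i'_def[abs_def] using homeo_pair_compose[OF EH \<sigma>H] by (simp add: \<sigma>_def)
  have \<Psi>'_inj: "\<Psi>' x = \<Psi>' y \<longleftrightarrow> x = y" for x y using \<Psi>'H unfolding homeo_pair_def by metis
  have \<sigma>_id: "\<sigma> x = x" if "w \<le> norm (sgn x - s)" for x
    using h(8)[of "sgn x"] that by (simp add: \<sigma>_def dist_norm norm_minus_commute)
  \<comment> \<open>Where the sphere moves at all, its image under \<open>\<sigma>\<close> lies in a thin sector along \<open>seg0\<close>.\<close>
  have spike: "(\<sigma> x \<in> cball 0 1) \<or> (\<sigma> x \<in> sector s u (1 + u) \<and> norm (sgn x - s) < w \<and> (\<exists>y\<in>seg0. dist y (\<sigma> x) < 2 * W))"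
    if x: "norm x \<le> 1" for x
  proof (cases "norm (\<sigma> x) \<le> 1")
    case False
    then have n\<sigma>: "1 < norm (\<sigma> x)" by simp
    then have x0: "x \<noteq> 0" by (auto simp: \<sigma>_def)
    have near: "norm (sgn x - s) < w" using \<sigma>_id[of x] x n\<sigma> by (cases "w \<le> norm (sgn x - s)") auto
    have "1 + h (sgn x) > 0" using h(5)[of "sgn x"] by linarith
    then have sgn\<sigma>: "sgn (\<sigma> x) = sgn x" by (simp add: \<sigma>_def sgn_scaleR)
    have "norm (\<sigma> x) = (1 + h (sgn x)) * norm x" using h(5)[of "sgn x"] by (simp add: \<sigma>_def)
    also have "\<dots> \<le> r0 * 1" using x h(5,6)[of "sgn x"] by (intro mult_mono) auto
    finally have nr0: "norm (\<sigma> x) \<le> r0" by simp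
    have r0u: "r0 < 1 + u" using r0 r1 \<delta> by linarith
    have "\<sigma> x \<in> sector s u (1 + u)"
      using n\<sigma> nr0 r0u near sgn\<sigma> h(4) W u by (simp add: sector_def)
    moreover have "norm (\<sigma> x) *\<^sub>R s \<in> seg0" using n\<sigma> nr0 by (auto simp: seg0_def)
    moreover have "dist (norm (\<sigma> x) *\<^sub>R s) (\<sigma> x) < 2 * W"
    proof -
      have "\<sigma> x \<noteq> 0" using n\<sigma> by auto
      then have "norm (\<sigma> x) *\<^sub>R sgn (\<sigma> x) = \<sigma> x" by (simp add: sgn_div_norm)
      then have "\<sigma> x = norm (\<sigma> x) *\<^sub>R sgn x" by (simp only: sgn\<sigma>)
      then have "dist (norm (\<sigma> x) *\<^sub>R s) (\<sigma> x) = norm (norm (\<sigma> x) *\<^sub>R (s - sgn x))"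
        unfolding dist_norm by (metis scaleR_diff_right)
      also have "\<dots> = norm (\<sigma> x) * norm (sgn x - s)" by (simp add: norm_minus_commute)
      also have "\<dots> < 2 * W" using nr0 r0 r1_2 near h(4) n\<sigma> by (intro mult_le_less_imp_less) auto
      finally show ?thesis .
    qed
    ultimately show ?thesis using near by blast
  qed simp
  have \<Psi>'P: "\<Psi>' x \<notin> P" if "norm x \<le> 1" for x
  proof -
    have "\<sigma> x \<in> (\<Union>y\<in>cball 0 1 \<union> seg0. ball y \<mu>1)"
      using spike[OF that] W(2) \<mu>1(1) by fastforce
    then show ?thesis using \<mu>1(2) unfolding \<Psi>'_def by blast
  qed
  have \<Psi>'R2: "\<Psi>' x \<notin> R2" if "norm x \<le> 1" for x
    using spike[OF that]
  proof
    assume "\<sigma> x \<in> cball 0 1"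
    then have "\<Psi>' x \<notin> R" unfolding \<Psi>'_def using E_R \<Psi>ball by simp
    then show ?thesis using R2(3) by blast
  next
    assume *: "\<sigma> x \<in> sector s u (1 + u) \<and> norm (sgn x - s) < w \<and> (\<exists>y\<in>seg0. dist y (\<sigma> x) < 2 * W)"
    then obtain y where "y \<in> seg0" "dist y (\<sigma> x) < 2 * W" by blast
    then have "\<sigma> x \<in> (\<Union>y\<in>seg0. ball y \<mu>2)" using W(3) by (intro UN_I[of y]) auto
    then have "\<Psi>' x \<notin> F2" using \<mu>2(2) unfolding \<Psi>'_def by blast
    then show ?thesis using F2(3) by blast
  qed
  \<comment> \<open>The region \<open>R1\<close>: a thin neighbourhood of \<open>P\<close> together with a sector from the finger's tip to \<open>P\<close>.\<close>
  define b where "b = (r1 + \<mu> / 4) / r0"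
  have b: "1 < b" "r0 * b = r1 + \<mu> / 4" "r1 / r0 < b"
    using r0 r1 \<mu> by (auto simp: b_def field_simps)
  define u1 where "u1 = Min {v, \<mu> / (4 * (2 + \<mu>)), b - 1, norm (s2 - s) / 4, u / 2}"
  have u1: "0 < u1" "u1 \<le> v" "u1 \<le> \<mu> / (4 * (2 + \<mu>))" "u1 \<le> b - 1" "u1 \<le> norm (s2 - s) / 4" "u1 \<le> u / 2"
  proof -
    show "0 < u1" using h(2) \<mu> b s2s u by (simp add: u1_def)
  qed (auto simp only: u1_def intro!: Min_le)
  have tip: "\<Psi>' x \<in> R \<inter> Q \<inter> - F2" if x: "x \<in> sector s u1 b" for x
  proof -
    have nx: "1 < norm x" "norm x < b" "norm (sgn x - s) < u1" using x by (auto simp: sector_def)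
    then have "h (sgn x) = r0 - 1" using u1 by (intro h(7)) (simp add: dist_norm norm_minus_commute)
    then have \<sigma>x: "\<sigma> x = r0 *\<^sub>R x" by (simp add: \<sigma>_def)
    define c where "c = r0 * norm x"
    have c: "r0 < c" "c < r1 + \<mu> / 4" using nx r0 b(2) by (auto simp: c_def) (metis mult_strict_left_mono zero_less_one less_trans)
    have "x \<noteq> 0" using nx by auto
    then have "\<sigma> x = c *\<^sub>R sgn x" by (simp add: \<sigma>x c_def sgn_div_norm)
    then have "\<sigma> x - r1 *\<^sub>R s = c *\<^sub>R (sgn x - s) + (c - r1) *\<^sub>R s" by (simp add: algebra_simps)
    then have "norm (\<sigma> x - r1 *\<^sub>R s) \<le> \<bar>c\<bar> * norm (sgn x - s) + \<bar>c - r1\<bar>"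
      using norm_triangle_ineq[of "c *\<^sub>R (sgn x - s)" "(c - r1) *\<^sub>R s"] s by simp
    also have "\<bar>c\<bar> * norm (sgn x - s) \<le> (2 + \<mu>) * (\<mu> / (4 * (2 + \<mu>)))"
      using c r0 r1_2 nx u1 \<mu> by (intro mult_mono) auto
    also have "\<dots> = \<mu> / 4" using \<mu>(1) by (simp add: divide_simps)
    also have "\<bar>c - r1\<bar> \<le> \<mu> / 4" using c r0 by linarith
    finally have "\<sigma> x \<in> ball (r1 *\<^sub>R s) \<mu>" using \<mu> by (simp add: dist_norm norm_minus_commute)
    then show ?thesis using \<mu>(2) unfolding \<Psi>'_def by blast
  qed
  have "closed (\<Psi>' ` cball 0 1)"
    using \<Psi>'H unfolding homeo_pair_def
    by (intro compact_imp_closed compact_continuous_image) (auto intro: continuous_on_subset)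
  moreover have "P \<subseteq> R \<inter> Q \<inter> - F2 \<inter> - \<Psi>' ` cball 0 1"
    using P(5) Q(2) F2(2) \<Psi>'P by (auto simp: Y_def)
  ultimately obtain \<rho> where \<rho>: "0 < \<rho>" "(\<Union>x\<in>P. ball x \<rho>) \<subseteq> R \<inter> Q \<inter> - F2 \<inter> - \<Psi>' ` cball 0 1"
    using compact_subset_open_imp_ball_epsilon_subset[OF P(1), of "R \<inter> Q \<inter> - F2 \<inter> - \<Psi>' ` cball 0 1"] R(1) Q(1) F2(1)
    by (metis open_Compl open_Int)
  define R1 where "R1 = (\<Union>x\<in>P. ball x \<rho>) \<union> \<Psi>' ` sector s u1 b"
  have R1: "open R1" "connected R1" "P \<subseteq> R1" "R1 \<subseteq> R \<inter> Q \<inter> - F2" "R1 \<inter> \<Psi>' ` cball 0 1 = {}"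
  proof -
    show "open R1" unfolding R1_def using homeo_pair_open_image[OF \<Psi>'H open_sector] by blast
    have "(r1 / r0) *\<^sub>R s \<in> sector s u1 b"
      using r0 r1 b u1 by (intro scaleR_in_sector s) auto
    moreover have "\<Psi>' ((r1 / r0) *\<^sub>R s) = E (r1 *\<^sub>R s)"
      using h(7)[of s] h(2) r0 r1 s by (simp add: \<Psi>'_def \<sigma>_def sgn_scaleR)
    ultimately have common: "E (r1 *\<^sub>R s) \<in> (\<Union>x\<in>P. ball x \<rho>) \<inter> \<Psi>' ` sector s u1 b"
      using r1(3) \<rho>(1) by (metis IntI UN_I centre_in_ball image_eqI)
    have "connected (\<Psi>' ` sector s u1 b)"
      using \<Psi>'H u1 u s(1) unfolding homeo_pair_def
      by (intro connected_continuous_image connected_sector) (auto intro: continuous_on_subset)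
    then show "connected R1"
      unfolding R1_def by (intro connected_Un connected_thickening[OF P(2)]) (use common in blast)+
    show "P \<subseteq> R1" unfolding R1_def using \<rho>(1) by force
    show "R1 \<subseteq> R \<inter> Q \<inter> - F2" unfolding R1_def using \<rho>(2) tip by blast
    have "\<Psi>' ` sector s u1 b \<inter> \<Psi>' ` cball 0 1 = {}"
      using sector_disjoint_cball[of s u1 b] \<Psi>'_inj by (auto simp: disjoint_iff)
    then show "R1 \<inter> \<Psi>' ` cball 0 1 = {}" unfolding R1_def using \<rho>(2) by blast
  qed
  define V where "V = {x \<in> - {0}. w < norm (sgn x - s)} \<inter> \<Psi> -` (- K)"
  have V: "open V" "\<And>x. x \<in> V \<Longrightarrow> \<Psi>' x = \<Psi> x" "sphere 0 1 - ball s (2 * w) \<subseteq> V"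
  proof -
    have "continuous_on (- {0}) (\<lambda>x::'a. norm (sgn x - s))"
      by (intro continuous_intros continuous_on_sgn) auto
    then have "open ((- {0}) \<inter> (\<lambda>x::'a. norm (sgn x - s)) -` {w<..})"
      by (intro continuous_open_preimage) auto
    moreover have "(- {0}) \<inter> (\<lambda>x::'a. norm (sgn x - s)) -` {w<..} = {x \<in> - {0}. w < norm (sgn x - s)}"
      using h(3) by auto
    ultimately show "open V"
      unfolding V_def using open_vimage[OF _ H'(3), of "- K"] \<Phi>(2) compact_imp_closed by (metis open_Compl open_Int)
    show "\<Psi>' x = \<Psi> x" if "x \<in> V" for x
      using that \<sigma>_id[of x] \<Phi>(4) by (simp add: V_def \<Psi>'_def E_def)
    show "sphere 0 1 - ball s (2 * w) \<subseteq> V"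
    proof
      fix x assume x: "x \<in> sphere 0 1 - ball s (2 * w)"
      then have nx: "norm x = 1" "sgn x = x" by (auto simp: sgn_div_norm)
      then have "\<Psi> x \<notin> K" using \<Psi>ball[of x] \<Phi>(3) by auto
      moreover have "w < norm (sgn x - s)" using x nx h(3) by (auto simp: dist_norm norm_minus_commute)
      ultimately show "x \<in> V" using nx h(3) by (auto simp: V_def)
    qed
  qed
  have V2: "E ((1 + h (sgn x)) *\<^sub>R x) = \<Psi> x" if "x \<in> V" for x
    using V(2)[OF that] by (simp only: \<Psi>'_def \<sigma>_def)
  show ?thesis
  proof (rule that[of \<Psi>' \<Psi>i' u1 R1 s2 u2 R2 V])
    show "homeo_pair \<Psi>' \<Psi>i'" by fact
    have "\<Psi>' ` sector s u1 (1 + u1) \<subseteq> R1"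
      unfolding R1_def using sector_mono[of u1 u1 "1 + u1" b s] u1 by auto
    then show "valid_task \<Psi>' s u1 R1"
      unfolding valid_task_def using R1 u1 u s by auto
    have "\<Psi>' x = E x" if "x \<in> sector s2 u2 (1 + u2)" for x
    proof -
      have "norm (s2 - s) \<le> norm (sgn x - s2) + norm (sgn x - s)"
        using norm_triangle_ineq[of "s2 - sgn x" "sgn x - s"] by (simp add: norm_minus_commute)
      then have "w \<le> norm (sgn x - s)" using that u2 h(4) W by (simp add: sector_def)
      then show ?thesis using \<sigma>_id by (simp add: \<Psi>'_def)
    qed
    then have "\<Psi>' ` sector s2 u2 (1 + u2) \<subseteq> R2" unfolding R2_def by auto
    moreover have "R2 \<inter> \<Psi>' ` cball 0 1 = {}" using \<Psi>'R2 by auto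
    ultimately show "valid_task \<Psi>' s2 u2 R2"
      unfolding valid_task_def using R2 u2 u s2 by auto
    show "P \<subseteq> R1" "R1 \<subseteq> R \<inter> Q" using R1 by auto
    show "Z \<subseteq> R2" "R2 \<subseteq> R" using R2 by auto
    show "R1 \<inter> R2 = {}" using R1(4) F2(3) by blast
    show "cball s u1 \<subseteq> cball s u" using u1 u by auto
    show "cball s2 u2 \<subseteq> cball s u"
    proof
      fix x assume "x \<in> cball s2 u2"
      then show "x \<in> cball s u"
        using u2 s2 dist_triangle[of s x s2] by (simp add: dist_norm norm_minus_commute)
    qed
    show "cball s u1 \<inter> cball s2 u2 = {}"
    proof -
      have "dist s s2 > u1 + u2" using u1 u2 s2s by (simp add: dist_norm norm_minus_commute)
      moreover have "dist s s2 \<le> u1 + u2" if "x \<in> cball s u1" "x \<in> cball s2 u2" for x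
        using that dist_triangle2[of s s2 x] by simp
      ultimately show ?thesis by (meson disjoint_iff not_le)
    qed
    show "open V" by (rule V(1))
    have "2 * w < u" using h(4) W u by linarith
    then have "sphere 0 1 - cball s u \<subseteq> sphere 0 1 - ball s (2 * w)" by auto
    then show "sphere 0 1 - cball s u \<subseteq> V" using V(3) by blast
    show "\<And>x. x \<in> V \<Longrightarrow> \<Psi>' x = \<Psi> x" by (rule V(2))
    fix x
    show "\<Psi>' x = \<Psi> x" if "u \<le> norm (sgn x - s)" "\<Psi> x \<notin> R"
      using \<sigma>_id[of x] that h(4) W u E_eq by (simp add: \<Psi>'_def)
    show "\<Psi>' ` cball 0 1 \<subseteq> \<Psi> ` cball 0 1 \<union> R"
    proof
      fix y assume "y \<in> \<Psi>' ` cball 0 1"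
      then obtain x where x: "norm x \<le> 1" "y = E (\<sigma> x)" by (auto simp: \<Psi>'_def)
      from spike[OF x(1)] show "y \<in> \<Psi> ` cball 0 1 \<union> R"
      proof
        assume "\<sigma> x \<in> cball 0 1"
        then show ?thesis using E_eq[OF \<Psi>ball, of "\<sigma> x"] x(2) by auto
      qed (use x(2) \<Psi>R E_R in blast)
    qed
    show "\<Psi>' x = \<Psi> x \<or> \<Psi>' x \<in> R" if "x \<in> sphere 0 1"
    proof -
      have x: "norm x = 1" using that by simp
      from spike[of x] x consider "norm (\<sigma> x) \<le> 1" | "\<sigma> x \<in> sector s u (1 + u)" by auto
      then show ?thesis
      proof cases
        case 1
        have "1 + h (sgn x) \<le> 1" using 1 x h(5)[of "sgn x"] by (simp add: \<sigma>_def)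
        then have "h (sgn x) = 0" using h(5)[of "sgn x"] by linarith
        then have "\<sigma> x = x" by (simp add: \<sigma>_def)
        then show ?thesis using E_eq[OF \<Psi>ball, of x] x by (simp add: \<Psi>'_def)
      next
        case 2
        then show ?thesis using \<Psi>R E_R unfolding \<Psi>'_def by blast
      qed
    qed
    show "energy \<Psi>' \<le> energy \<Psi> + ennreal \<epsilon>"
      unfolding \<Psi>'_def[abs_def] \<sigma>_def
      by (rule energy_spike_le[OF EE(5) h(1,5) h1 M(2,1) H'(5) V(1,3) V2 h(9) \<epsilon>])
  qed
qed

section \<open>Refining a family of tasks\<close>

type_synonym 'a task = "'a \<times> real \<times> 'a set"

abbreviation tip :: "'a task \<Rightarrow> 'a" where "tip \<tau> \<equiv> fst \<tau>"
abbreviation rad :: "'a task \<Rightarrow> real" where "rad \<tau> \<equiv> fst (snd \<tau>)"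
abbreviation reg :: "'a task \<Rightarrow> 'a set" where "reg \<tau> \<equiv> snd (snd \<tau>)"
abbreviation cap :: "'a::euclidean_space task \<Rightarrow> 'a set" where "cap \<tau> \<equiv> cball (tip \<tau>) (rad \<tau>)"

text \<open>The caps are closed and disjoint, so that a point of the sphere belongs to at most one task.\<close>

definition state :: "'a::euclidean_space set \<Rightarrow> ('a \<Rightarrow> 'a) \<Rightarrow> ('a \<Rightarrow> 'a) \<Rightarrow> 'a task set \<Rightarrow> bool" where
  "state C \<Psi> \<Psi>i T \<longleftrightarrow> homeo_pair \<Psi> \<Psi>i \<and> finite T \<and> (\<forall>\<tau>\<in>T. valid_task \<Psi> (tip \<tau>) (rad \<tau>) (reg \<tau>)) \<and>
     (\<forall>\<tau>\<in>T. \<forall>\<tau>'\<in>T. \<tau> \<noteq> \<tau>' \<longrightarrow> cap \<tau> \<inter> cap \<tau>' = {} \<and> reg \<tau> \<inter> reg \<tau>' = {}) \<and> C \<subseteq> (\<Union>\<tau>\<in>T. reg \<tau>)"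

text \<open>One step of the construction as seen by the limit: tasks are nested, the map changes only over the
  caps, the image of a cap stays within the region of its task and its previous image, and the energy
  grows by at most \<open>\<epsilon>\<close>.\<close>

definition refines :: "real \<Rightarrow> ('a::euclidean_space \<Rightarrow> 'a) \<Rightarrow> 'a task set \<Rightarrow> ('a \<Rightarrow> 'a) \<Rightarrow> 'a task set \<Rightarrow> bool" where
  "refines \<epsilon> \<Psi> T \<Psi>' T' \<longleftrightarrow>
     (\<forall>\<nu>\<in>T'. \<exists>\<tau>\<in>T. cap \<nu> \<subseteq> cap \<tau> \<and> reg \<nu> \<subseteq> reg \<tau>) \<and>
     (\<exists>V. open V \<and> sphere 0 1 - (\<Union>\<tau>\<in>T. cap \<tau>) \<subseteq> V \<and> (\<forall>x\<in>V. \<Psi>' x = \<Psi> x)) \<and>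
     (\<forall>\<tau>\<in>T. \<forall>x\<in>sphere 0 1 \<inter> cap \<tau>. \<Psi>' x \<in> reg \<tau> \<union> \<Psi> ` (sphere 0 1 \<inter> cap \<tau>)) \<and>
     energy \<Psi>' \<le> energy \<Psi> + ennreal \<epsilon>"

lemma refines_same:
  assumes "\<And>\<nu>. \<nu> \<in> T' \<Longrightarrow> \<exists>\<tau>\<in>T. cap \<nu> \<subseteq> cap \<tau> \<and> reg \<nu> \<subseteq> reg \<tau>"
  shows "refines \<epsilon> \<Psi> T \<Psi> T'"
  unfolding refines_def using assms by (intro conjI exI[of _ UNIV]) auto

text \<open>The third clause composes because the caps of \<open>T\<close> are disjoint: a task of \<open>T'\<close> whose cap meets that of \<open>\<tau>\<close> descends
  from \<open>\<tau>\<close>.\<close>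

lemma refines_trans:
  assumes st: "state C \<Psi> \<Psi>i T" and r1: "refines a \<Psi> T \<Psi>' T'" and r2: "refines b \<Psi>' T' \<Psi>'' T''"
    and ab: "0 \<le> a" "0 \<le> b"
  shows "refines (a + b) \<Psi> T \<Psi>'' T''"
proof -
  obtain V where V: "open V" "sphere 0 1 - (\<Union>\<tau>\<in>T. cap \<tau>) \<subseteq> V" "\<forall>x\<in>V. \<Psi>' x = \<Psi> x"
    using r1 unfolding refines_def by blast
  obtain V' where V': "open V'" "sphere 0 1 - (\<Union>\<tau>\<in>T'. cap \<tau>) \<subseteq> V'" "\<forall>x\<in>V'. \<Psi>'' x = \<Psi>' x"
    using r2 unfolding refines_def by blast
  have par: "\<exists>\<tau>\<in>T. cap \<nu> \<subseteq> cap \<tau> \<and> reg \<nu> \<subseteq> reg \<tau>" if "\<nu> \<in> T'" for \<nu>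
    using r1 that unfolding refines_def by blast
  have par': "\<exists>\<tau>\<in>T'. cap \<nu> \<subseteq> cap \<tau> \<and> reg \<nu> \<subseteq> reg \<tau>" if "\<nu> \<in> T''" for \<nu>
    using r2 that unfolding refines_def by blast
  have img: "\<Psi>' x \<in> reg \<tau> \<union> \<Psi> ` (sphere 0 1 \<inter> cap \<tau>)" if "\<tau> \<in> T" "x \<in> sphere 0 1 \<inter> cap \<tau>" for \<tau> x
    using r1 that unfolding refines_def by blast
  have img': "\<Psi>'' x \<in> reg \<tau> \<union> \<Psi>' ` (sphere 0 1 \<inter> cap \<tau>)" if "\<tau> \<in> T'" "x \<in> sphere 0 1 \<inter> cap \<tau>" for \<tau> x
    using r2 that unfolding refines_def by blast
  have disj: "\<tau> = \<tau>'" if "\<tau> \<in> T" "\<tau>' \<in> T" "x \<in> cap \<tau>" "x \<in> cap \<tau>'" for \<tau> \<tau>' x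
    using st that unfolding state_def by blast
  show ?thesis
    unfolding refines_def
  proof (intro conjI ballI)
    fix \<nu> assume "\<nu> \<in> T''"
    then show "\<exists>\<tau>\<in>T. cap \<nu> \<subseteq> cap \<tau> \<and> reg \<nu> \<subseteq> reg \<tau>" using par par' by (meson order_trans)
  next
    have "(\<Union>\<tau>\<in>T'. cap \<tau>) \<subseteq> (\<Union>\<tau>\<in>T. cap \<tau>)" using par by blast
    then have "sphere 0 1 - (\<Union>\<tau>\<in>T. cap \<tau>) \<subseteq> V'"
      by (rule order_trans[OF Diff_mono[OF order_refl] V'(2)])
    then have "sphere 0 1 - (\<Union>\<tau>\<in>T. cap \<tau>) \<subseteq> V \<inter> V'" using V(2) by (rule Int_greatest[rotated])
    then show "\<exists>V. open V \<and> sphere 0 1 - (\<Union>\<tau>\<in>T. cap \<tau>) \<subseteq> V \<and> (\<forall>x\<in>V. \<Psi>'' x = \<Psi> x)"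
      using V(1,3) V'(1,3) by (intro exI[of _ "V \<inter> V'"]) (simp add: open_Int)
  next
    fix \<tau> x assume \<tau>: "\<tau> \<in> T" and x: "x \<in> sphere 0 1 \<inter> cap \<tau>"
    show "\<Psi>'' x \<in> reg \<tau> \<union> \<Psi> ` (sphere 0 1 \<inter> cap \<tau>)"
    proof (cases "\<exists>\<nu>\<in>T'. x \<in> cap \<nu>")
      case False
      then have "\<Psi>'' x = \<Psi>' x" using V' x by blast
      then show ?thesis using img[OF \<tau> x] by simp
    next
      case True
      then obtain \<nu> where \<nu>: "\<nu> \<in> T'" "x \<in> cap \<nu>" by blast
      then obtain \<tau>' where "\<tau>' \<in> T" "cap \<nu> \<subseteq> cap \<tau>'" "reg \<nu> \<subseteq> reg \<tau>'" using par by blast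
      moreover have "\<tau> = \<tau>'" using disj[OF \<tau> \<open>\<tau>' \<in> T\<close>] x \<nu> calculation by blast
      ultimately have sub: "cap \<nu> \<subseteq> cap \<tau>" "reg \<nu> \<subseteq> reg \<tau>" by auto
      have "\<Psi>'' x \<in> reg \<nu> \<union> \<Psi>' ` (sphere 0 1 \<inter> cap \<nu>)" using img'[OF \<nu>(1)] x \<nu> by blast
      then show ?thesis
      proof
        assume "\<Psi>'' x \<in> \<Psi>' ` (sphere 0 1 \<inter> cap \<nu>)"
        then obtain z where "\<Psi>'' x = \<Psi>' z" "z \<in> sphere 0 1 \<inter> cap \<tau>" using sub(1) by blast
        then show ?thesis using img[OF \<tau>, of z] by simp
      qed (use sub(2) in blast)
    qed
  next
    have "energy \<Psi>'' \<le> energy \<Psi>' + ennreal b" "energy \<Psi>' \<le> energy \<Psi> + ennreal a"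
      using r1 r2 unfolding refines_def by auto
    then have "energy \<Psi>'' \<le> energy \<Psi> + ennreal a + ennreal b" by (meson add_right_mono order_trans)
    then show "energy \<Psi>'' \<le> energy \<Psi> + ennreal (a + b)" using ab by (simp add: ennreal_plus add.assoc)
  qed
qed

lemma state_subset:
  assumes "state C \<Psi> \<Psi>i T" "T' \<subseteq> T" "C \<subseteq> (\<Union>\<tau>\<in>T'. reg \<tau>)"
  shows "state C \<Psi> \<Psi>i T'" "refines \<epsilon> \<Psi> T \<Psi> T'"
proof -
  show "state C \<Psi> \<Psi>i T'"
    using assms(1) finite_subset[OF assms(2)] unfolding state_def by (auto simp: assms(3) subsetD[OF assms(2)])
  show "refines \<epsilon> \<Psi> T \<Psi> T'" by (rule refines_same) (use assms(2) in blast)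
qed

text \<open>The change is supported in the cap and the region of \<open>\<tau>\<close>, hence it does not disturb the other tasks.\<close>

lemma split_task:
  fixes \<Psi> :: "'a::euclidean_space \<Rightarrow> 'a"
  assumes dim: "3 \<le> DIM('a)" and st: "state C \<Psi> \<Psi>i T" and \<tau>: "\<tau> \<in> T"
    and P: "compact P" "connected P" "P \<noteq> {}" "connected (- P)" "P \<subseteq> reg \<tau>"
    and Z: "compact Z" "connected (- Z)" "Z \<subseteq> reg \<tau>" "P \<inter> Z = {}"
    and Q: "open Q" "P \<subseteq> Q" and \<epsilon>: "0 < \<epsilon>" and C: "C \<inter> reg \<tau> \<subseteq> P \<union> Z"
  obtains \<Psi>' \<Psi>i' \<tau>1 \<tau>2 where
    "state C \<Psi>' \<Psi>i' (insert \<tau>1 (insert \<tau>2 (T - {\<tau>})))" "refines \<epsilon> \<Psi> T \<Psi>' (insert \<tau>1 (insert \<tau>2 (T - {\<tau>})))"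
    "P \<subseteq> reg \<tau>1" "reg \<tau>1 \<subseteq> Q" "Z \<subseteq> reg \<tau>2" "C \<inter> reg \<tau>2 \<subseteq> Z" "\<tau>2 \<noteq> \<tau>1" "\<tau>2 \<notin> T - {\<tau>}"
proof -
  have H: "homeo_pair \<Psi> \<Psi>i" and fin: "finite T" and val: "\<And>\<tau>. \<tau> \<in> T \<Longrightarrow> valid_task \<Psi> (tip \<tau>) (rad \<tau>) (reg \<tau>)"
    and disj: "\<And>\<tau> \<tau>'. \<tau> \<in> T \<Longrightarrow> \<tau>' \<in> T \<Longrightarrow> \<tau> \<noteq> \<tau>' \<Longrightarrow> cap \<tau> \<inter> cap \<tau>' = {} \<and> reg \<tau> \<inter> reg \<tau>' = {}"
    and CT: "C \<subseteq> (\<Union>\<tau>\<in>T. reg \<tau>)"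
    using st unfolding state_def by auto
  obtain \<Psi>' \<Psi>i' u1 R1 s2 u2 R2 V where F: "homeo_pair \<Psi>' \<Psi>i'" "valid_task \<Psi>' (tip \<tau>) u1 R1" "valid_task \<Psi>' s2 u2 R2"
    "P \<subseteq> R1" "R1 \<subseteq> reg \<tau> \<inter> Q" "Z \<subseteq> R2" "R2 \<subseteq> reg \<tau>" "R1 \<inter> R2 = {}"
    "cball (tip \<tau>) u1 \<subseteq> cap \<tau>" "cball s2 u2 \<subseteq> cap \<tau>" "cball (tip \<tau>) u1 \<inter> cball s2 u2 = {}"
    "open V" "sphere 0 1 - cap \<tau> \<subseteq> V" "\<And>x. x \<in> V \<Longrightarrow> \<Psi>' x = \<Psi> x"
    "\<And>x. rad \<tau> \<le> norm (sgn x - tip \<tau>) \<Longrightarrow> \<Psi> x \<notin> reg \<tau> \<Longrightarrow> \<Psi>' x = \<Psi> x"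
    "\<Psi>' ` cball 0 1 \<subseteq> \<Psi> ` cball 0 1 \<union> reg \<tau>"
    "\<And>x. x \<in> sphere 0 1 \<Longrightarrow> \<Psi>' x = \<Psi> x \<or> \<Psi>' x \<in> reg \<tau>"
    "energy \<Psi>' \<le> energy \<Psi> + ennreal \<epsilon>"
    by (rule finger_move[OF dim H val[OF \<tau>] P Z Q \<epsilon>]) (rule that)
  define \<tau>1 \<tau>2 where "\<tau>1 = (tip \<tau>, u1, R1)" and "\<tau>2 = (s2, u2, R2)"
  have nonempty: "s2 \<in> cap \<tau>2" using F(3) by (auto simp: \<tau>2_def valid_task_def)
  have ne: "\<tau>2 \<noteq> \<tau>1" using F(11) nonempty by (auto simp: \<tau>1_def \<tau>2_def)
  have notin: "\<tau>2 \<notin> T - {\<tau>}"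
  proof
    assume "\<tau>2 \<in> T - {\<tau>}"
    then have "cap \<tau> \<inter> cap \<tau>2 = {}" using disj[OF \<tau>, of \<tau>2] by blast
    moreover have "cap \<tau>2 \<subseteq> cap \<tau>" using F(10) by (simp add: \<tau>2_def)
    ultimately show False using nonempty by blast
  qed
  have sub: "cap \<nu> \<subseteq> cap \<tau> \<and> reg \<nu> \<subseteq> reg \<tau>" if "\<nu> \<in> {\<tau>1, \<tau>2}" for \<nu>
    using that F(5,7,9,10) by (auto simp: \<tau>1_def \<tau>2_def)
  let ?T = "insert \<tau>1 (insert \<tau>2 (T - {\<tau>}))"
  have "state C \<Psi>' \<Psi>i' ?T"
    unfolding state_def
  proof (intro conjI ballI impI)
    show "homeo_pair \<Psi>' \<Psi>i'" "finite ?T" using F(1) fin by auto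
    fix \<nu> assume \<nu>: "\<nu> \<in> ?T"
    then consider "\<nu> = \<tau>1" | "\<nu> = \<tau>2" | "\<nu> \<in> T" "\<nu> \<noteq> \<tau>" by blast
    then show "valid_task \<Psi>' (tip \<nu>) (rad \<nu>) (reg \<nu>)"
    proof cases
      case 3
      have v: "valid_task \<Psi> (tip \<nu>) (rad \<nu>) (reg \<nu>)" using val 3 by blast
      have d: "cap \<nu> \<inter> cap \<tau> = {}" "reg \<nu> \<inter> reg \<tau> = {}" using disj[OF 3(1) \<tau> 3(2)] by auto
      have "\<Psi>' x = \<Psi> x" if x: "x \<in> sector (tip \<nu>) (rad \<nu>) (1 + rad \<nu>)" for x
      proof (rule F(15))
        have "\<Psi> x \<in> reg \<nu>" using v x by (auto simp: valid_task_def)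
        then show "\<Psi> x \<notin> reg \<tau>" using d by blast
        have "sgn x \<in> cap \<nu>" using x by (auto simp: sector_def dist_norm norm_minus_commute)
        then have "sgn x \<notin> cap \<tau>" using d by blast
        then show "rad \<tau> \<le> norm (sgn x - tip \<tau>)" by (simp add: dist_norm norm_minus_commute)
      qed
      then have "\<Psi>' ` sector (tip \<nu>) (rad \<nu>) (1 + rad \<nu>) = \<Psi> ` sector (tip \<nu>) (rad \<nu>) (1 + rad \<nu>)" by auto
      moreover have "reg \<nu> \<inter> \<Psi>' ` cball 0 1 = {}" using v F(16) d unfolding valid_task_def by blast
      ultimately show ?thesis using v unfolding valid_task_def by metis
    qed (use F(2,3) in \<open>auto simp: \<tau>1_def \<tau>2_def\<close>)
  next
    fix \<nu> \<nu>' assume \<nu>: "\<nu> \<in> ?T" "\<nu>' \<in> ?T" "\<nu> \<noteq> \<nu>'"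
    have 12: "cap \<tau>1 \<inter> cap \<tau>2 = {}" "reg \<tau>1 \<inter> reg \<tau>2 = {}" using F(8,11) by (auto simp: \<tau>1_def \<tau>2_def)
    have old: "cap \<nu> \<inter> cap \<nu>' = {} \<and> reg \<nu> \<inter> reg \<nu>' = {}" if "\<nu> \<in> {\<tau>1, \<tau>2}" "\<nu>' \<in> T - {\<tau>}" for \<nu> \<nu>'
      using sub[OF that(1)] disj[OF \<tau>, of \<nu>'] that(2) by blast
    show "cap \<nu> \<inter> cap \<nu>' = {}" "reg \<nu> \<inter> reg \<nu>' = {}"
      using \<nu> 12 old[of \<nu> \<nu>'] old[of \<nu>' \<nu>] disj[of \<nu> \<nu>'] by (auto simp: Int_commute)
  next
    show "C \<subseteq> (\<Union>\<nu>\<in>?T. reg \<nu>)"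
    proof
      fix c assume "c \<in> C"
      then obtain \<nu> where \<nu>: "\<nu> \<in> T" "c \<in> reg \<nu>" using CT by blast
      show "c \<in> (\<Union>\<nu>\<in>?T. reg \<nu>)"
      proof (cases "\<nu> = \<tau>")
        case True
        then have "c \<in> reg \<tau>1 \<union> reg \<tau>2" using C \<open>c \<in> C\<close> \<nu> F(4,6) by (auto simp: \<tau>1_def \<tau>2_def)
        then show ?thesis by blast
      qed (use \<nu> in blast)
    qed
  qed
  moreover have "refines \<epsilon> \<Psi> T \<Psi>' ?T"
    unfolding refines_def
  proof (intro conjI ballI)
    fix \<nu> assume "\<nu> \<in> ?T"
    then show "\<exists>\<tau>\<in>T. cap \<nu> \<subseteq> cap \<tau> \<and> reg \<nu> \<subseteq> reg \<tau>" using sub \<tau> by blast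
  next
    show "\<exists>V. open V \<and> sphere 0 1 - (\<Union>\<tau>\<in>T. cap \<tau>) \<subseteq> V \<and> (\<forall>x\<in>V. \<Psi>' x = \<Psi> x)"
      using F(12-14) \<tau> by (intro exI[of _ V]) blast
  next
    fix \<nu> x assume \<nu>: "\<nu> \<in> T" and x: "x \<in> sphere 0 1 \<inter> cap \<nu>"
    show "\<Psi>' x \<in> reg \<nu> \<union> \<Psi> ` (sphere 0 1 \<inter> cap \<nu>)"
    proof (cases "\<nu> = \<tau>")
      case True
      then show ?thesis using F(17)[of x] x by auto
    next
      case False
      then have "x \<in> V" using disj[OF \<nu> \<tau>] x F(13) by blast
      then show ?thesis using F(14) x by auto
    qed
  qed (rule F(18))
  moreover have "C \<inter> reg \<tau>2 \<subseteq> Z" using C F(4,7,8) by (auto simp: \<tau>2_def)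
  ultimately show ?thesis using that[of \<Psi>' \<Psi>i' \<tau>1 \<tau>2] F(4,5,6) ne notin by (auto simp: \<tau>1_def \<tau>2_def)
qed

definition good_task :: "'a::euclidean_space set \<Rightarrow> real \<Rightarrow> 'a task \<Rightarrow> bool" where
  "good_task C e \<nu> \<longleftrightarrow> reg \<nu> \<inter> C \<noteq> {} \<and> (\<exists>x. reg \<nu> \<subseteq> ball x e)"

text \<open>The continua are peeled off one at a time; the second task produced by a split serves all the remaining
  ones. When none is left, the region contains no point of \<open>C\<close> and the task is dropped.\<close>

lemma replace_task:
  fixes \<Psi> :: "'a::euclidean_space \<Rightarrow> 'a"
  assumes dim: "3 \<le> DIM('a)" and "finite \<P>" "pairwise disjnt \<P>"
    and "\<And>P. P \<in> \<P> \<Longrightarrow> compact P \<and> connected P \<and> connected (- P) \<and> P \<subseteq> reg \<tau> \<and> P \<inter> C \<noteq> {} \<and> (\<exists>x. P \<subseteq> ball x e)"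
    and "state C \<Psi> \<Psi>i T" "\<tau> \<in> T" "C \<inter> reg \<tau> \<subseteq> \<Union>\<P>" "0 < \<epsilon>"
  shows "\<exists>\<Psi>' \<Psi>i' N. state C \<Psi>' \<Psi>i' (N \<union> (T - {\<tau>})) \<and> refines \<epsilon> \<Psi> T \<Psi>' (N \<union> (T - {\<tau>})) \<and> (\<forall>\<nu>\<in>N. good_task C e \<nu>)"
  using assms(2-)
proof (induction \<P> arbitrary: \<Psi> \<Psi>i T \<tau> \<epsilon> rule: finite_induct)
  case empty
  then have "C \<inter> reg \<tau> = {}" by auto
  then have sub: "C \<subseteq> (\<Union>\<nu>\<in>T - {\<tau>}. reg \<nu>)" using empty.prems(3) unfolding state_def by blast
  then show ?case
    using state_subset[OF empty.prems(3) Diff_subset sub] by (intro exI[of _ \<Psi>] exI[of _ \<Psi>i] exI[of _ "{}"]) auto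
next
  case (insert P \<P>)
  note Pp = insert.prems(2)[of P, simplified]
  obtain x where x: "P \<subseteq> ball x e" using Pp by blast
  have PZ: "P \<inter> \<Union>\<P> = {}" using insert.prems(1) insert.hyps(2) by (auto simp: pairwise_insert disjnt_def)
  have dP: "pairwise disjnt \<P>" using insert.prems(1) by (simp add: pairwise_insert)
  have Z: "compact (\<Union>\<P>)" "connected (- \<Union>\<P>)" "\<Union>\<P> \<subseteq> reg \<tau>"
  proof -
    show "compact (\<Union>\<P>)" using insert by (intro compact_Union) auto
    show "connected (- \<Union>\<P>)" using nonseparating_disjoint_Union[OF insert.hyps(1) dP] insert.prems(2) by blast
    show "\<Union>\<P> \<subseteq> reg \<tau>" using insert.prems(2) by blast
  qed
  have P: "compact P" "connected P" "P \<noteq> {}" "connected (- P)" "P \<subseteq> reg \<tau>" using Pp by auto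
  have C: "C \<inter> reg \<tau> \<subseteq> P \<union> \<Union>\<P>" using insert.prems(5) by simp
  have e2: "0 < \<epsilon> / 2" using insert.prems(6) by simp
  obtain \<Psi>' \<Psi>i' \<tau>1 \<tau>2 where S:
    "state C \<Psi>' \<Psi>i' (insert \<tau>1 (insert \<tau>2 (T - {\<tau>})))" "refines (\<epsilon> / 2) \<Psi> T \<Psi>' (insert \<tau>1 (insert \<tau>2 (T - {\<tau>})))"
    "P \<subseteq> reg \<tau>1" "reg \<tau>1 \<subseteq> ball x e" "\<Union>\<P> \<subseteq> reg \<tau>2" "C \<inter> reg \<tau>2 \<subseteq> \<Union>\<P>" "\<tau>2 \<noteq> \<tau>1" "\<tau>2 \<notin> T - {\<tau>}"
    by (rule split_task[OF dim insert.prems(3,4) P Z PZ open_ball x e2 C]) (rule that)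
  let ?T = "insert \<tau>1 (insert \<tau>2 (T - {\<tau>}))"
  have "\<exists>\<Psi>'' \<Psi>i'' N. state C \<Psi>'' \<Psi>i'' (N \<union> (?T - {\<tau>2})) \<and> refines (\<epsilon> / 2) \<Psi>' ?T \<Psi>'' (N \<union> (?T - {\<tau>2})) \<and> (\<forall>\<nu>\<in>N. good_task C e \<nu>)"
  proof (rule insert.IH[OF dP _ S(1) _ S(6) e2])
    fix P' assume "P' \<in> \<P>"
    then show "compact P' \<and> connected P' \<and> connected (- P') \<and> P' \<subseteq> reg \<tau>2 \<and> P' \<inter> C \<noteq> {} \<and> (\<exists>x. P' \<subseteq> ball x e)"
      using insert.prems(2)[of P'] S(5) by blast
  qed simp
  then obtain \<Psi>'' \<Psi>i'' N where N: "state C \<Psi>'' \<Psi>i'' (N \<union> (?T - {\<tau>2}))" "refines (\<epsilon> / 2) \<Psi>' ?T \<Psi>'' (N \<union> (?T - {\<tau>2}))"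
    "\<forall>\<nu>\<in>N. good_task C e \<nu>" by blast
  have eq: "N \<union> (?T - {\<tau>2}) = insert \<tau>1 N \<union> (T - {\<tau>})" using S(7,8) by blast
  have "refines (\<epsilon> / 2 + \<epsilon> / 2) \<Psi> T \<Psi>'' (N \<union> (?T - {\<tau>2}))"
    using refines_trans[OF insert.prems(3) S(2) N(2)] e2 by simp
  moreover have "good_task C e \<tau>1" unfolding good_task_def using S(3,4) Pp by blast
  ultimately show ?case using N(1,3) unfolding eq
    by (intro exI[of _ \<Psi>''] exI[of _ \<Psi>i''] exI[of _ "insert \<tau>1 N"]) simp
qed

text \<open>Replacing a bad task by good ones lowers the number of bad tasks.\<close>

lemma all_tasks_good:
  fixes \<Psi> :: "'a::euclidean_space \<Rightarrow> 'a"
  assumes dim: "3 \<le> DIM('a)" and C: "compact C" "totally_disconnected C" and e: "0 < e"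
    and "state C \<Psi> \<Psi>i T" "0 < \<epsilon>"
  shows "\<exists>\<Psi>' \<Psi>i' T'. state C \<Psi>' \<Psi>i' T' \<and> refines \<epsilon> \<Psi> T \<Psi>' T' \<and> (\<forall>\<nu>\<in>T'. good_task C e \<nu>)"
  using assms(5,6)
proof (induction "card {\<tau>\<in>T. \<not> good_task C e \<tau>}" arbitrary: \<Psi> \<Psi>i T \<epsilon> rule: less_induct)
  case less
  have fin: "finite T" using less.prems(1) by (simp add: state_def)
  show ?case
  proof (cases "\<exists>\<tau>\<in>T. \<not> good_task C e \<tau>")
    case False
    then show ?thesis using less.prems(1) refines_same[of T T \<epsilon> \<Psi>] by blast
  next
    case True
    then obtain \<tau> where \<tau>: "\<tau> \<in> T" "\<not> good_task C e \<tau>" by blast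
    have opn: "open (reg \<nu>)" if "\<nu> \<in> T" for \<nu> using less.prems(1) that by (auto simp: state_def valid_task_def)
    have "C \<inter> reg \<tau> = C - (\<Union>\<nu>\<in>T - {\<tau>}. reg \<nu>)"
      using less.prems(1) \<tau>(1) unfolding state_def by blast
    moreover have "open (\<Union>\<nu>\<in>T - {\<tau>}. reg \<nu>)" using opn by blast
    ultimately have c: "compact (C \<inter> reg \<tau>)" using C(1) by (simp add: compact_diff)
    have td: "totally_disconnected (C \<inter> reg \<tau>)" using C(2) unfolding totally_disconnected_def by blast
    have dim2: "2 \<le> DIM('a)" using dim by simp
    obtain \<P> where \<P>: "finite \<P>" "pairwise disjnt \<P>" "C \<inter> reg \<tau> \<subseteq> \<Union>\<P>"
      "\<And>P. P \<in> \<P> \<Longrightarrow> compact P \<and> connected P \<and> connected (- P) \<and> P \<subseteq> reg \<tau> \<and> P \<inter> (C \<inter> reg \<tau>) \<noteq> {} \<and> (\<exists>x. P \<subseteq> ball x e)"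
      by (rule totally_disconnected_filled_cover[OF c td opn[OF \<tau>(1)] Int_lower2 e dim2]) (rule that)
    have e2: "0 < \<epsilon> / 2" using less.prems(2) by simp
    obtain \<Psi>' \<Psi>i' N where N: "state C \<Psi>' \<Psi>i' (N \<union> (T - {\<tau>}))" "refines (\<epsilon> / 2) \<Psi> T \<Psi>' (N \<union> (T - {\<tau>}))" "\<forall>\<nu>\<in>N. good_task C e \<nu>"
      using replace_task[OF dim \<P>(1,2) _ less.prems(1) \<tau>(1) \<P>(3) e2, of e] \<P>(4) by blast
    have "{\<nu> \<in> N \<union> (T - {\<tau>}). \<not> good_task C e \<nu>} \<subset> {\<tau>\<in>T. \<not> good_task C e \<tau>}" using N(3) \<tau> by blast
    then have "card {\<nu> \<in> N \<union> (T - {\<tau>}). \<not> good_task C e \<nu>} < card {\<tau>\<in>T. \<not> good_task C e \<tau>}"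
      using fin by (intro psubset_card_mono) auto
    from less.hyps[OF this N(1) e2] obtain \<Psi>'' \<Psi>i'' T' where
      T': "state C \<Psi>'' \<Psi>i'' T'" "refines (\<epsilon> / 2) \<Psi>' (N \<union> (T - {\<tau>})) \<Psi>'' T'" "\<forall>\<nu>\<in>T'. good_task C e \<nu>" by blast
    have "refines (\<epsilon> / 2 + \<epsilon> / 2) \<Psi> T \<Psi>'' T'" using refines_trans[OF less.prems(1) N(2) T'(2)] e2 by simp
    then show ?thesis using T' by auto
  qed
qed

text \<open>Only the caps change. They may be made small in the domain and, by continuity, also in the image.\<close>

lemma shrink_caps:
  fixes \<Psi> :: "'a::euclidean_space \<Rightarrow> 'a"
  assumes st: "state C \<Psi> \<Psi>i T" and r: "0 < r" and e: "0 < e"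
  obtains T' where "state C \<Psi> \<Psi>i T'" "refines \<epsilon> \<Psi> T \<Psi> T'" "card T' \<le> card T"
    "\<And>\<nu>. \<nu> \<in> T' \<Longrightarrow> rad \<nu> \<le> r \<and> (\<forall>x\<in>cap \<nu>. dist (\<Psi> x) (\<Psi> (tip \<nu>)) \<le> e) \<and> (\<exists>\<tau>\<in>T. reg \<nu> = reg \<tau>)"
proof -
  have cont: "continuous_on UNIV \<Psi>" using st by (auto simp: state_def homeo_pair_def)
  have "\<exists>d>0. \<forall>x. dist x s < d \<longrightarrow> dist (\<Psi> x) (\<Psi> s) < e" for s
    using cont e unfolding continuous_on_iff by auto
  then obtain d where d: "\<And>s. 0 < d s" "\<And>s x. dist x s < d s \<Longrightarrow> dist (\<Psi> x) (\<Psi> s) < e" by metis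
  define f where "f \<tau> = (tip \<tau>, min (min (rad \<tau>) r) (d (tip \<tau>) / 2), reg \<tau>)" for \<tau> :: "'a task"
  have f: "tip (f \<tau>) = tip \<tau>" "reg (f \<tau>) = reg \<tau>" "rad (f \<tau>) \<le> rad \<tau>" "rad (f \<tau>) \<le> r" "rad (f \<tau>) \<le> d (tip \<tau>) / 2" for \<tau>
    by (auto simp: f_def)
  have capf: "cap (f \<tau>) \<subseteq> cap \<tau>" for \<tau> using f(1,3)[of \<tau>] by auto
  show ?thesis
  proof (rule that[of "f ` T"])
    show "state C \<Psi> \<Psi>i (f ` T)"
      unfolding state_def
    proof (intro conjI ballI impI)
      show "homeo_pair \<Psi> \<Psi>i" "finite (f ` T)" using st by (auto simp: state_def)
      show "C \<subseteq> (\<Union>\<tau>\<in>f ` T. reg \<tau>)" using st by (auto simp: state_def f)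
    next
      fix \<nu> assume "\<nu> \<in> f ` T"
      then obtain \<tau> where \<tau>: "\<tau> \<in> T" "\<nu> = f \<tau>" by blast
      have v: "valid_task \<Psi> (tip \<tau>) (rad \<tau>) (reg \<tau>)" using st \<tau> by (auto simp: state_def)
      moreover have "sector (tip \<tau>) (rad (f \<tau>)) (1 + rad (f \<tau>)) \<subseteq> sector (tip \<tau>) (rad \<tau>) (1 + rad \<tau>)"
        using f(3)[of \<tau>] by (intro sector_mono) auto
      moreover have "0 < rad (f \<tau>)" using v r d(1)[of "tip \<tau>"] by (simp add: f_def valid_task_def)
      ultimately show "valid_task \<Psi> (tip \<nu>) (rad \<nu>) (reg \<nu>)"
        unfolding \<tau>(2) f(1,2) using f(3)[of \<tau>] unfolding valid_task_def by (meson image_mono le_less_trans order_trans)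
    next
      fix \<nu> \<nu>' assume "\<nu> \<in> f ` T" "\<nu>' \<in> f ` T" "\<nu> \<noteq> \<nu>'"
      then obtain \<tau> \<tau>' where \<tau>: "\<tau> \<in> T" "\<tau>' \<in> T" "\<nu> = f \<tau>" "\<nu>' = f \<tau>'" "\<tau> \<noteq> \<tau>'" by blast
      then have "cap \<tau> \<inter> cap \<tau>' = {} \<and> reg \<tau> \<inter> reg \<tau>' = {}" using st by (simp add: state_def)
      then show "cap \<nu> \<inter> cap \<nu>' = {}" "reg \<nu> \<inter> reg \<nu>' = {}"
        unfolding \<tau>(3,4) f(2) using capf[of \<tau>] capf[of \<tau>'] by auto
    qed
    show "refines \<epsilon> \<Psi> T \<Psi> (f ` T)" 
    proof (rule refines_same)
      fix \<nu> assume "\<nu> \<in> f ` T"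
      then obtain \<tau> where "\<tau> \<in> T" "\<nu> = f \<tau>" by blast
      then show "\<exists>\<tau>\<in>T. cap \<nu> \<subseteq> cap \<tau> \<and> reg \<nu> \<subseteq> reg \<tau>" using capf[of \<tau>] f(2)[of \<tau>] by auto
    qed
    show "card (f ` T) \<le> card T" using st by (intro card_image_le) (simp add: state_def)
    fix \<nu> assume "\<nu> \<in> f ` T"
    then obtain \<tau> where \<tau>: "\<tau> \<in> T" "\<nu> = f \<tau>" by blast
    have "dist (\<Psi> x) (\<Psi> (tip \<nu>)) \<le> e" if "x \<in> cap \<nu>" for x
    proof -
      have "dist x (tip \<nu>) < d (tip \<nu>)"
        using that f(1,5)[of \<tau>] d(1)[of "tip \<tau>"] by (simp add: \<tau>(2) dist_commute)
      then show ?thesis using d(2) less_imp_le by blast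
    qed
    then show "rad \<nu> \<le> r \<and> (\<forall>x\<in>cap \<nu>. dist (\<Psi> x) (\<Psi> (tip \<nu>)) \<le> e) \<and> (\<exists>\<tau>\<in>T. reg \<nu> = reg \<tau>)"
      using f(2,4)[of \<tau>] \<tau> by auto
  qed
qed

text \<open>The last inequality makes the sum of \<open>(2 r)\<^sup>e\<close> over all cap radii \<open>r\<close> at most \<open>e\<close>. This yields Hausdorff dimension
  zero as well as small total measure of the caps.\<close>

definition fine_tasks :: "'a::euclidean_space set \<Rightarrow> ('a \<Rightarrow> 'a) \<Rightarrow> 'a task set \<Rightarrow> real \<Rightarrow> bool" where
  "fine_tasks C \<Psi> T e \<longleftrightarrow> (\<forall>\<nu>\<in>T. reg \<nu> \<inter> C \<noteq> {} \<and> (\<forall>c\<in>reg \<nu>. \<forall>y\<in>reg \<nu> \<union> \<Psi> ` cap \<nu>. dist y c \<le> 4 * e) \<and>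
      2 * rad \<nu> \<le> e \<and> real (card T) * (2 * rad \<nu>) powr e \<le> e)"

lemma next_state:
  fixes \<Psi> :: "'a::euclidean_space \<Rightarrow> 'a"
  assumes dim: "3 \<le> DIM('a)" and C: "compact C" "totally_disconnected C" and e: "0 < e" "e \<le> 1"
    and st: "state C \<Psi> \<Psi>i T" and \<epsilon>: "0 < \<epsilon>"
  shows "\<exists>\<Psi>' \<Psi>i' T'. state C \<Psi>' \<Psi>i' T' \<and> refines \<epsilon> \<Psi> T \<Psi>' T' \<and> fine_tasks C \<Psi>' T' e"
proof -
  obtain \<Psi>' \<Psi>i' T1 where 1: "state C \<Psi>' \<Psi>i' T1" "refines \<epsilon> \<Psi> T \<Psi>' T1" "\<forall>\<nu>\<in>T1. good_task C e \<nu>"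
    using all_tasks_good[OF dim C e(1) st \<epsilon>] by blast
  \<comment> \<open>The solution of \<open>(card T1 + 1) q\<^sup>e = e\<close>.\<close>
  define q where "q = (e / (real (card T1) + 1)) powr (1 / e)"
  have q: "0 < q" using e by (simp add: q_def)
  define r where "r = min q e / 2"
  have r: "0 < r" "2 * r \<le> e" "2 * r \<le> q" using q e by (auto simp: r_def)
  obtain T' where T': "state C \<Psi>' \<Psi>i' T'" "refines 0 \<Psi>' T1 \<Psi>' T'" "card T' \<le> card T1"
    "\<And>\<nu>. \<nu> \<in> T' \<Longrightarrow> rad \<nu> \<le> r \<and> (\<forall>x\<in>cap \<nu>. dist (\<Psi>' x) (\<Psi>' (tip \<nu>)) \<le> e) \<and> (\<exists>\<tau>\<in>T1. reg \<nu> = reg \<tau>)"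
    using shrink_caps[OF 1(1) r(1) e(1), of 0] by blast
  have "refines (\<epsilon> + 0) \<Psi> T \<Psi>' T'" using refines_trans[OF st 1(2) T'(2)] \<epsilon> by simp
  moreover have "fine_tasks C \<Psi>' T' e"
    unfolding fine_tasks_def
  proof (intro ballI conjI)
    fix \<nu> assume \<nu>: "\<nu> \<in> T'"
    have good: "good_task C e \<nu>" using T'(4)[OF \<nu>] 1(3) by (metis good_task_def)
    then show "reg \<nu> \<inter> C \<noteq> {}" by (simp add: good_task_def)
    show "2 * rad \<nu> \<le> e" using T'(4)[OF \<nu>] r by linarith
    have v: "valid_task \<Psi>' (tip \<nu>) (rad \<nu>) (reg \<nu>)" using T'(1) \<nu> by (simp add: state_def)
    then have rad: "0 < rad \<nu>" "norm (tip \<nu>) = 1" by (auto simp: valid_task_def)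
    have "real (card T') * (2 * rad \<nu>) powr e \<le> (real (card T1) + 1) * q powr e"
      using T'(3) T'(4)[OF \<nu>] r rad e by (intro mult_mono powr_mono2) auto
    also have "q powr e = e / (real (card T1) + 1)" using e by (simp add: q_def powr_powr)
    finally show "real (card T') * (2 * rad \<nu>) powr e \<le> e" by simp
    fix c y assume c: "c \<in> reg \<nu>" and y: "y \<in> reg \<nu> \<union> \<Psi>' ` cap \<nu>"
    obtain x where x: "reg \<nu> \<subseteq> ball x e" using good by (auto simp: good_task_def)
    have close: "dist a b \<le> 2 * e" if "a \<in> reg \<nu>" "b \<in> reg \<nu>" for a b
    proof -
      have "dist x a < e" "dist x b < e" using x that by auto
      then show ?thesis using dist_triangle[of a b x] by (simp add: dist_commute)
    qed
    show "dist y c \<le> 4 * e"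
    proof (cases "y \<in> reg \<nu>")
      case True
      then show ?thesis using close[OF True c] e by simp
    next
      case False
      then obtain z where z: "z \<in> cap \<nu>" "y = \<Psi>' z" using y by blast
      define p where "p = (1 + rad \<nu> / 2) *\<^sub>R tip \<nu>"
      have "p \<in> sector (tip \<nu>) (rad \<nu>) (1 + rad \<nu>)" unfolding p_def using rad by (intro scaleR_in_sector) auto
      then have "\<Psi>' p \<in> reg \<nu>" using v by (auto simp: valid_task_def)
      moreover have "p \<in> cap \<nu>"
      proof -
        have "tip \<nu> - p = (- rad \<nu> / 2) *\<^sub>R tip \<nu>" by (simp add: p_def algebra_simps)
        then show ?thesis using rad by (simp add: dist_norm)
      qed
      ultimately have "dist (\<Psi>' p) c \<le> 2 * e" "dist (\<Psi>' p) (\<Psi>' (tip \<nu>)) \<le> e" "dist (\<Psi>' z) (\<Psi>' (tip \<nu>)) \<le> e"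
        using close c T'(4)[OF \<nu>] z by auto
      then show ?thesis
        unfolding z(2) using dist_triangle[of "\<Psi>' z" c "\<Psi>' p"] dist_triangle2[of "\<Psi>' z" "\<Psi>' p" "\<Psi>' (tip \<nu>)"]
        by linarith
    qed
  qed
  ultimately show ?thesis using T'(1) by auto
qed

text \<open>The first map is a translation that puts the unit ball far away from \<open>C\<close>; the only region is the
  complement of the ball.\<close>

lemma initial_state:
  fixes C :: "'a::euclidean_space set"
  assumes dim: "3 \<le> DIM('a)" and C: "compact C"
  shows "\<exists>\<Psi> \<Psi>i T. state C \<Psi> \<Psi>i T"
proof -
  obtain B where B: "\<And>c. c \<in> C \<Longrightarrow> norm c \<le> B" using compact_imp_bounded[OF C] bounded_iff by blast
  obtain e :: 'a where e: "e \<in> Basis" by (meson SOME_Basis)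
  have ne: "norm e = 1" using e by simp
  define a where "a = (\<bar>B\<bar> + 2) *\<^sub>R e"
  have na: "norm a = \<bar>B\<bar> + 2" using ne by (simp add: a_def)
  define \<Psi> where "\<Psi> = (\<lambda>x. a + x)"
  define \<Psi>i where "\<Psi>i = (\<lambda>x. - a + x)"
  have "homeo_pair \<Psi> \<Psi>i"
    unfolding homeo_pair_def \<Psi>_def \<Psi>i_def
    by (intro conjI allI continuous_intros smooth_on_open_add smooth_on_open_const smooth_on_open_id) auto
  moreover have img: "\<Psi> ` cball 0 1 = cball a 1"
    unfolding \<Psi>_def using cball_translation[of a 0 1] by simp
  have "valid_task \<Psi> e (1/2) (- cball a 1)"
    unfolding valid_task_def img
  proof (intro conjI)
    show "connected (- cball a 1)" using connected_complement_bounded_convex[of "cball a 1"] dim by simp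
    show "\<Psi> ` sector e (1/2) (1 + 1/2) \<subseteq> - cball a 1"
      by (auto simp: \<Psi>_def sector_def dist_norm)
  qed (auto simp: ne)
  moreover have "C \<subseteq> - cball a 1"
  proof
    fix c assume "c \<in> C"
    then have "norm c \<le> B" by (rule B)
    then have "1 < dist a c" using na norm_triangle_ineq2[of a c] by (simp add: dist_norm) 
    then show "c \<in> - cball a 1" by simp
  qed
  ultimately have "state C \<Psi> \<Psi>i {(e, 1/2, - cball a 1)}" by (simp add: state_def)
  then show ?thesis by blast
qed

lemma state_sequence:
  fixes C :: "'a::euclidean_space set"
  assumes dim: "3 \<le> DIM('a)" and C: "compact C" "totally_disconnected C"
  obtains \<Psi> \<Psi>i :: "nat \<Rightarrow> 'a \<Rightarrow> 'a" and T where
    "\<And>k. state C (\<Psi> k) (\<Psi>i k) (T k)"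
    "\<And>k. refines ((1/2) ^ k) (\<Psi> k) (T k) (\<Psi> (Suc k)) (T (Suc k))"
    "\<And>k. fine_tasks C (\<Psi> k) (T k) (1 / Suc k)"
proof -
  define good where "good k S \<longleftrightarrow> state C (fst S) (fst (snd S)) (snd (snd S)) \<and> fine_tasks C (fst S) (snd (snd S)) (1 / Suc k)"
    for k :: nat and S :: "('a \<Rightarrow> 'a) \<times> ('a \<Rightarrow> 'a) \<times> 'a task set"
  obtain \<Psi>0 \<Psi>i0 T0 where "state C \<Psi>0 \<Psi>i0 T0" using initial_state[OF dim C(1)] by blast
  then have "\<exists>S. good 0 S"
    using next_state[OF dim C, of 1 \<Psi>0 \<Psi>i0 T0 1] by (fastforce simp: good_def)
  moreover have "\<exists>S'. good (Suc k) S' \<and> refines ((1/2) ^ k) (fst S) (snd (snd S)) (fst S') (snd (snd S'))" if "good k S" for k S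
    using next_state[OF dim C, of "1 / Suc (Suc k)" "fst S" "fst (snd S)" "snd (snd S)" "(1/2) ^ k"] that
    by (fastforce simp: good_def)
  ultimately obtain S where S: "\<And>k. good k (S k)"
    "\<And>k. refines ((1/2) ^ k) (fst (S k)) (snd (snd (S k))) (fst (S (Suc k))) (snd (snd (S (Suc k))))"
    using dependent_nat_choice[of good "\<lambda>k S S'. refines ((1/2) ^ k) (fst S) (snd (snd S)) (fst S') (snd (snd S'))"] by metis
  show ?thesis
    by (rule that[of "\<lambda>k. fst (S k)" "\<lambda>k. fst (snd (S k))" "\<lambda>k. snd (snd (S k))"]) (use S in \<open>auto simp: good_def\<close>)
qed

section \<open>The ternary Cantor set\<close>

lemma ternary_cantor_bounds:
  assumes "x \<in> ternary_cantor_set"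
  shows "0 \<le> x" "x \<le> 1"
proof -
  obtain a :: "nat \<Rightarrow> real" where a: "\<forall>k. a k \<in> {0, 2}" "(\<lambda>k. a k / 3 ^ Suc k) sums x"
    using assms by (auto simp: ternary_cantor_set_def)
  have a02: "0 \<le> a k" "a k \<le> 2" for k using a(1)[rule_format, of k] by auto
  have "(\<lambda>k. 2 / 3 * (1 / 3) ^ k) sums (2 / 3 * (1 / (1 - 1 / 3 :: real)))"
    by (intro sums_mult geometric_sums) simp
  then have s1: "(\<lambda>k. 2 / 3 ^ Suc k :: real) sums 1" by (simp add: power_one_over)
  have "a k / 3 ^ Suc k \<le> 2 / 3 ^ Suc k" for k using a02 by (intro divide_right_mono) auto
  then show "x \<le> 1" using sums_le[OF _ a(2) s1] by blast
  show "0 \<le> x" using sums_le[OF _ sums_zero a(2)] a02 by (simp add: divide_nonneg_nonneg)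
qed

text \<open>Splitting off the first digit.\<close>

lemma ternary_cantor_step:
  assumes "x \<in> ternary_cantor_set"
  obtains d y where "d \<in> {0, 2}" "y \<in> ternary_cantor_set" "x = (d + y) / 3"
proof -
  obtain a :: "nat \<Rightarrow> real" where a: "\<forall>k. a k \<in> {0, 2}" "(\<lambda>k. a k / 3 ^ Suc k) sums x"
    using assms by (auto simp: ternary_cantor_set_def)
  have "(\<lambda>k. a (Suc k) / 3 ^ Suc (Suc k)) sums (x - a 0 / 3 ^ Suc 0)"
    using a(2) by (subst sums_Suc_iff) simp
  then have "(\<lambda>k. 3 * (a (Suc k) / 3 ^ Suc (Suc k))) sums (3 * (x - a 0 / 3 ^ Suc 0))" by (rule sums_mult)
  then have "(\<lambda>k. a (Suc k) / 3 ^ Suc k) sums (3 * x - a 0)" by (simp add: algebra_simps)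
  then have "3 * x - a 0 \<in> ternary_cantor_set"
    using a(1) unfolding ternary_cantor_set_def by (intro CollectI exI[of _ "\<lambda>k. a (Suc k)"]) auto
  then show ?thesis using that[of "a 0" "3 * x - a 0"] a(1) by simp
qed

text \<open>The closure inherits the possibility of splitting off a digit, since only two digits compete and the
  two images of the closure are compact. Iterating this expands every point of the closure into digits.\<close>

lemma compact_ternary_cantor_set: "compact ternary_cantor_set"
proof -
  let ?T = ternary_cantor_set
  have bT: "?T \<subseteq> {0..1}" using ternary_cantor_bounds by auto
  then have cl01: "closure ?T \<subseteq> {0..1}" by (rule closure_minimal) simp
  have cT: "compact (closure ?T)"
    by (metis cl01 bounded_closed_interval bounded_subset closed_closure compact_eq_bounded_closed)
  have step: "\<exists>d\<in>{0, 2}. \<exists>y\<in>closure ?T. x = (d + y) / 3" if "x \<in> closure ?T" for x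
  proof -
    have "compact ((\<lambda>y. (d + y) / 3) ` closure ?T)" for d :: real
      by (intro compact_continuous_image continuous_intros cT) auto
    then have "closed ((\<lambda>y. (0 + y) / 3) ` closure ?T \<union> (\<lambda>y. (2 + y) / 3) ` closure ?T)"
      by (intro closed_Un compact_imp_closed)
    moreover have "?T \<subseteq> (\<lambda>y. (0 + y) / 3) ` closure ?T \<union> (\<lambda>y. (2 + y) / 3) ` closure ?T"
    proof
      fix x assume "x \<in> ?T"
      then obtain d y where "d \<in> {0, 2}" "y \<in> ?T" "x = (d + y) / 3" using ternary_cantor_step by metis
      then show "x \<in> (\<lambda>y. (0 + y) / 3) ` closure ?T \<union> (\<lambda>y. (2 + y) / 3) ` closure ?T"
        using closure_subset[of ?T] by auto
    qed
    ultimately have "closure ?T \<subseteq> (\<lambda>y. (0 + y) / 3) ` closure ?T \<union> (\<lambda>y. (2 + y) / 3) ` closure ?T"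
      by (rule closure_minimal[rotated])
    then show ?thesis using that by blast
  qed
  have "closure ?T \<subseteq> ?T"
  proof
    fix x assume x: "x \<in> closure ?T"
    obtain D Y where DY: "\<And>x. x \<in> closure ?T \<Longrightarrow> D x \<in> {0, 2} \<and> Y x \<in> closure ?T \<and> x = (D x + Y x) / 3"
      using step by metis
    define z where "z k = (Y ^^ k) x" for k
    have z: "z k \<in> closure ?T" for k by (induction k) (use x DY in \<open>auto simp: z_def\<close>)
    have zS: "z k = (D (z k) + z (Suc k)) / 3" for k using DY[OF z[of k]] by (simp add: z_def)
    have part: "(\<Sum>k<n. D (z k) / 3 ^ Suc k) = x - z n / 3 ^ n" for n
    proof (induction n)
      case (Suc n)
      then show ?case using zS[of n] by (simp add: field_simps)
    qed (simp add: z_def)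
    have z01: "z n \<in> {0..1}" for n using z cl01 by blast
    have "(\<lambda>n. z n * (1 / 3) ^ n) \<longlonglongrightarrow> 0"
    proof (rule Lim_null_comparison)
      show "\<forall>\<^sub>F n in sequentially. norm (z n * (1 / 3) ^ n) \<le> (1 / 3) ^ n"
        using z01 by (intro always_eventually allI) (auto simp: abs_mult intro!: mult_left_le_one_le)
      show "(\<lambda>n. (1 / 3 :: real) ^ n) \<longlonglongrightarrow> 0" by (rule LIMSEQ_realpow_zero) auto
    qed
    then have "(\<lambda>n. x - z n / 3 ^ n) \<longlonglongrightarrow> x - 0"
      by (intro tendsto_diff tendsto_const) (simp add: power_one_over)
    then have "(\<lambda>k. D (z k) / 3 ^ Suc k) sums x" unfolding sums_def part by simp
    then show "x \<in> ?T" using DY[OF z] unfolding ternary_cantor_set_def by (intro CollectI exI[of _ "\<lambda>k. D (z k)"]) auto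
  qed
  then have "closure ?T = ?T" using closure_subset by blast
  then show ?thesis using cT by simp
qed

text \<open>A connected subset lies on one side of the middle gap, so tripling maps it to a connected subset again.
  All these subsets have diameter at most one.\<close>

lemma totally_disconnected_ternary_cantor_set: "totally_disconnected ternary_cantor_set"
proof -
  let ?T = ternary_cantor_set
  have small: "\<bar>x - y\<bar> \<le> (1 / 3) ^ n" if "Y \<subseteq> ?T" "connected Y" "x \<in> Y" "y \<in> Y" for n Y x y
    using that
  proof (induction n arbitrary: Y x y)
    case 0
    have "x \<in> ?T" "y \<in> ?T" using 0 by auto
    then show ?case using ternary_cantor_bounds[of x] ternary_cantor_bounds[of y] by auto
  next
    case (Suc n)
    have dich: "x \<le> 1 / 3 \<and> 3 * x \<in> ?T \<or> 2 / 3 \<le> x \<and> 3 * x - 2 \<in> ?T" if x: "x \<in> ?T" for x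
    proof -
      obtain d y where dy: "d \<in> {0, 2}" "y \<in> ?T" "x = (d + y) / 3" using ternary_cantor_step[OF x] by metis
      have y: "0 \<le> y" "y \<le> 1" using ternary_cantor_bounds[OF dy(2)] by auto
      consider "d = 0" | "d = 2" using dy(1) by blast
      then show ?thesis
      proof cases
        case 1
        then have "3 * x = y" using dy(3) by simp
        moreover have "x \<le> 1 / 3" using 1 dy(3) y by simp
        ultimately show ?thesis using dy(2) by simp
      next
        case 2
        then have "3 * x - 2 = y" using dy(3) by simp
        moreover have "2 / 3 \<le> x" using 2 dy(3) y by simp
        ultimately show ?thesis using dy(2) by metis
      qed
    qed
    have "{..1/3} \<inter> Y = {} \<or> {2/3..} \<inter> Y = {}"
    proof (rule connected_closedD[OF Suc.prems(2)])
      show "Y \<subseteq> {..1/3} \<union> {2/3..}" using dich Suc.prems(1) by (meson UnI1 UnI2 atLeast_iff atMost_iff subset_iff)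
    qed auto
    then obtain d where "(\<lambda>x. 3 * x - d) ` Y \<subseteq> ?T"
    proof
      assume "{..1/3} \<inter> Y = {}"
      then have "(\<lambda>x. 3 * x - 2) ` Y \<subseteq> ?T" using dich Suc.prems(1) by fastforce
      then show ?thesis by (rule that)
    next
      assume "{2/3..} \<inter> Y = {}"
      then have "(\<lambda>x. 3 * x - 0) ` Y \<subseteq> ?T" using dich Suc.prems(1) by fastforce
      then show ?thesis by (rule that)
    qed
    moreover have "connected ((\<lambda>x. 3 * x - d) ` Y)"
      by (intro connected_continuous_image continuous_intros Suc.prems)
    ultimately have "\<bar>(3 * x - d) - (3 * y - d)\<bar> \<le> (1 / 3) ^ n"
      using Suc.prems by (intro Suc.IH[of "(\<lambda>x. 3 * x - d) ` Y"]) auto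
    then show ?case by (simp add: abs_if split: if_splits)
  qed
  have "x = y" if Y: "Y \<subseteq> ?T" "connected Y" "x \<in> Y" "y \<in> Y" for Y x y
  proof -
    have "(\<lambda>n. (1 / 3 :: real) ^ n) \<longlonglongrightarrow> 0" by (rule LIMSEQ_realpow_zero) auto
    then have "\<bar>x - y\<bar> \<le> 0"
      by (rule LIMSEQ_le_const) (use small[OF Y] in auto)
    then show ?thesis by simp
  qed
  then show ?thesis unfolding totally_disconnected_def by (metis insertI1 subsetI empty_subsetI singletonI subset_singleton_iff)
qed

lemma cantor_set_compact_totally_disconnected:
  assumes "cantor_set C"
  shows "compact C" "totally_disconnected C"
proof -
  have h: "C homeomorphic ternary_cantor_set" using assms by (simp add: cantor_set_def)
  show "compact C" using homeomorphic_compactness[OF h] compact_ternary_cantor_set by simp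
  obtain p q where pq: "homeomorphism C ternary_cantor_set p q" using h by (auto simp: homeomorphic_def)
  show "totally_disconnected C"
    unfolding totally_disconnected_def
  proof (intro allI impI)
    fix Y assume Y: "Y \<subseteq> C" "connected Y"
    have "connected (p ` Y)" "p ` Y \<subseteq> ternary_cantor_set"
      using pq Y by (auto simp: homeomorphism_def intro!: connected_continuous_image intro: continuous_on_subset)
    then obtain a where "p ` Y \<subseteq> {a}"
      using totally_disconnected_ternary_cantor_set unfolding totally_disconnected_def by blast
    moreover have "q (p y) = y" if "y \<in> Y" for y using pq Y that by (auto simp: homeomorphism_def)
    ultimately have "Y \<subseteq> {q a}" by force
    then show "\<exists>a. Y \<subseteq> {a}" by blast
  qed
qed

section \<open>The limit embedding\<close>

text \<open>Uniform integrability from the elementary bound \<open>t \<le> l + t\<^sup>n / l\<close> for \<open>l \<ge> 1\<close>: the second term is small for large \<open>l\<close>, and then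
  the first one is small on sets of small measure.\<close>

lemma set_integral_small_of_Ln_bounded:
  assumes n: "2 \<le> n" and A: "\<And>k. A k \<in> sets M" and A0: "(\<lambda>k. emeasure M (A k)) \<longlonglongrightarrow> 0"
    and g: "\<And>k. g k \<in> borel_measurable M" "\<And>k x. 0 \<le> g k x" and E: "0 \<le> E"
    and bd: "\<And>k. (\<integral>\<^sup>+x. ennreal (g k x ^ n) \<partial>M) \<le> ennreal E"
  shows "(\<lambda>k. \<integral>\<^sup>+x. indicator (A k) x * ennreal (g k x) \<partial>M) \<longlonglongrightarrow> 0"
proof -
  have "\<forall>\<^sub>F k in sequentially. (\<integral>\<^sup>+x. indicator (A k) x * ennreal (g k x) \<partial>M) < e" if e: "0 < e" for e
  proof -
    obtain \<eta> :: real where \<eta>: "0 < \<eta>" "ennreal \<eta> < e"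
    proof (cases e rule: ennreal_cases)
      case (real r)
      then have "0 < r" using e by simp
      then have "0 < r / 2" "ennreal (r / 2) < e" using real by (auto simp: ennreal_less_iff)
      then show ?thesis by (rule that)
    next
      case top
      then show ?thesis using that[of 1] by simp
    qed
    define l where "l = 2 * E / \<eta> + 1"
    have l: "1 \<le> l" "E / l \<le> \<eta> / 2" using \<eta> E by (auto simp: l_def field_simps)
    have pt: "t \<le> l + t ^ n / l" if "0 \<le> t" for t
    proof (cases "t \<le> l")
      case True
      have "0 \<le> t ^ n / l" using that l by simp
      then show ?thesis using True by linarith
    next
      case False
      have "l * t \<le> t * t" using False that by (intro mult_right_mono) auto
      also have "\<dots> = t ^ 2" by (simp add: power2_eq_square)
      also have "\<dots> \<le> t ^ n" using False l n by (intro power_increasing) auto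
      finally have "t \<le> t ^ n / l" using l by (simp add: field_simps)
      then show ?thesis using l by linarith
    qed
    have le: "(\<integral>\<^sup>+x. indicator (A k) x * ennreal (g k x) \<partial>M) \<le> ennreal l * emeasure M (A k) + ennreal (\<eta> / 2)" for k
    proof -
      have "(\<integral>\<^sup>+x. indicator (A k) x * ennreal (g k x) \<partial>M)
        \<le> (\<integral>\<^sup>+x. ennreal l * indicator (A k) x + ennreal (1 / l) * ennreal (g k x ^ n) \<partial>M)"
      proof (rule nn_integral_mono)
        fix x
        have "ennreal (g k x) \<le> ennreal (l + g k x ^ n / l)" using pt[OF g(2)] by (rule ennreal_leI)
        also have "\<dots> = ennreal l + ennreal (1 / l) * ennreal (g k x ^ n)"
          using l g(2)[of k x] by (simp add: ennreal_plus flip: ennreal_mult)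
        finally show "indicator (A k) x * ennreal (g k x) \<le> ennreal l * indicator (A k) x + ennreal (1 / l) * ennreal (g k x ^ n)"
          by (auto simp: indicator_def)
      qed
      also have "\<dots> = ennreal l * emeasure M (A k) + ennreal (1 / l) * (\<integral>\<^sup>+x. ennreal (g k x ^ n) \<partial>M)"
      proof -
        have m1: "(\<lambda>x. ennreal l * indicator (A k) x) \<in> borel_measurable M" using A[of k] by measurable
        have m2: "(\<lambda>x. ennreal (g k x ^ n)) \<in> borel_measurable M" using g(1)[of k] by measurable
        show ?thesis
          using nn_integral_add[OF m1 borel_measurable_times_ennreal[OF borel_measurable_const m2], of "ennreal (1 / l)"]
          by (simp add: nn_integral_cmult[OF m2] nn_integral_cmult_indicator[OF A])
      qed
      also have "\<dots> \<le> ennreal l * emeasure M (A k) + ennreal (1 / l) * ennreal E"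
        using bd by (intro add_left_mono mult_left_mono) auto
      also have "ennreal (1 / l) * ennreal E \<le> ennreal (\<eta> / 2)"
        using l E by (simp add: ennreal_leI flip: ennreal_mult)
      finally show ?thesis by (simp add: add_left_mono)
    qed
    have "(\<lambda>k. ennreal l * emeasure M (A k)) \<longlonglongrightarrow> ennreal l * 0"
      by (intro ennreal_tendsto_cmult A0) simp
    then have "\<forall>\<^sub>F k in sequentially. ennreal l * emeasure M (A k) < ennreal (\<eta> / 2)"
      by (rule order_tendstoD(2)) (use \<eta> in simp)
    then show ?thesis
    proof (eventually_elim)
      case (elim k)
      have "(\<integral>\<^sup>+x. indicator (A k) x * ennreal (g k x) \<partial>M) \<le> ennreal (\<eta> / 2) + ennreal (\<eta> / 2)"
        using le[of k] elim by (meson add_right_mono less_imp_le order_trans)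
      also have "\<dots> = ennreal \<eta>" using \<eta> by (simp flip: ennreal_plus)
      finally show ?case using \<eta>(2) by (rule le_less_trans)
    qed
  qed
  then show ?thesis by (intro order_tendstoI) auto
qed

lemma measurable_norm_comp:
  fixes f :: "'b \<Rightarrow> 'a::euclidean_space"
  shows "f \<in> borel_measurable M \<Longrightarrow> (\<lambda>x. norm (f x)) \<in> borel_measurable M"
  by measurable

locale finger_sequence =
  fixes C :: "'a::euclidean_space set" and \<Psi> \<Psi>i :: "nat \<Rightarrow> 'a \<Rightarrow> 'a" and T :: "nat \<Rightarrow> 'a task set"
  assumes dim: "3 \<le> DIM('a)" and C: "compact C"
    and st: "\<And>k. state C (\<Psi> k) (\<Psi>i k) (T k)"
    and ref: "\<And>k. refines ((1/2) ^ k) (\<Psi> k) (T k) (\<Psi> (Suc k)) (T (Suc k))"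
    and fine: "\<And>k. fine_tasks C (\<Psi> k) (T k) (1 / Suc k)"
begin

definition eps :: "nat \<Rightarrow> real" where "eps k = 1 / Suc k"

lemma eps: "0 < eps k" "eps k \<le> 1"
  by (auto simp: eps_def divide_le_eq)

lemma eps_tendsto_0: "eps \<longlonglongrightarrow> 0"
  unfolding eps_def[abs_def] using LIMSEQ_inverse_real_of_nat by (simp add: inverse_eq_divide)

definition caps :: "nat \<Rightarrow> 'a set" where "caps k = (\<Union>\<tau>\<in>T k. cap \<tau>)"

lemma closed_caps: "closed (caps k)"
  unfolding caps_def using st[of k] by (intro closed_UN) (auto simp: state_def)

lemma refines_le: "k \<le> l \<Longrightarrow> refines (\<Sum>i=k..<l. (1/2) ^ i) (\<Psi> k) (T k) (\<Psi> l) (T l)"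
proof (induction l rule: dec_induct)
  case base
  show ?case by (rule refines_same) auto
next
  case (step l)
  show ?case
    using refines_trans[OF st step.IH ref[of l]] step.hyps by (simp add: sum_nonneg)
qed

lemma homeo: "homeo_pair (\<Psi> k) (\<Psi>i k)"
  using st by (simp add: state_def)

lemma \<Psi>_smooth: "smooth_on_open (\<Psi> k) (- {0})"
  using homeo by (simp add: homeo_pair_def)

lemma \<Psi>_inj: "\<Psi> k x = \<Psi> k y \<longleftrightarrow> x = y"
  using homeo[of k] unfolding homeo_pair_def by metis

lemma \<Psi>_cont: "continuous_on A (\<Psi> k)"
  using homeo[of k] continuous_on_subset unfolding homeo_pair_def by blast

lemma caps_decreasing: "k \<le> l \<Longrightarrow> caps l \<subseteq> caps k"
  using refines_le[of k l] unfolding refines_def caps_def by blast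

lemma agree_off_caps:
  assumes "k \<le> l"
  obtains V where "open V" "sphere 0 1 - caps k \<subseteq> V" "\<And>x. x \<in> V \<Longrightarrow> \<Psi> l x = \<Psi> k x"
  using refines_le[OF assms] unfolding refines_def caps_def by blast

lemma image_cap:
  assumes "k \<le> l" "\<tau> \<in> T k" "x \<in> sphere 0 1" "x \<in> cap \<tau>"
  shows "\<Psi> l x \<in> reg \<tau> \<union> \<Psi> k ` (sphere 0 1 \<inter> cap \<tau>)"
  using refines_le[OF assms(1)] assms(2-) unfolding refines_def by blast

lemma task:
  assumes "\<tau> \<in> T k"
  shows "norm (tip \<tau>) = 1" "0 < rad \<tau>" "open (reg \<tau>)" "reg \<tau> \<inter> \<Psi> k ` cball 0 1 = {}" "reg \<tau> \<inter> C \<noteq> {}"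
    "2 * rad \<tau> \<le> eps k" "real (card (T k)) * (2 * rad \<tau>) powr eps k \<le> eps k"
  using st[of k] fine[of k] assms unfolding state_def valid_task_def fine_tasks_def eps_def by auto

lemma task_close:
  assumes "\<tau> \<in> T k" "c \<in> reg \<tau>" "y \<in> reg \<tau> \<union> \<Psi> k ` (sphere 0 1 \<inter> cap \<tau>)"
  shows "dist y c \<le> 4 * eps k"
  using fine[of k] assms unfolding fine_tasks_def eps_def by blast

lemma finite_T: "finite (T k)"
  using st[of k] by (simp add: state_def)

lemma C_regions: "c \<in> C \<Longrightarrow> \<exists>\<tau>\<in>T k. c \<in> reg \<tau>"
  using st[of k] by (auto simp: state_def)

lemma regions_disjoint: "\<tau> \<in> T k \<Longrightarrow> \<tau>' \<in> T k \<Longrightarrow> \<tau> \<noteq> \<tau>' \<Longrightarrow> reg \<tau> \<inter> reg \<tau>' = {}"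
  using st[of k] by (simp add: state_def)

text \<open>Off the caps the two values agree. On a cap both lie in its region or its old image, hence within \<open>4 eps k\<close> of
  every point of the region.\<close>

lemma \<Psi>_Cauchy:
  assumes "k \<le> l" "x \<in> sphere 0 1"
  shows "dist (\<Psi> l x) (\<Psi> k x) \<le> 8 * eps k"
proof (cases "x \<in> caps k")
  case False
  then have "\<Psi> l x = \<Psi> k x" using agree_off_caps[OF assms(1)] assms(2) by (metis DiffI subsetD)
  then show ?thesis using eps(1)[of k] by simp
next
  case True
  then obtain \<tau> where \<tau>: "\<tau> \<in> T k" "x \<in> cap \<tau>" by (auto simp: caps_def)
  obtain c where c: "c \<in> reg \<tau>" using task(5)[OF \<tau>(1)] by blast
  have "dist (\<Psi> l x) c \<le> 4 * eps k" "dist (\<Psi> k x) c \<le> 4 * eps k"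
    using task_close[OF \<tau>(1) c] image_cap[OF assms(1) \<tau>(1) assms(2) \<tau>(2)] image_cap[OF order_refl \<tau>(1) assms(2) \<tau>(2)]
    by auto
  then show ?thesis using dist_triangle2[of "\<Psi> l x" "\<Psi> k x" c] by linarith
qed

definition f :: "'a \<Rightarrow> 'a" where "f x = lim (\<lambda>k. \<Psi> k x)"

lemma f_tendsto:
  assumes "x \<in> sphere 0 1"
  shows "(\<lambda>k. \<Psi> k x) \<longlonglongrightarrow> f x"
proof -
  have "Cauchy (\<lambda>k. \<Psi> k x)"
  proof (rule metric_CauchyI)
    fix e :: real assume "0 < e"
    then have "\<forall>\<^sub>F k in sequentially. 16 * eps k < e"
      using order_tendstoD(2)[OF tendsto_mult_left[OF eps_tendsto_0, of 16]] by simp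
    then obtain N where N: "16 * eps N < e" by (auto simp: eventually_sequentially)
    have "dist (\<Psi> m x) (\<Psi> n x) < e" if "N \<le> m" "N \<le> n" for m n
      using \<Psi>_Cauchy[OF that(1) assms] \<Psi>_Cauchy[OF that(2) assms] dist_triangle2[of "\<Psi> m x" "\<Psi> n x" "\<Psi> N x"] N
      by linarith
    then show "\<exists>N. \<forall>m\<ge>N. \<forall>n\<ge>N. dist (\<Psi> m x) (\<Psi> n x) < e" by blast
  qed
  then show ?thesis unfolding f_def by (simp add: Cauchy_convergent_iff convergent_LIMSEQ_iff)
qed

lemma f_close:
  assumes "x \<in> sphere 0 1"
  shows "dist (f x) (\<Psi> k x) \<le> 8 * eps k"
proof (rule tendsto_upperbound)
  show "(\<lambda>l. dist (\<Psi> l x) (\<Psi> k x)) \<longlonglongrightarrow> dist (f x) (\<Psi> k x)" by (intro tendsto_intros f_tendsto assms)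
  show "\<forall>\<^sub>F l in sequentially. dist (\<Psi> l x) (\<Psi> k x) \<le> 8 * eps k"
    using \<Psi>_Cauchy[OF _ assms] eventually_sequentially by blast
qed simp

lemma f_continuous: "continuous_on (sphere 0 1) f"
proof (rule uniform_limit_theorem)
  show "\<forall>\<^sub>F k in sequentially. continuous_on (sphere 0 1) (\<Psi> k)" using \<Psi>_cont by simp
  show "uniform_limit (sphere 0 1) \<Psi> f sequentially"
  proof (rule uniform_limitI)
    fix e :: real assume "0 < e"
    then have "\<forall>\<^sub>F k in sequentially. 8 * eps k < e"
      using order_tendstoD(2)[OF tendsto_mult_left[OF eps_tendsto_0, of 8]] by simp
    then show "\<forall>\<^sub>F k in sequentially. \<forall>x\<in>sphere 0 1. dist (\<Psi> k x) (f x) < e"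
      by eventually_elim (use f_close in \<open>fastforce simp: dist_commute intro: le_less_trans\<close>)
  qed
qed simp

lemma f_off_caps:
  assumes "x \<in> sphere 0 1" "x \<notin> caps k"
  shows "f x = \<Psi> k x"
proof (rule LIMSEQ_unique[OF f_tendsto[OF assms(1)]])
  have "\<Psi> l x = \<Psi> k x" if "k \<le> l" for l
    using agree_off_caps[OF that] assms by (metis DiffI subsetD)
  then show "(\<lambda>l. \<Psi> l x) \<longlonglongrightarrow> \<Psi> k x" by (intro tendsto_eventually eventually_sequentiallyI)
qed

definition K :: "'a set" where "K = {x \<in> sphere 0 1. \<forall>k. x \<in> caps k}"

lemma K_subset: "K \<subseteq> sphere 0 1"
  by (auto simp: K_def)

lemma K_cap:
  assumes "x \<in> K"
  shows "\<exists>\<tau>\<in>T k. x \<in> cap \<tau>"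
proof -
  have "x \<in> caps k" using assms by (simp add: K_def)
  then show ?thesis unfolding caps_def by blast
qed

lemma f_cap_close:
  assumes "\<tau> \<in> T k" "c \<in> reg \<tau>" "x \<in> sphere 0 1" "x \<in> cap \<tau>"
  shows "dist (f x) c \<le> 12 * eps k"
  using f_close[OF assms(3), of k] task_close[OF assms(1,2), of "\<Psi> k x"] assms(3,4)
    dist_triangle[of "f x" c "\<Psi> k x"] by auto

lemma in_closed_by_eps:
  assumes "closed X" "\<And>k. \<exists>y\<in>X. dist z y \<le> 12 * eps k"
  shows "z \<in> X"
proof -
  have "z \<in> closure X"
    unfolding closure_approachable
  proof (intro allI impI)
    fix e :: real assume "0 < e"
    then have "\<forall>\<^sub>F k in sequentially. 12 * eps k < e"
      using order_tendstoD(2)[OF tendsto_mult_left[OF eps_tendsto_0, of 12]] by simp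
    then obtain N where "12 * eps N < e" by (auto simp: eventually_sequentially)
    then show "\<exists>y\<in>X. dist y z < e" using assms(2)[of N] by (metis dist_commute le_less_trans)
  qed
  then show ?thesis using assms(1) by simp
qed

text \<open>Each region of the \<open>k\<close>-th stage contains a point of \<open>C\<close>, and \<open>f x\<close> is within \<open>12 eps k\<close> of it.\<close>

lemma f_K: "x \<in> K \<Longrightarrow> f x \<in> C"
proof (rule in_closed_by_eps)
  show "closed C" using C compact_imp_closed by blast
  fix k assume x: "x \<in> K"
  then obtain \<tau> where \<tau>: "\<tau> \<in> T k" "x \<in> cap \<tau>" using K_cap by metis
  obtain c where "c \<in> reg \<tau>" "c \<in> C" using task(5)[OF \<tau>(1)] by blast
  then show "\<exists>y\<in>C. dist (f x) y \<le> 12 * eps k" using f_cap_close[OF \<tau>(1) _ _ \<tau>(2)] x by (auto simp: K_def)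
qed

lemma f_not_K: "x \<in> sphere 0 1 \<Longrightarrow> x \<notin> K \<Longrightarrow> f x \<notin> C"
proof
  assume x: "x \<in> sphere 0 1" "x \<notin> K" "f x \<in> C"
  then obtain k where k: "x \<notin> caps k" by (auto simp: K_def)
  obtain \<tau> where \<tau>: "\<tau> \<in> T k" "f x \<in> reg \<tau>" using C_regions[OF x(3)] by blast
  have "f x \<in> \<Psi> k ` cball 0 1" using f_off_caps[OF x(1) k] x(1) by auto
  then show False using task(4)[OF \<tau>(1)] \<tau>(2) by blast
qed

lemma preimage_C: "sphere 0 1 \<inter> f -` C = K"
  using f_K f_not_K K_subset by blast

lemma C_subset: "C \<subseteq> f ` sphere 0 1"
proof
  fix c assume c: "c \<in> C"
  show "c \<in> f ` sphere 0 1"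
  proof (rule in_closed_by_eps)
    show "closed (f ` sphere 0 1)"
      by (intro compact_imp_closed compact_continuous_image f_continuous compact_sphere)
    fix k
    obtain \<tau> where \<tau>: "\<tau> \<in> T k" "c \<in> reg \<tau>" using C_regions[OF c] by blast
    have "dist (f (tip \<tau>)) c \<le> 12 * eps k"
      by (rule f_cap_close[OF \<tau>]) (use task[OF \<tau>(1)] in auto)
    then show "\<exists>y\<in>f ` sphere 0 1. dist c y \<le> 12 * eps k"
      using task(1)[OF \<tau>(1)] by (intro bexI[of _ "f (tip \<tau>)"]) (auto simp: dist_commute)
  qed
qed

text \<open>A priori \<open>f x\<close> only lies in the closure of the region and of the old image of the cap. Since it belongs to \<open>C\<close>, it lies
  in some region, and the other regions are open and disjoint from that set.\<close>

lemma f_in_own_region: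
  assumes x: "x \<in> K" and \<tau>: "\<tau> \<in> T k" "x \<in> cap \<tau>"
  shows "f x \<in> reg \<tau>"
proof -
  obtain \<nu> where \<nu>: "\<nu> \<in> T k" "f x \<in> reg \<nu>" using C_regions[OF f_K[OF x]] by blast
  have xS: "x \<in> sphere 0 1" using x by (simp add: K_def)
  have cl: "f x \<in> closure (reg \<tau> \<union> \<Psi> k ` (sphere 0 1 \<inter> cap \<tau>))"
  proof (rule Lim_in_closed_set[OF closed_closure _ _ f_tendsto[OF xS]])
    show "\<forall>\<^sub>F l in sequentially. \<Psi> l x \<in> closure (reg \<tau> \<union> \<Psi> k ` (sphere 0 1 \<inter> cap \<tau>))"
      by (rule eventually_sequentiallyI[of k], rule subsetD[OF closure_subset], rule image_cap[OF _ \<tau>(1) xS \<tau>(2)])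
  qed simp
  have "\<nu> = \<tau>"
  proof (rule ccontr)
    assume "\<nu> \<noteq> \<tau>"
    have "\<Psi> k ` (sphere 0 1 \<inter> cap \<tau>) \<subseteq> \<Psi> k ` cball 0 1" by auto
    then have "reg \<nu> \<inter> (reg \<tau> \<union> \<Psi> k ` (sphere 0 1 \<inter> cap \<tau>)) = {}"
      using regions_disjoint[OF \<nu>(1) \<tau>(1) \<open>\<nu> \<noteq> \<tau>\<close>] task(4)[OF \<nu>(1)] by blast
    then have "reg \<nu> \<inter> closure (reg \<tau> \<union> \<Psi> k ` (sphere 0 1 \<inter> cap \<tau>)) = {}"
      using task(3)[OF \<nu>(1)] open_Int_closure_eq_empty by blast
    then show False using cl \<nu>(2) by blast
  qed
  then show ?thesis using \<nu> by simp
qed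

lemma f_inj: "inj_on f (sphere 0 1)"
proof (rule inj_onI)
  fix x y :: 'a assume x: "x \<in> sphere 0 1" and y: "y \<in> sphere 0 1" and eq: "f x = f y"
  consider "x \<notin> K" "y \<notin> K" | "x \<in> K" "y \<in> K"
    using f_K f_not_K x y eq by metis
  then show "x = y"
  proof cases
    case 1
    then obtain k l where kl: "x \<notin> caps k" "y \<notin> caps l" using x y by (auto simp: K_def)
    then have "x \<notin> caps (max k l)" "y \<notin> caps (max k l)"
      using caps_decreasing[of k "max k l"] caps_decreasing[of l "max k l"] by auto
    then show ?thesis using eq f_off_caps x y \<Psi>_inj by metis
  next
    case 2
    have d: "dist x y \<le> eps k" for k
    proof -
      obtain \<tau> \<tau>' where \<tau>: "\<tau> \<in> T k" "x \<in> cap \<tau>" "\<tau>' \<in> T k" "y \<in> cap \<tau>'"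
        using K_cap[of x k] K_cap[of y k] 2 by metis
      have "f x \<in> reg \<tau> \<inter> reg \<tau>'"
        using f_in_own_region[OF 2(1) \<tau>(1,2)] f_in_own_region[OF 2(2) \<tau>(3,4)] eq by simp
      then have "\<tau> = \<tau>'" using regions_disjoint \<tau> by blast
      then have "dist x y \<le> 2 * rad \<tau>" using \<tau> dist_triangle2[of x y "tip \<tau>"] by (simp add: dist_commute)
      then show ?thesis using task(6)[OF \<tau>(1)] by linarith
    qed
    have "dist x y \<le> 0"
      by (rule LIMSEQ_le_const[OF eps_tendsto_0]) (use d in auto)
    then show ?thesis by simp
  qed
qed

lemma f_homeomorphism: "\<exists>g. homeomorphism (sphere 0 1) (f ` sphere 0 1) f g"
  using homeomorphism_compact[OF compact_sphere f_continuous refl f_inj] by blast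

lemma K_homeomorphic_C: "K homeomorphic C"
proof -
  have KS: "K \<subseteq> sphere 0 1" by (auto simp: K_def)
  have fK: "f ` K = C" using preimage_C C_subset by blast
  have "closed (sphere (0::'a) 1 \<inter> (\<Inter>k. caps k))" using closed_caps by (intro closed_Int closed_INT) auto
  moreover have "sphere 0 1 \<inter> (\<Inter>k. caps k) = K" by (auto simp: K_def)
  ultimately have "compact K" using KS by (metis bounded_sphere bounded_subset compact_eq_bounded_closed)
  then obtain g where "homeomorphism K C f g"
    using homeomorphism_compact[of K f C] f_continuous KS fK f_inj by (metis continuous_on_subset inj_on_subset)
  then show ?thesis by (auto simp: homeomorphic_def)
qed

lemma sum_rad_powr_le: "(\<Sum>\<tau>\<in>T k. (2 * rad \<tau>) powr eps k) \<le> eps k"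
proof (cases "T k = {}")
  case False
  then have c: "0 < real (card (T k))" using finite_T by (simp add: card_gt_0_iff)
  have "(2 * rad \<tau>) powr eps k \<le> eps k / card (T k)" if "\<tau> \<in> T k" for \<tau>
    using task(7)[OF that] c by (simp add: field_simps)
  then have "(\<Sum>\<tau>\<in>T k. (2 * rad \<tau>) powr eps k) \<le> (\<Sum>\<tau>\<in>T k. eps k / card (T k))" by (rule sum_mono)
  then show ?thesis using c by simp
qed (use eps(1)[of k] in simp)

lemma rad_powr_mono:
  assumes "\<tau> \<in> T k" "eps k \<le> s"
  shows "(2 * rad \<tau>) powr s \<le> (2 * rad \<tau>) powr eps k"
  using task(2,6)[OF assms(1)] eps(2)[of k] assms(2) by (intro powr_mono') auto

text \<open>The caps of the \<open>k\<close>-th stage cover \<open>K\<close>.\<close>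

lemma hausdorff_content_K_le:
  assumes "eps k \<le> \<delta>" "eps k \<le> s" "0 < s"
  shows "hausdorff_content \<delta> s K \<le> ennreal (eps k)"
proof -
  obtain e where e: "bij_betw e {..<card (T k)} (T k)"
    using ex_bij_betw_nat_finite[OF finite_T] by (auto simp: atLeast0LessThan)
  define U where "U i = (if i < card (T k) then cap (e i) else {})" for i
  have eT: "e i \<in> T k" if "i < card (T k)" for i using e that by (auto simp: bij_betw_def)
  have diam: "diameter (cap \<tau>) \<le> 2 * rad \<tau>" if "\<tau> \<in> T k" for \<tau>
    using task(2)[OF that] by (simp add: diameter_cball)
  have cover: "U \<in> {U. K \<subseteq> (\<Union>i. U i) \<and> (\<forall>i. bounded (U i) \<and> diameter (U i) \<le> \<delta>)}"
  proof (intro CollectI conjI allI)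
    show "K \<subseteq> (\<Union>i. U i)"
    proof
      fix x assume "x \<in> K"
      then obtain \<tau> where "\<tau> \<in> T k" "x \<in> cap \<tau>" using K_cap by metis
      then have "\<tau> \<in> e ` {..<card (T k)}" using e by (simp add: bij_betw_def)
      then obtain i where "i < card (T k)" "e i = \<tau>" by auto
      then show "x \<in> (\<Union>i. U i)" using \<open>x \<in> cap \<tau>\<close> by (intro UN_I[of i]) (auto simp: U_def)
    qed
    show "bounded (U i)" for i by (simp add: U_def)
    show "diameter (U i) \<le> \<delta>" for i
      using diam[OF eT, of i] task(6)[OF eT, of i] assms eps(1)[of k] by (auto simp: U_def)
  qed
  have le: "diameter (U i) powr s \<le> (2 * rad (e i)) powr eps k" if "i < card (T k)" for i
  proof -
    have "diameter (U i) powr s \<le> (2 * rad (e i)) powr s"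
      using diam[OF eT[OF that]] that assms diameter_ge_0 by (intro powr_mono2) (auto simp: U_def)
    also have "\<dots> \<le> (2 * rad (e i)) powr eps k" by (rule rad_powr_mono[OF eT[OF that] assms(2)])
    finally show ?thesis .
  qed
  have "hausdorff_content \<delta> s K \<le> (\<Sum>i. ennreal (diameter (U i) powr s))"
    unfolding hausdorff_content_def by (rule INF_lower[OF cover])
  also have "\<dots> = (\<Sum>i<card (T k). ennreal (diameter (U i) powr s))"
    by (rule suminf_finite) (auto simp: U_def)
  also have "\<dots> \<le> (\<Sum>i<card (T k). ennreal ((2 * rad (e i)) powr eps k))"
    using le by (intro sum_mono ennreal_leI) auto
  also have "\<dots> = (\<Sum>\<tau>\<in>T k. ennreal ((2 * rad \<tau>) powr eps k))"
    by (rule sum.reindex_bij_betw[OF e])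
  also have "\<dots> = ennreal (\<Sum>\<tau>\<in>T k. (2 * rad \<tau>) powr eps k)" by (simp add: sum_ennreal)
  also have "\<dots> \<le> ennreal (eps k)" using sum_rad_powr_le by (rule ennreal_leI)
  finally show ?thesis .
qed

lemma hausdorff_dim_K: "hausdorff_dim K = 0"
proof -
  have cont: "hausdorff_content \<delta> s K = 0" if "0 < \<delta>" "0 < s" for \<delta> s
  proof -
    have "\<forall>\<^sub>F k in sequentially. eps k \<le> min \<delta> s"
      using order_tendstoD(2)[OF eps_tendsto_0, of "min \<delta> s"] that by (auto elim: eventually_mono)
    then have "\<forall>\<^sub>F k in sequentially. hausdorff_content \<delta> s K \<le> ennreal (eps k)"
      by eventually_elim (use hausdorff_content_K_le that in auto)
    moreover have "(\<lambda>k. ennreal (eps k)) \<longlonglongrightarrow> ennreal 0" by (intro tendsto_ennrealI eps_tendsto_0)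
    ultimately have "hausdorff_content \<delta> s K \<le> ennreal 0"
      by (intro tendsto_lowerbound[of "\<lambda>k. ennreal (eps k)" _ sequentially]) auto
    then show ?thesis by simp
  qed
  have "hausdorff_outer_measure s K = 0" if "0 < s" for s
    unfolding hausdorff_outer_measure_def using cont[OF _ that] by (auto intro!: antisym SUP_least)
  then have "hausdorff_dim K \<le> ennreal (eps k)" for k
    unfolding hausdorff_dim_def using eps(1)[of k] by (intro INF_lower) auto
  moreover have "(\<lambda>k. ennreal (eps k)) \<longlonglongrightarrow> ennreal 0" by (intro tendsto_ennrealI eps_tendsto_0)
  ultimately have "hausdorff_dim K \<le> ennreal 0"
    by (intro tendsto_lowerbound[of "\<lambda>k. ennreal (eps k)" _ sequentially]) auto
  then show ?thesis by simp
qed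

text \<open>Near a point off \<open>K\<close> the map \<open>f\<close> coincides with some \<open>\<Psi> k\<close> and, because the image of the caps is closed, its
  inverse coincides with the inverse of \<open>\<Psi> k\<close>.\<close>

lemma f_diffeomorphism: "diffeomorphism_onto_image f (sphere 0 1 - f -` C)"
proof -
  have off: "sphere 0 1 - f -` C = sphere 0 1 - K" using preimage_C by blast
  obtain g where g: "homeomorphism (sphere 0 1) (f ` sphere 0 1) f g" using f_homeomorphism by blast
  then have gf: "g (f x) = x" if "x \<in> sphere 0 1" for x using that by (simp add: homeomorphism_def)
  have "smooth_on f (sphere 0 1 - K)"
    unfolding smooth_on_def
  proof
    fix x :: 'a assume x: "x \<in> sphere 0 1 - K"
    then obtain k where k: "x \<notin> caps k" by (auto simp: K_def)
    have x0: "x \<noteq> 0" using x by auto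
    have "open (- caps k - {0})" using closed_caps[of k] by (intro open_Diff) (auto simp: open_Compl)
    then have "smooth_on_open (\<Psi> k) (- caps k - {0})" by (rule smooth_on_open_subset[OF \<Psi>_smooth]) auto
    then show "\<exists>U F. x \<in> U \<and> smooth_on_open F U \<and> (\<forall>y\<in>(sphere 0 1 - K) \<inter> U. F y = f y)"
      using k x0 f_off_caps by (intro exI[of _ "- caps k - {0}"] exI[of _ "\<Psi> k"]) auto
  qed
  moreover have "smooth_on g (f ` (sphere 0 1 - K))"
    unfolding smooth_on_def
  proof
    fix z assume "z \<in> f ` (sphere 0 1 - K)"
    then obtain x where x: "x \<in> sphere 0 1" "x \<notin> K" "z = f x" by blast
    then obtain k where k: "x \<notin> caps k" by (auto simp: K_def)
    define U where "U = - f ` (sphere 0 1 \<inter> caps k) - {\<Psi> k 0}"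
    have "compact (f ` (sphere 0 1 \<inter> caps k))"
      using closed_caps by (intro compact_continuous_image continuous_on_subset[OF f_continuous] compact_Int_closed) auto
    then have "open U" unfolding U_def by (intro open_Diff) (auto simp: compact_imp_closed open_Compl)
    have "smooth_on_open (\<Psi>i k) (- {\<Psi> k 0})" using homeo by (simp add: homeo_pair_def)
    then have "smooth_on_open (\<Psi>i k) U" by (rule smooth_on_open_subset[OF _ \<open>open U\<close>]) (auto simp: U_def)
    moreover have "z \<in> U"
    proof -
      have "x = y" if "y \<in> sphere 0 1" "f x = f y" for y using f_inj x that by (auto dest: inj_onD)
      note inj = this
      have "z \<notin> f ` (sphere 0 1 \<inter> caps k)"
      proof
        assume "z \<in> f ` (sphere 0 1 \<inter> caps k)"
        then obtain y where "y \<in> sphere 0 1" "y \<in> caps k" "f x = f y" using x(3) by auto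
        then show False using inj[of y] k by simp
      qed
      moreover have "z \<noteq> \<Psi> k 0" using f_off_caps[OF x(1) k] x \<Psi>_inj[of k x 0] by auto
      ultimately show ?thesis by (simp add: U_def)
    qed
    moreover have "\<Psi>i k y = g y" if y: "y \<in> f ` (sphere 0 1 - K) \<inter> U" for y
    proof -
      obtain w where w: "w \<in> sphere 0 1" "y = f w" using y by blast
      then have "w \<notin> caps k" using y by (auto simp: U_def)
      then have "y = \<Psi> k w" using f_off_caps w by simp
      then have "\<Psi>i k y = w" using homeo[of k] by (simp add: homeo_pair_def)
      then show ?thesis using gf w by simp
    qed
    ultimately show "\<exists>U F. z \<in> U \<and> smooth_on_open F U \<and> (\<forall>y\<in>f ` (sphere 0 1 - K) \<inter> U. F y = g y)"
      by (intro exI[of _ U] exI[of _ "\<Psi>i k"]) simp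
  qed
  ultimately show ?thesis unfolding diffeomorphism_onto_image_def off using gf by (intro conjI exI[of _ g]) auto
qed

lemma energy_bound:
  obtains E where "0 \<le> E" "\<And>k. energy (\<Psi> k) \<le> ennreal E"
proof -
  have "integrable sphere_measure (\<lambda>x. dnorm (\<Psi> 0) x ^ (DIM('a) - 1))"
    by (intro integrable_sphere_continuous continuous_intros dnorm_continuous_on[OF \<Psi>_smooth]) auto
  then have e0: "energy (\<Psi> 0) = ennreal (LINT x|sphere_measure. dnorm (\<Psi> 0) x ^ (DIM('a) - 1))" (is "_ = ennreal ?I")
    unfolding energy_def by (rule nn_integral_eq_integral) (auto simp: dnorm_nonneg)
  have I: "0 \<le> ?I" by (rule integral_nonneg_AE) (auto simp: dnorm_nonneg)
  have "energy (\<Psi> k) \<le> ennreal (?I + 2)" for k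
  proof -
    have "(\<Sum>i=0..<k. (1/2) ^ i) \<le> (2::real)"
      using sum_gp_strict[of "1/2 :: real" k] by (simp add: atLeast0LessThan)
    moreover have "energy (\<Psi> k) \<le> energy (\<Psi> 0) + ennreal (\<Sum>i=0..<k. (1/2) ^ i)"
      using refines_le[of 0 k] by (simp add: refines_def)
    ultimately have "energy (\<Psi> k) \<le> ennreal ?I + ennreal 2"
      unfolding e0 by (meson add_left_mono ennreal_leI order_trans)
    then show ?thesis using I by (simp add: ennreal_plus)
  qed
  then show ?thesis using that[of "?I + 2"] I by simp
qed

lemma sets_sphere_closed: "closed A \<Longrightarrow> sphere 0 1 \<inter> A \<in> sets (sphere_measure :: 'a measure)"
  by (auto simp: sets_restrict_space)

lemma emeasure_caps_tendsto: "(\<lambda>k. emeasure (sphere_measure :: 'a measure) (sphere 0 1 \<inter> caps k)) \<longlonglongrightarrow> 0"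
proof -
  define M where "M = 2 * DIM('a) * unit_ball_vol DIM('a) * 2 ^ DIM('a)"
  have M: "0 \<le> M" by (simp add: M_def)
  have single: "emeasure (sphere_measure :: 'a measure) (sphere 0 1 \<inter> cap \<tau>) \<le> ennreal (M * (2 * rad \<tau>) powr eps k)" if \<tau>: "\<tau> \<in> T k" for \<tau> k
  proof -
    note t = task[OF \<tau>]
    have r: "0 < 2 * rad \<tau>" "2 * rad \<tau> \<le> 1" using t(2,6) eps(2)[of k] by linarith+
    have "emeasure (sphere_measure :: 'a measure) (sphere 0 1 \<inter> cap \<tau>) \<le> emeasure sphere_measure (sphere 0 1 \<inter> ball (tip \<tau>) (2 * rad \<tau>))"
      using t(2) by (intro emeasure_mono) (auto simp: sets_restrict_space)
    also have "\<dots> \<le> ennreal (M * (2 * rad \<tau>) ^ (DIM('a) - 1))"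
      using emeasure_cap_le[OF t(1) r] by (simp add: M_def)
    also have "\<dots> \<le> ennreal (M * (2 * rad \<tau>) powr eps k)"
    proof (intro ennreal_leI mult_left_mono M)
      have "(2 * rad \<tau>) ^ (DIM('a) - 1) \<le> (2 * rad \<tau>) ^ 1" using r dim by (intro power_decreasing) auto
      also have "\<dots> = (2 * rad \<tau>) powr 1" using r by simp
      also have "\<dots> \<le> (2 * rad \<tau>) powr eps k" using r eps(2)[of k] by (intro powr_mono') auto
      finally show "(2 * rad \<tau>) ^ (DIM('a) - 1) \<le> (2 * rad \<tau>) powr eps k" .
    qed
    finally show ?thesis .
  qed
  have le: "emeasure (sphere_measure :: 'a measure) (sphere 0 1 \<inter> caps k) \<le> ennreal (M * eps k)" for k
  proof -
    have "sphere 0 1 \<inter> caps k = (\<Union>\<tau>\<in>T k. sphere 0 1 \<inter> cap \<tau>)" by (auto simp: caps_def)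
    then have "emeasure (sphere_measure :: 'a measure) (sphere 0 1 \<inter> caps k) \<le> (\<Sum>\<tau>\<in>T k. emeasure sphere_measure (sphere 0 1 \<inter> cap \<tau>))"
      using finite_T[of k] by (simp only:) (intro emeasure_subadditive_finite, auto simp: sets_restrict_space)
    also have "\<dots> \<le> (\<Sum>\<tau>\<in>T k. ennreal (M * (2 * rad \<tau>) powr eps k))" using single by (rule sum_mono)
    also have "\<dots> = ennreal (M * (\<Sum>\<tau>\<in>T k. (2 * rad \<tau>) powr eps k))"
      using M by (subst sum_ennreal) (auto simp: sum_distrib_left)
    also have "\<dots> \<le> ennreal (M * eps k)" using sum_rad_powr_le M by (intro ennreal_leI mult_left_mono)
    finally show ?thesis .
  qed
  have "(\<lambda>k. ennreal (M * eps k)) \<longlonglongrightarrow> ennreal (M * 0)" by (intro tendsto_ennrealI tendsto_intros eps_tendsto_0)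
  then have lim: "(\<lambda>k. ennreal (M * eps k)) \<longlonglongrightarrow> 0" by simp
  show ?thesis
    by (rule tendsto_sandwich[OF _ _ tendsto_const lim]) (use le in auto)
qed

definition grad :: "'a \<Rightarrow> nat \<Rightarrow> 'a \<Rightarrow> 'a" where
  "grad b k = sphere_grad (\<lambda>x. \<Psi> k x \<bullet> b)"

text \<open>On \<open>K\<close>, a null set, this is a default value; elsewhere the gradients of \<open>\<Psi> k\<close> are constant from some \<open>k\<close> on.\<close>

definition limit_grad :: "'a \<Rightarrow> 'a \<Rightarrow> 'a" where
  "limit_grad b x = (if x \<in> K then 0 else grad b (LEAST k. x \<notin> caps k) x)"

lemma component_smooth: "smooth_on_open (\<lambda>x. \<Psi> k x \<bullet> b) (- {0})"
  by (rule smooth_on_open_compose_linear[OF bounded_linear_inner_left \<Psi>_smooth])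

lemma grad_continuous: "continuous_on (sphere 0 1) (grad b k)"
proof -
  have "continuous_on (sphere 0 1) (\<lambda>x. frechet_derivative (\<lambda>x. \<Psi> k x \<bullet> b) (at x) v)" for v
    by (rule continuous_on_subset[OF smooth_on_open_continuous[OF smooth_on_open_frechet[OF component_smooth]]]) auto
  then show ?thesis unfolding grad_def sphere_grad_def[abs_def] tangential_def by (intro continuous_intros)
qed

lemma norm_grad_le:
  assumes b: "b \<in> Basis" and x: "x \<in> sphere 0 1"
  shows "norm (grad b k x) \<le> dnorm (\<Psi> k) x"
proof -
  have x0: "x \<noteq> 0" "x \<bullet> x = 1" using x by (auto simp: dot_square_norm)
  have "(\<Psi> k has_derivative frechet_derivative (\<Psi> k) (at x)) (at x)"
    using smooth_on_open_has_derivative[OF \<Psi>_smooth] x0 by auto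
  then have "((\<lambda>x. \<Psi> k x \<bullet> b) has_derivative (\<lambda>v. frechet_derivative (\<Psi> k) (at x) v \<bullet> b)) (at x)"
    by (rule has_derivative_inner_left)
  from frechet_derivative_at[OF this, symmetric]
  have fd: "frechet_derivative (\<lambda>x. \<Psi> k x \<bullet> b) (at x) v = frechet_derivative (\<Psi> k) (at x) v \<bullet> b" for v by simp
  define w where "w = (\<Sum>e\<in>Basis. (frechet_derivative (\<Psi> k) (at x) e \<bullet> b) *\<^sub>R e)"
  have "norm (tangential x w) \<le> norm w"
  proof (rule power2_le_imp_le)
    have "(norm (tangential x w))\<^sup>2 = (norm w)\<^sup>2 - (w \<bullet> x)\<^sup>2"
      unfolding power2_norm_eq_inner tangential_def using x0(2)
      by (simp add: inner_diff_left inner_diff_right inner_commute power2_eq_square algebra_simps)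
    then show "(norm (tangential x w))\<^sup>2 \<le> (norm w)\<^sup>2" by simp
  qed simp
  also have "norm w \<le> (\<Sum>e\<in>Basis. norm (frechet_derivative (\<Psi> k) (at x) e))"
    unfolding w_def by (rule sum_norm_le) (use Basis_le_norm[OF b] in auto)
  finally show ?thesis by (simp add: grad_def sphere_grad_def fd w_def dnorm_def)
qed

lemma limit_grad_eq:
  assumes "x \<in> sphere 0 1" "x \<notin> caps k"
  shows "limit_grad b x = grad b k x"
proof -
  define m where "m = (LEAST k. x \<notin> caps k)"
  have m: "x \<notin> caps m" "m \<le> k" 
    unfolding m_def using LeastI[of "\<lambda>k. x \<notin> caps k" k] Least_le[of "\<lambda>k. x \<notin> caps k" k] assms(2) by auto
  have "x \<notin> K" using assms(2) by (auto simp: K_def)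
  then have eq: "limit_grad b x = grad b m x" by (simp add: limit_grad_def m_def)
  obtain V where V: "open V" "sphere 0 1 - caps m \<subseteq> V" "\<And>x. x \<in> V \<Longrightarrow> \<Psi> k x = \<Psi> m x"
    using agree_off_caps[OF m(2)] by metis
  have xV: "x \<in> V" using V(2) assms(1) m(1) by blast
  have "x \<noteq> 0" using assms(1) by auto
  then have "(\<lambda>x. \<Psi> m x \<bullet> b) differentiable (at x)" using smooth_on_open_differentiable[OF component_smooth] by auto
  then have "frechet_derivative (\<lambda>x. \<Psi> m x \<bullet> b) (at x) = frechet_derivative (\<lambda>x. \<Psi> k x \<bullet> b) (at x)"
    by (rule frechet_derivative_transform_within_open[OF _ V(1) xV]) (simp add: V(3))
  then show ?thesis unfolding eq by (simp add: grad_def sphere_grad_def)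
qed

lemma limit_grad_tendsto:
  assumes "x \<in> sphere 0 1"
  shows "(\<lambda>k. indicator (- caps k) x *\<^sub>R grad b k x) \<longlonglongrightarrow> limit_grad b x"
proof (cases "x \<in> K")
  case True
  then have "indicator (- caps k) x = (0::real)" for k by (simp add: K_def)
  then show ?thesis using True by (simp add: limit_grad_def)
next
  case False
  then obtain k where k: "x \<notin> caps k" using assms by (auto simp: K_def)
  have "indicator (- caps l) x *\<^sub>R grad b l x = limit_grad b x" if "k \<le> l" for l
  proof -
    have "x \<notin> caps l" using k caps_decreasing[OF that] by blast
    then show ?thesis using limit_grad_eq[OF assms, of l b] by simp
  qed
  then show ?thesis by (intro tendsto_eventually eventually_sequentiallyI)
qed

lemma cut_grad_measurable: "(\<lambda>x. indicator (- caps k) x *\<^sub>R grad b k x) \<in> borel_measurable sphere_measure"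
proof -
  have "(indicator (- caps k) :: 'a \<Rightarrow> real) \<in> borel_measurable borel"
    using closed_caps[of k] by (intro borel_measurable_indicator) (auto simp: open_Compl)
  then have "(indicator (- caps k) :: 'a \<Rightarrow> real) \<in> borel_measurable (restrict_space borel (sphere 0 1))"
    by (rule measurable_restrict_space1)
  then have "(indicator (- caps k) :: 'a \<Rightarrow> real) \<in> borel_measurable sphere_measure"
    by (simp cong: measurable_cong_sets)
  then show ?thesis
    by (rule borel_measurable_scaleR[OF _ borel_measurable_sphere_continuous[OF grad_continuous]])
qed

lemma limit_grad_measurable: "limit_grad b \<in> borel_measurable sphere_measure"
  by (rule borel_measurable_LIMSEQ_metric[OF cut_grad_measurable]) (use limit_grad_tendsto in auto)

text \<open>Fatou's lemma for the gradients cut off on the caps, which converge everywhere on the sphere.\<close>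

lemma limit_grad_energy:
  assumes b: "b \<in> Basis" and E: "\<And>k. energy (\<Psi> k) \<le> ennreal E"
  shows "(\<integral>\<^sup>+x. ennreal (norm (limit_grad b x) ^ (DIM('a) - 1)) \<partial>sphere_measure) \<le> ennreal E"
proof -
  let ?n = "DIM('a) - 1"
  let ?u = "\<lambda>k x. ennreal (norm (indicator (- caps k) x *\<^sub>R grad b k x) ^ ?n)"
  have lim: "(\<lambda>k. ?u k x) \<longlonglongrightarrow> ennreal (norm (limit_grad b x) ^ ?n)" if "x \<in> sphere 0 1" for x
    by (intro tendsto_ennrealI tendsto_intros limit_grad_tendsto that)
  have "(\<integral>\<^sup>+x. ennreal (norm (limit_grad b x) ^ ?n) \<partial>sphere_measure) = (\<integral>\<^sup>+x. liminf (\<lambda>k. ?u k x) \<partial>sphere_measure)"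
    by (rule nn_integral_cong, rule lim_imp_Liminf[OF _ lim, symmetric]) auto
  also have "\<dots> \<le> liminf (\<lambda>k. \<integral>\<^sup>+x. ?u k x \<partial>sphere_measure)"
    by (rule nn_integral_liminf) (intro measurable_compose[OF _ measurable_ennreal] borel_measurable_power measurable_norm_comp cut_grad_measurable)
  also have "\<dots> \<le> ennreal E"
  proof (rule Liminf_le)
    show "\<forall>\<^sub>F k in sequentially. (\<integral>\<^sup>+x. ?u k x \<partial>sphere_measure) \<le> ennreal E"
    proof (rule always_eventually, rule allI)
      fix k
      have "(\<integral>\<^sup>+x. ?u k x \<partial>sphere_measure) \<le> energy (\<Psi> k)"
        unfolding energy_def
      proof (intro nn_integral_mono ennreal_leI power_mono)
        fix x :: 'a assume "x \<in> space sphere_measure"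
        then have "norm (grad b k x) \<le> dnorm (\<Psi> k) x" using norm_grad_le[OF b] by simp
        then show "norm (indicator (- caps k) x *\<^sub>R grad b k x) \<le> dnorm (\<Psi> k) x"
          using dnorm_nonneg[of "\<Psi> k" x] by (simp add: indicator_def)
      qed simp
      then show "(\<integral>\<^sup>+x. ?u k x \<partial>sphere_measure) \<le> ennreal E" using E order_trans by blast
    qed
  qed simp
  finally show ?thesis .
qed

lemma powr_dim: "0 \<le> t \<Longrightarrow> t powr real (DIM('a) - 1) = t ^ (DIM('a) - 1)"
  using dim powr_realpow[of t "DIM('a) - 1"] by (cases "t = 0") (simp_all only: powr_0 power_0_left, auto)

lemma limit_grad_integrable:
  assumes b: "b \<in> Basis"
  shows "integrable sphere_measure (\<lambda>x. norm (limit_grad b x) ^ (DIM('a) - 1))" "integrable sphere_measure (limit_grad b)"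
proof -
  interpret finite_measure "sphere_measure :: 'a measure" by (rule finite_sphere_measure)
  let ?n = "DIM('a) - 1"
  obtain E where E: "\<And>k. energy (\<Psi> k) \<le> ennreal E" using energy_bound by metis
  show i: "integrable sphere_measure (\<lambda>x. norm (limit_grad b x) ^ ?n)"
  proof (rule integrableI_bounded)
    have "(\<integral>\<^sup>+x. ennreal (norm (norm (limit_grad b x) ^ ?n)) \<partial>sphere_measure) \<le> ennreal E"
      using limit_grad_energy[OF b E] by simp
    also have "\<dots> < \<infinity>" by simp
    finally show "(\<integral>\<^sup>+x. ennreal (norm (norm (limit_grad b x) ^ ?n)) \<partial>sphere_measure) < \<infinity>" .
  qed (intro borel_measurable_power measurable_norm_comp limit_grad_measurable)
  show "integrable sphere_measure (limit_grad b)"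
  proof (rule Bochner_Integration.integrable_bound[OF _ limit_grad_measurable])
    show "integrable sphere_measure (\<lambda>x. 1 + norm (limit_grad b x) ^ ?n)" using i by simp
    have "t \<le> 1 + t ^ ?n" if "0 \<le> t" for t :: real
    proof (cases "t \<le> 1")
      case False
      then have "t ^ 1 \<le> t ^ ?n" using dim by (intro power_increasing) auto
      then show ?thesis by simp
    qed (use that in \<open>simp add: add_increasing2\<close>)
    then show "AE x in sphere_measure. norm (limit_grad b x) \<le> norm (1 + norm (limit_grad b x) ^ ?n)"
      by (intro AE_I2) (simp add: add_nonneg_nonneg)
  qed
qed

text \<open>The two gradients differ only on the caps, whose measure tends to zero while both gradients are bounded
  in \<open>L\<^sup>n\<close> with \<open>n \<ge> 2\<close>.\<close>

lemma integral_against_bounded_tendsto: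
  fixes X :: "'a \<Rightarrow> 'a"
  assumes b: "b \<in> Basis" and X: "continuous_on (sphere 0 1) X"
  shows "(\<lambda>k. LINT x|sphere_measure. grad b k x \<bullet> X x) \<longlonglongrightarrow> (LINT x|sphere_measure. limit_grad b x \<bullet> X x)"
proof -
  let ?n = "DIM('a) - 1"
  have n2: "2 \<le> ?n" using dim by simp
  obtain E where E: "0 \<le> E" "\<And>k. energy (\<Psi> k) \<le> ennreal E" using energy_bound by metis
  have "compact (X ` sphere 0 1)" using X compact_continuous_image compact_sphere by blast
  then obtain M where M: "\<And>x. x \<in> sphere 0 1 \<Longrightarrow> norm (X x) \<le> M"
    using compact_imp_bounded bounded_iff by (metis (mono_tags, lifting) image_eqI)
  have mX: "X \<in> borel_measurable sphere_measure" using X by (rule borel_measurable_sphere_continuous)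
  define A where "A k = sphere 0 1 \<inter> caps k" for k
  have A: "A k \<in> sets (sphere_measure :: 'a measure)" for k
    unfolding A_def by (rule sets_sphere_closed[OF closed_caps])
  have A0: "(\<lambda>k. emeasure (sphere_measure :: 'a measure) (A k)) \<longlonglongrightarrow> 0"
    unfolding A_def by (rule emeasure_caps_tendsto)
  have small1: "(\<lambda>k. \<integral>\<^sup>+x. indicator (A k) x * ennreal (norm (grad b k x)) \<partial>sphere_measure) \<longlonglongrightarrow> 0"
  proof (rule set_integral_small_of_Ln_bounded[OF n2 A A0 _ _ E(1)])
    show "(\<lambda>x. norm (grad b k x)) \<in> borel_measurable sphere_measure" for k
      by (intro measurable_norm_comp borel_measurable_sphere_continuous grad_continuous)
    show "(\<integral>\<^sup>+x. ennreal (norm (grad b k x) ^ ?n) \<partial>sphere_measure) \<le> ennreal E" for k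
    proof -
      have "(\<integral>\<^sup>+x. ennreal (norm (grad b k x) ^ ?n) \<partial>sphere_measure) \<le> energy (\<Psi> k)"
        unfolding energy_def by (intro nn_integral_mono ennreal_leI power_mono norm_grad_le[OF b]) auto
      then show ?thesis using E(2) order_trans by blast
    qed
  qed simp
  have small2: "(\<lambda>k. \<integral>\<^sup>+x. indicator (A k) x * ennreal (norm (limit_grad b x)) \<partial>sphere_measure) \<longlonglongrightarrow> 0"
    by (rule set_integral_small_of_Ln_bounded[OF n2 A A0 _ _ E(1) limit_grad_energy[OF b E(2)]])
      (intro measurable_norm_comp limit_grad_measurable, simp)
  have ig: "integrable sphere_measure (\<lambda>x. grad b k x \<bullet> X x)" for k
    by (intro integrable_sphere_continuous continuous_intros grad_continuous X)
  have il: "integrable sphere_measure (\<lambda>x. limit_grad b x \<bullet> X x)"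
  proof (rule Bochner_Integration.integrable_bound)
    show "integrable sphere_measure (\<lambda>x. M * norm (limit_grad b x))"
      using limit_grad_integrable(2)[OF b] by (intro integrable_mult_right integrable_norm)
    show "(\<lambda>x. limit_grad b x \<bullet> X x) \<in> borel_measurable sphere_measure"
      by (intro borel_measurable_inner limit_grad_measurable mX)
    show "AE x in sphere_measure. norm (limit_grad b x \<bullet> X x) \<le> norm (M * norm (limit_grad b x))"
    proof (rule AE_I2)
      fix x :: 'a assume "x \<in> space sphere_measure"
      then have "norm (X x) \<le> M" using M by simp
      then have "norm (limit_grad b x) * norm (X x) \<le> norm (limit_grad b x) * M" by (intro mult_left_mono) auto
      moreover have "0 \<le> M" using \<open>norm (X x) \<le> M\<close> norm_ge_zero order_trans by blast
      ultimately show "norm (limit_grad b x \<bullet> X x) \<le> norm (M * norm (limit_grad b x))"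
        using Cauchy_Schwarz_ineq2[of "limit_grad b x" "X x"] by (simp add: abs_mult mult.commute)
    qed
  qed
  have bound: "ennreal (norm ((LINT x|sphere_measure. grad b k x \<bullet> X x) - (LINT x|sphere_measure. limit_grad b x \<bullet> X x)))
    \<le> ennreal M * ((\<integral>\<^sup>+x. indicator (A k) x * ennreal (norm (grad b k x)) \<partial>sphere_measure)
        + (\<integral>\<^sup>+x. indicator (A k) x * ennreal (norm (limit_grad b x)) \<partial>sphere_measure))" for k
  proof -
    have m1: "(\<lambda>x. indicator (A k) x * ennreal (norm (grad b k x))) \<in> borel_measurable sphere_measure"
      using A[of k] by (intro borel_measurable_times_ennreal borel_measurable_indicator measurable_compose[OF _ measurable_ennreal]
          measurable_norm_comp borel_measurable_sphere_continuous grad_continuous)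
    have m2: "(\<lambda>x. indicator (A k) x * ennreal (norm (limit_grad b x))) \<in> borel_measurable sphere_measure"
      using A[of k] by (intro borel_measurable_times_ennreal borel_measurable_indicator measurable_compose[OF _ measurable_ennreal]
          measurable_norm_comp limit_grad_measurable)
    have "norm ((LINT x|sphere_measure. grad b k x \<bullet> X x) - (LINT x|sphere_measure. limit_grad b x \<bullet> X x))
        = norm (LINT x|sphere_measure. grad b k x \<bullet> X x - limit_grad b x \<bullet> X x)"
      using Bochner_Integration.integral_diff[OF ig il] by simp
    then have "ennreal (norm ((LINT x|sphere_measure. grad b k x \<bullet> X x) - (LINT x|sphere_measure. limit_grad b x \<bullet> X x)))
        \<le> (\<integral>\<^sup>+x. ennreal (norm (grad b k x \<bullet> X x - limit_grad b x \<bullet> X x)) \<partial>sphere_measure)"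
      using integral_norm_bound_ennreal[OF Bochner_Integration.integrable_diff[OF ig il]] by simp
    also have "\<dots> \<le> (\<integral>\<^sup>+x. ennreal M * (indicator (A k) x * ennreal (norm (grad b k x)) + indicator (A k) x * ennreal (norm (limit_grad b x))) \<partial>sphere_measure)"
    proof (rule nn_integral_mono)
      fix x :: 'a assume "x \<in> space sphere_measure"
      then have x: "x \<in> sphere 0 1" by simp
      show "ennreal (norm (grad b k x \<bullet> X x - limit_grad b x \<bullet> X x))
        \<le> ennreal M * (indicator (A k) x * ennreal (norm (grad b k x)) + indicator (A k) x * ennreal (norm (limit_grad b x)))"
      proof (cases "x \<in> caps k")
        case False
        then show ?thesis using limit_grad_eq[OF x False] by simp
      next
        case True
        have M0: "0 \<le> M" using M[OF x] norm_ge_zero order_trans by blast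
        have "norm (grad b k x \<bullet> X x - limit_grad b x \<bullet> X x) = \<bar>(grad b k x - limit_grad b x) \<bullet> X x\<bar>"
          by (simp add: inner_diff_left)
        also have "\<dots> \<le> norm (grad b k x - limit_grad b x) * norm (X x)" by (rule Cauchy_Schwarz_ineq2)
        also have "\<dots> \<le> (norm (grad b k x) + norm (limit_grad b x)) * M"
          using M[OF x] norm_triangle_ineq4 by (intro mult_mono) auto
        finally have "ennreal (norm (grad b k x \<bullet> X x - limit_grad b x \<bullet> X x))
            \<le> ennreal ((norm (grad b k x) + norm (limit_grad b x)) * M)" by (rule ennreal_leI)
        also have "\<dots> = ennreal M * (ennreal (norm (grad b k x)) + ennreal (norm (limit_grad b x)))"
          using M0 by (simp add: ennreal_mult ennreal_plus mult.commute)
        finally show ?thesis using True x by (simp add: A_def)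
      qed
    qed
    also have "\<dots> = ennreal M * ((\<integral>\<^sup>+x. indicator (A k) x * ennreal (norm (grad b k x)) \<partial>sphere_measure)
        + (\<integral>\<^sup>+x. indicator (A k) x * ennreal (norm (limit_grad b x)) \<partial>sphere_measure))"
      by (subst nn_integral_cmult[OF borel_measurable_add[OF m1 m2]]) (simp add: nn_integral_add[OF m1 m2])
    finally show ?thesis .
  qed
  have "(\<lambda>k. ennreal M * ((\<integral>\<^sup>+x. indicator (A k) x * ennreal (norm (grad b k x)) \<partial>sphere_measure)
        + (\<integral>\<^sup>+x. indicator (A k) x * ennreal (norm (limit_grad b x)) \<partial>sphere_measure))) \<longlonglongrightarrow> ennreal M * (0 + 0)"
    by (intro ennreal_tendsto_cmult tendsto_add small1 small2) simp
  then have "(\<lambda>k. ennreal M * ((\<integral>\<^sup>+x. indicator (A k) x * ennreal (norm (grad b k x)) \<partial>sphere_measure)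
        + (\<integral>\<^sup>+x. indicator (A k) x * ennreal (norm (limit_grad b x)) \<partial>sphere_measure))) \<longlonglongrightarrow> ennreal 0" by simp
  then have "(\<lambda>k. ennreal (norm ((LINT x|sphere_measure. grad b k x \<bullet> X x) - (LINT x|sphere_measure. limit_grad b x \<bullet> X x)))) \<longlonglongrightarrow> ennreal 0"
    by (rule tendsto_sandwich[OF _ _ tendsto_const, rotated 2]) (use bound in auto)
  then have "(\<lambda>k. norm ((LINT x|sphere_measure. grad b k x \<bullet> X x) - (LINT x|sphere_measure. limit_grad b x \<bullet> X x))) \<longlonglongrightarrow> 0"
    by (subst (asm) tendsto_ennreal_iff) auto
  then show ?thesis by (rule LIM_zero_cancel[OF tendsto_norm_zero_cancel])
qed

lemma f_Sobolev:
  assumes b: "b \<in> Basis"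
  shows "(\<lambda>x. f x \<bullet> b) \<in> sphere_W1p (real (DIM('a) - 1))"
  unfolding sphere_W1p_def
proof (intro CollectI conjI exI[of _ "limit_grad b"])
  let ?n = "DIM('a) - 1"
  have cf: "continuous_on (sphere 0 1) (\<lambda>x. f x \<bullet> b)" by (intro continuous_intros f_continuous)
  have "integrable sphere_measure (\<lambda>x. norm (f x \<bullet> b) ^ ?n)"
    by (intro integrable_sphere_continuous continuous_intros cf)
  then show "sphere_Lp (real ?n) (\<lambda>x. f x \<bullet> b)"
    unfolding sphere_Lp_def powr_dim[OF norm_ge_zero] using borel_measurable_sphere_continuous[OF cf] by simp
  show "sphere_Lp (real ?n) (limit_grad b)"
    unfolding sphere_Lp_def powr_dim[OF norm_ge_zero]
    using limit_grad_measurable limit_grad_integrable(1)[OF b] by simp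
  show "sphere_weak_gradient (\<lambda>x. f x \<bullet> b) (limit_grad b)"
    unfolding sphere_weak_gradient_def
  proof (intro conjI ballI AE_I2)
    fix x :: 'a assume "x \<in> space sphere_measure"
    then show "limit_grad b x \<bullet> x = 0"
      by (simp add: limit_grad_def grad_def sphere_grad_def tangential_def inner_diff_left dot_square_norm)
  next
    fix X :: "'a \<Rightarrow> 'a" assume X: "X \<in> sphere_vector_fields"
    have smX: "smooth_on_open X UNIV" using X by (simp add: sphere_vector_fields_def)
    have cX: "continuous_on (sphere 0 1) X"
      by (rule continuous_on_subset[OF smooth_on_open_continuous[OF smX]]) auto
    have cD: "continuous_on (sphere 0 1) (sphere_div X)" by (rule sphere_div_continuous[OF smX])
    have weak: "(LINT x|sphere_measure. grad b k x \<bullet> X x) = - (LINT x|sphere_measure. (\<Psi> k x \<bullet> b) * sphere_div X x)" for k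
      using sphere_weak_gradient_smooth[OF component_smooth] X unfolding grad_def sphere_weak_gradient_def by blast
    have "compact (sphere_div X ` sphere 0 1)" using cD compact_continuous_image compact_sphere by blast
    then obtain M where M: "\<And>x. x \<in> sphere 0 1 \<Longrightarrow> \<bar>sphere_div X x\<bar> \<le> M"
      using compact_imp_bounded bounded_iff by (metis (mono_tags, lifting) image_eqI real_norm_def)
    have "(\<lambda>k. LINT x|sphere_measure. (\<Psi> k x \<bullet> b) * sphere_div X x) \<longlonglongrightarrow> (LINT x|sphere_measure. (f x \<bullet> b) * sphere_div X x)"
    proof (rule integral_dominated_convergence)
      show "(\<lambda>x. (f x \<bullet> b) * sphere_div X x) \<in> borel_measurable sphere_measure"
        by (intro borel_measurable_sphere_continuous continuous_intros cf cD)
      show "(\<lambda>x. (\<Psi> k x \<bullet> b) * sphere_div X x) \<in> borel_measurable sphere_measure" for k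
        by (intro borel_measurable_sphere_continuous continuous_intros \<Psi>_cont cD)
      show "integrable sphere_measure (\<lambda>x. (norm (f x) + 8) * M)"
        by (intro integrable_sphere_continuous continuous_intros f_continuous)
      show "AE x in sphere_measure. (\<lambda>k. (\<Psi> k x \<bullet> b) * sphere_div X x) \<longlonglongrightarrow> (f x \<bullet> b) * sphere_div X x"
        by (intro AE_I2 tendsto_intros f_tendsto) simp
      show "AE x in sphere_measure. norm ((\<Psi> k x \<bullet> b) * sphere_div X x) \<le> (norm (f x) + 8) * M" for k
      proof (rule AE_I2)
        fix x :: 'a assume "x \<in> space sphere_measure"
        then have x: "x \<in> sphere 0 1" by simp
        have "\<bar>\<Psi> k x \<bullet> b\<bar> \<le> norm (\<Psi> k x)" by (rule Basis_le_norm[OF b])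
        also have "\<dots> \<le> norm (f x) + dist (f x) (\<Psi> k x)"
          using norm_triangle_ineq2[of "\<Psi> k x" "f x"] by (simp add: dist_norm norm_minus_commute)
        also have "\<dots> \<le> norm (f x) + 8" using f_close[OF x, of k] eps(2)[of k] by linarith
        finally show "norm ((\<Psi> k x \<bullet> b) * sphere_div X x) \<le> (norm (f x) + 8) * M"
          using M[OF x] by (simp add: abs_mult mult_mono)
      qed
    qed
    then have "(\<lambda>k. LINT x|sphere_measure. grad b k x \<bullet> X x) \<longlonglongrightarrow> - (LINT x|sphere_measure. (f x \<bullet> b) * sphere_div X x)"
      unfolding weak by (rule tendsto_minus)
    then show "(LINT x|sphere_measure. limit_grad b x \<bullet> X x) = - (LINT x|sphere_measure. (f x \<bullet> b) * sphere_div X x)"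
      by (rule LIMSEQ_unique[OF integral_against_bounded_tendsto[OF b cX]])
  qed
qed

end

theorem theorem1p1:
  fixes n :: nat and C :: "(real ^ 'm) set"
  assumes "n \<ge> 2" and "CARD('m) = n + 1" and "cantor_set C"
  shows "\<exists>f :: real ^ 'm \<Rightarrow> real ^ 'm.
           (\<exists>g. homeomorphism (sphere 0 1) (f ` sphere 0 1) f g) \<and>
           (\<forall>i. (\<lambda>x. f x $ i) \<in> sphere_W1p (real n)) \<and>
           C \<subseteq> f ` sphere 0 1 \<and>
           cantor_set (sphere 0 1 \<inter> f -` C) \<and>
           hausdorff_dim (sphere 0 1 \<inter> f -` C) = 0 \<and>
           diffeomorphism_onto_image f (sphere 0 1 - f -` C)"
proof -
  have dim3: "3 \<le> DIM(real ^ 'm)" and dim_n: "DIM(real ^ 'm) - 1 = n" using assms(1,2) by auto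
  note C = cantor_set_compact_totally_disconnected[OF assms(3)]
  obtain \<Psi> \<Psi>i :: "nat \<Rightarrow> real ^ 'm \<Rightarrow> real ^ 'm" and T where seq:
    "\<And>k. state C (\<Psi> k) (\<Psi>i k) (T k)"
    "\<And>k. refines ((1/2) ^ k) (\<Psi> k) (T k) (\<Psi> (Suc k)) (T (Suc k))"
    "\<And>k. fine_tasks C (\<Psi> k) (T k) (1 / Suc k)"
    by (rule state_sequence[OF dim3 C]) (rule that)
  interpret finger_sequence C \<Psi> \<Psi>i T
    by unfold_locales (use dim3 C(1) seq in auto)
  show ?thesis
  proof (rule exI[of _ f], intro conjI allI)
    show "(\<lambda>x. f x $ i) \<in> sphere_W1p (real n)" for i
      using f_Sobolev[of "axis i 1", unfolded dim_n] by (simp add: inner_axis axis_in_Basis_iff)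
    show "cantor_set (sphere 0 1 \<inter> f -` C)"
      using homeomorphic_trans[OF K_homeomorphic_C] assms(3) by (simp add: cantor_set_def preimage_C)
    show "hausdorff_dim (sphere 0 1 \<inter> f -` C) = 0" by (simp add: preimage_C hausdorff_dim_K)
  qed (rule f_homeomorphism C_subset f_diffeomorphism)+
qed

end
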